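(* Let $p>3$ be a prime and let $x,y,z$ be indeterminates (or arbitrary complex numbers). Then $$\det\left[x+\left(\frac{j+k-1}p\right)+\left(\frac jp\right)y+\left(\frac kp\right)z\right]_{1\le j,k\le(p-1)/2} =\begin{cases}\left(\frac 2p\right)2^{(p-1)/2}\big((yz-x)a_p+(y+1)(z+1)b_p\big)&\text{if } p\equiv1\pmod4,\\ 2^{(p-1)/2}(yz-x)&\text{if } p\equiv3\pmod4,\end{cases}$$ and $$\det\left[x+\left(\frac{j+k-1}p\right)+\left(\frac jp\right)y+\left(\frac kp\right)z\right]_{1\le j,k\le(p+1)/2} =\begin{cases}\left(\frac 2p\right)2^{(p-1)/2}\big(pb_p(x-yz)-a_p(y+1)(z+1)\big)&\text{if } p\equiv1\pmod4,\\ 2^{(p-1)/2}(y+1)(z+1)&\text{if } p\equiv3\pmod4.\end{cases}$$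
   Context: $\left(\frac{\cdot}{p}\right)$ is the Legendre symbol (zero on multiples of $p$). Let $\varepsilon_p$ and $h(p)$ be the fundamental unit and the class number of the real quadratic field $\mathbb Q(\sqrt p)$, and define $a_p,b_p$ by $\varepsilon_p^{h(p)}=a_p+b_p\sqrt p$ with $2a_p,2b_p\in\mathbb Z$. *)

theory Defs
  imports
    Complex_Main
    "HOL-Computational_Algebra.Polynomial"
    "HOL-Number_Theory.Residues"
    "HOL-Algebra.Ideal"
    "Jordan_Normal_Form.Determinant"
begin

text \<open>The real quadratic field \<open>\<rat>(\<surd>d)\<close>, as a subfield of the reals. The notions below
  carry their usual meaning when \<open>d\<close> is not a perfect square.\<close>

definition quad_field :: "nat \<Rightarrow> real set" where
  "quad_field d = {a + b * sqrt (real d) | a b. a \<in> \<rat> \<and> b \<in> \<rat>}"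

definition quad_int_ring :: "nat \<Rightarrow> real ring" where
  "quad_int_ring d =
     \<lparr>carrier = {x \<in> quad_field d. algebraic_int x}, monoid.mult = (*), one = 1, zero = 0, add = (+)\<rparr>"

text \<open>The generator, greater than 1, of the unit group modulo \<open>\<plusminus>1\<close>.\<close>

definition fundamental_unit :: "nat \<Rightarrow> real" where
  "fundamental_unit d =
     (THE \<epsilon>. \<epsilon> \<in> Units (quad_int_ring d) \<and> \<epsilon> > 1 \<and>
        (\<forall>u \<in> Units (quad_int_ring d). \<exists>n::int. u = \<epsilon> powi n \<or> u = - (\<epsilon> powi n)))"

definition nonzero_ideals :: "nat \<Rightarrow> real set set" where
  "nonzero_ideals d = {I. ideal I (quad_int_ring d) \<and> I \<noteq> {0}}"

text \<open>Ideal classes: \<open>I\<close> and \<open>J\<close> are equivalent iff \<open>\<alpha>I = \<beta>J\<close> for nonzero integers \<open>\<alpha>, \<beta>\<close>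
  of the field. As every fractional ideal is a scalar multiple of an integral one, the
  equivalence classes are the elements of the ideal class group.\<close>

definition ideal_class_rel :: "nat \<Rightarrow> (real set \<times> real set) set" where
  "ideal_class_rel d =
     {(I, J). I \<in> nonzero_ideals d \<and> J \<in> nonzero_ideals d \<and>
        (\<exists>\<alpha> \<in> carrier (quad_int_ring d) - {0}. \<exists>\<beta> \<in> carrier (quad_int_ring d) - {0}.
           (*) \<alpha> ` I = (*) \<beta> ` J)}"

definition class_number :: "nat \<Rightarrow> nat" where
  "class_number d = card (nonzero_ideals d // ideal_class_rel d)"

definition coeff_a :: "nat \<Rightarrow> real" where
  "coeff_a p = (THE a. 2 * a \<in> \<int> \<and>
     (\<exists>b. 2 * b \<in> \<int> \<and> fundamental_unit p ^ class_number p = a + b * sqrt (real p)))"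

definition coeff_b :: "nat \<Rightarrow> real" where
  "coeff_b p = (THE b. 2 * b \<in> \<int> \<and>
     (\<exists>a. 2 * a \<in> \<int> \<and> fundamental_unit p ^ class_number p = a + b * sqrt (real p)))"

definition legendre_entry ::
    "nat \<Rightarrow> complex \<Rightarrow> complex \<Rightarrow> complex \<Rightarrow> nat \<Rightarrow> nat \<Rightarrow> complex" where
  "legendre_entry p x y z j k =
     x + of_int (Legendre (int j + int k - 1) (int p))
       + of_int (Legendre (int j) (int p)) * y
       + of_int (Legendre (int k) (int p)) * z"

text \<open>Rows and columns of \<^const>\<open>mat\<close> are counted from 0, those of the matrix
  \<open>[\<dots>]\<^bsub>1 \<le> j, k \<le> n\<^esub>\<close> from 1; hence the shift by \<^const>\<open>Suc\<close>.\<close>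

definition legendre_mat ::
    "nat \<Rightarrow> complex \<Rightarrow> complex \<Rightarrow> complex \<Rightarrow> nat \<Rightarrow> complex mat" where
  "legendre_mat p x y z n = mat n n (\<lambda>(i, l). legendre_entry p x y z (Suc i) (Suc l))"

end

theory Submission
  imports "HOL-Number_Theory.Number_Theory" "HOL-Analysis.Analysis" Defs
begin

text \<open>Write \<open>n = (p - 1)/2\<close>, let \<open>R\<close> and \<open>N\<close> be the quadratic residues and nonresidues, and put
  \<open>\<rho> = \<Prod>\<^bsub>r \<in> R\<^esub> (1 - \<zeta>\<^sup>r)\<close> and \<open>\<nu> = \<Prod>\<^bsub>r \<in> N\<^esub> (1 - \<zeta>\<^sup>r)\<close> for a primitive \<open>p\<close>-th root of unity \<open>\<zeta>\<close>.
  The matrix is obtained by row and column operations from \<open>C + w J\<close>, where \<open>C\<close> is the Hankel matrix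
  with entries \<open>\<chi>(j + k - 1)\<close> and \<open>J\<close> is the all-ones matrix. Multiplied by the Gauss sum, the moments
  \<open>\<chi>(s)\<close> become \<open>2 \<Sum>\<^bsub>r \<in> R\<^esub> \<zeta>\<^sup>r\<^sup>s + 1 - p [p | s]\<close>, so \<open>C + w J\<close> is \<open>E\<^sup>T D E\<close> for a Vandermonde matrix \<open>E\<close>
  and a diagonal matrix plus a matrix of rank one; the determinant comes out in terms of \<open>\<rho>\<close> and \<open>\<nu>\<close>.

  For \<open>p \<equiv> 3 (mod 4)\<close> one has \<open>\<nu> = - \<rho>\<close> and \<open>\<rho> \<nu> = p\<close>. For \<open>p \<equiv> 1 (mod 4)\<close> it remains to see that
  \<open>\<nu>/\<surd>p = \<epsilon>\<^sub>p\<^sup>h\<close>. This is Dirichlet's class number formula, since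
  \<open>ln \<nu> - ln \<rho> = \<surd>p L(1, \<chi>)\<close>: the number of ideals of norm at most \<open>X\<close> is
  \<open>\<Sum>\<^bsub>m \<le> X\<^esub> \<Sum>\<^bsub>d | m\<^esub> \<chi>(d) \<sim> L(1, \<chi>) X\<close>, while each ideal class contributes
  \<open>\<sim> (2 ln \<epsilon>\<^sub>p/\<surd>p) X\<close> of them by a lattice point count. Finiteness of the class number is a by-product,
  and the determinants themselves provide a unit of norm \<open>-1\<close>.\<close>

section \<open>The quadratic character\<close>

text \<open>The link between the two sides of the formula is the number nu/sqrt p = A + B sqrt p
  with A = (nu - rho)/(2 sqrt p) and B = (rho + nu)/(2 p): for p = 1 mod 4 the determinants of C and
  their increments from C to C + J are, up to explicit factors, A and B. Two values of w suffice
  because the determinant of C + w J is affine in w. Three difficulties shape the rest. The sign of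
  the Gauss sum is never computed: passing from zeta to a nonresidue power of it flips the sign, so
  zeta is chosen to make it positive. Next, \<open>fundamental_unit\<close> is a definite
  description, hence a unit other than 1 and -1 is needed before anything can be said about it.
  Pell's equation is avoided: determinants with entries 1 and -1 carry enough powers of 2 to make 2A
  and 2B integers, and A^2 - p B^2 = -1 holds by rho nu = p. Finally, norm -1 lets a unit make both
  conjugates of any nonzero element positive, so that wide ideal classes can be counted by one
  sector; the units that still act are the powers of the square of the fundamental unit.\<close>

locale odd_prime =
  fixes p :: nat
  assumes prime_p: "prime p" and p_gt_3: "p > 3"
begin

abbreviation chi :: "int \<Rightarrow> int" where "chi x \<equiv> Legendre x (int p)"

definition n :: nat where "n = (p - 1) div 2"

lemma p_eq: "p = 2 * n + 1"
proof -
  have "odd p" using prime_p p_gt_3 by (simp add: prime_odd_nat)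
  then show ?thesis unfolding n_def by presburger
qed

lemma p_minus_1: "p - 1 = 2 * n"
  using p_eq by linarith

lemma n_ge_2: "n \<ge> 2"
  using p_eq p_gt_3 by linarith

lemma prime_int_p: "prime (int p)"
  using prime_p by simp

lemma chi_values: "chi x \<in> {-1, 0, 1}"
  by (auto simp: Legendre_def)

lemma chi_eq_0_iff: "chi x = 0 \<longleftrightarrow> int p dvd x"
  by (auto simp: Legendre_def cong_0_iff)

lemma chi_cong:
  assumes "[x = y] (mod int p)"
  shows "chi x = chi y"
proof -
  have "[x = 0] (mod int p) \<longleftrightarrow> [y = 0] (mod int p)"
    using assms by (meson cong_sym cong_trans)
  moreover have "QuadRes (int p) x \<longleftrightarrow> QuadRes (int p) y"
    unfolding QuadRes_def using assms by (meson cong_sym cong_trans)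
  ultimately show ?thesis by (simp add: Legendre_def)
qed

lemma chi_mod [simp]: "chi (x mod int p) = chi x"
  by (rule chi_cong) (simp add: unique_euclidean_semiring_class.cong_def)

text \<open>Two such values differ by at most 2, which is less than p. This turns congruences from
  Euler's criterion into equalities.\<close>

lemma chi_eqI:
  assumes "[a = b] (mod int p)" "a \<in> {-1, 0, 1}" "b \<in> {-1, 0, 1}"
  shows "a = b"
proof -
  have "int p dvd a - b" using assms(1) by (simp add: cong_iff_dvd_diff)
  moreover have "\<bar>a - b\<bar> < int p" using assms p_gt_3 by auto
  ultimately show ?thesis using dvd_imp_le_int[of "a - b" "int p"] by linarith
qed

lemma euler: "[chi x = x ^ n] (mod int p)"
  using euler_criterion[of p x] prime_p p_gt_3 by (simp add: n_def)

lemma chi_mult: "chi (x * y) = chi x * chi y"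
proof (rule chi_eqI)
  have "[chi x * chi y = x ^ n * y ^ n] (mod int p)"
    by (intro cong_mult euler)
  then show "[chi (x * y) = chi x * chi y] (mod int p)"
    using euler[of "x * y"] by (metis cong_sym cong_trans power_mult_distrib)
qed (use chi_values[of x] chi_values[of y] chi_values[of "x*y"] in auto)

lemma chi_1 [simp]: "chi 1 = 1"
proof -
  have "QuadRes (int p) 1" unfolding QuadRes_def by (rule exI[of _ 1]) simp
  moreover have "\<not> [1 = 0] (mod int p)" using p_gt_3 by (simp add: cong_0_iff)
  ultimately show ?thesis by (simp add: Legendre_def)
qed

lemma chi_0 [simp]: "chi 0 = 0"
  by (simp add: Legendre_def)

lemma chi_square: "\<not> int p dvd x \<Longrightarrow> chi x * chi x = 1"
  using chi_values[of x] chi_eq_0_iff[of x] by auto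

lemma chi_minus_1: "chi (- 1) = (- 1) ^ n"
  by (rule chi_eqI[OF euler]) (use chi_values[of "-1"] in \<open>auto simp: minus_one_power_iff\<close>)

lemma not_dvd_nat: "r \<in> {1..<p} \<Longrightarrow> \<not> int p dvd int r"
  by (auto dest: dvd_imp_le)

lemma chi_nonzero: "r \<in> {1..<p} \<Longrightarrow> chi (int r) \<noteq> 0"
  using chi_eq_0_iff not_dvd_nat by blast

lemma bij_times:
  assumes "\<not> p dvd t"
  shows "bij_betw (\<lambda>r. r * t mod p) {..<p} {..<p}"
proof -
  have inj: "inj_on (\<lambda>r. r * t mod p) {..<p}"
  proof (rule inj_onI)
    fix r s assume rs: "r \<in> {..<p}" "s \<in> {..<p}" and "r * t mod p = s * t mod p"
    then have "[r * t = s * t] (mod p)" by (simp add: unique_euclidean_semiring_class.cong_def)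
    moreover have "coprime t p"
      using assms prime_p by (metis coprime_commute prime_imp_coprime)
    ultimately have "[r = s] (mod p)" by (simp add: cong_mult_rcancel_nat)
    then show "r = s" using rs by (simp add: unique_euclidean_semiring_class.cong_def)
  qed
  have "(\<lambda>r. r * t mod p) ` {..<p} \<subseteq> {..<p}"
    using p_gt_3 by auto
  with inj show ?thesis
    by (simp add: bij_betw_def endo_inj_surj)
qed

lemma bij_times_chi:
  assumes "\<not> p dvd t"
  shows "bij_betw (\<lambda>r. r * t mod p) {r \<in> {..<p}. chi (int r) = c} {r \<in> {..<p}. chi (int r) = c * chi (int t)}"
proof -
  have t: "chi (int t) * chi (int t) = 1" using chi_square assms by simp
  have eq: "chi (int (r * t mod p)) = chi (int r) * chi (int t)" for r
    by (metis chi_mod chi_mult of_nat_mod of_nat_mult)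
  have im: "(\<lambda>r. r * t mod p) ` {r \<in> {..<p}. chi (int r) = c} = {r \<in> {..<p}. chi (int r) = c * chi (int t)}"
  proof (intro equalityI subsetI)
    fix s assume s: "s \<in> {r \<in> {..<p}. chi (int r) = c * chi (int t)}"
    then obtain r where r: "r < p" "s = r * t mod p"
      using bij_times[OF assms] unfolding bij_betw_def by (metis (mono_tags, lifting) imageE lessThan_iff mem_Collect_eq)
    have "chi (int r) * chi (int t) = c * chi (int t)" using s eq[of r] r by simp
    then have "chi (int r) = c" using t by auto
    then show "s \<in> (\<lambda>r. r * t mod p) ` {r \<in> {..<p}. chi (int r) = c}" using r by auto
  qed (use eq p_gt_3 in auto)
  moreover have "inj_on (\<lambda>r. r * t mod p) {r \<in> {..<p}. chi (int r) = c}"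
    using bij_times[OF assms] unfolding bij_betw_def by (rule inj_on_subset[OF conjunct1]) auto
  ultimately show ?thesis by (simp add: bij_betw_def)
qed

text \<open>Otherwise squaring modulo p would map the residues onto themselves, hence injectively,
  although p - 1 and 1 have the same square.\<close>

lemma nonresidue_exists: "\<exists>g. \<not> p dvd g \<and> chi (int g) = -1"
proof (rule ccontr)
  assume no: "\<nexists>g. \<not> p dvd g \<and> chi (int g) = -1"
  have sq: "\<exists>y\<in>{..<p}. y * y mod p = r" if r: "r \<in> {..<p}" for r
  proof (cases "r = 0")
    case True then show ?thesis using p_gt_3 by (intro bexI[of _ 0]) auto
  next
    case False
    then have rS: "r \<in> {1..<p}" using r by auto
    then have "\<not> p dvd r" using not_dvd_nat by simp
    then have "chi (int r) = 1" using no chi_values[of "int r"] chi_nonzero[OF rS] by auto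
    then have "QuadRes (int p) (int r)" by (auto simp: Legendre_def split: if_splits)
    then obtain y where y: "[y\<^sup>2 = int r] (mod int p)" unfolding QuadRes_def by auto
    define z where "z = nat (y mod int p)"
    have z: "int z = y mod int p" "z < p" using p_gt_3 by (auto simp: z_def nat_less_iff)
    have "int (z * z mod p) = int r"
      using y r z(1) by (simp add: unique_euclidean_semiring_class.cong_def power2_eq_square zmod_int mod_mult_eq)
    then have "z * z mod p = r" by (simp only: of_nat_eq_iff)
    then show ?thesis using z by blast
  qed
  have "(\<lambda>y. y * y mod p) ` {..<p} = {..<p}"
    using sq p_gt_3 by (auto simp: image_iff)
  then have "inj_on (\<lambda>y. y * y mod p) {..<p}"
    by (simp add: eq_card_imp_inj_on)
  moreover have "(p - 1) * (p - 1) mod p = 1 * 1 mod p"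
  proof -
    obtain m where "p = m + 2" by (rule that[of "p - 2"]) (use p_gt_3 in simp)
    then have "(p - 1) * (p - 1) = m * p + 1" by (simp add: algebra_simps)
    then show ?thesis by (simp only: mod_mult_self3 mult_1)
  qed
  ultimately have "p - 1 = 1"
    by (rule inj_onD) (use p_gt_3 in auto)
  then show False using p_gt_3 by simp
qed

lemma sum_mod_reindex:
  fixes f :: "nat \<Rightarrow> 'b::comm_monoid_add"
  assumes "\<not> p dvd t"
  shows "(\<Sum>r<p. f (r * t mod p)) = (\<Sum>r<p. f r)"
  using sum.reindex_bij_betw[OF bij_times[OF assms], of f] by simp

text \<open>Multiplication by a nonresidue permutes the residue classes and negates the sum.\<close>

lemma sum_chi: "(\<Sum>r<p. chi (int r)) = 0"
proof -
  obtain g where g: "\<not> p dvd g" "chi (int g) = -1" using nonresidue_exists by blast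
  have "(\<Sum>r<p. chi (int r)) = (\<Sum>r<p. chi (int (r * g mod p)))"
    using sum_mod_reindex[OF g(1), of "\<lambda>r. chi (int r)"] by simp
  also have "\<dots> = (\<Sum>r<p. - chi (int r))"
    by (rule sum.cong) (simp_all add: zmod_int chi_mult g)
  finally show ?thesis by (simp add: sum_negf)
qed

section \<open>Residues, nonresidues and correlations of the character\<close>

definition R :: "nat set" where "R = {r \<in> {..<p}. chi (int r) = 1}"
definition N :: "nat set" where "N = {r \<in> {..<p}. chi (int r) = -1}"

lemma finite_R [simp]: "finite R" and finite_N [simp]: "finite N"
  by (simp_all add: R_def N_def)

lemma R_N_disjoint: "R \<inter> N = {}"
  by (auto simp: R_def N_def)

lemma zero_notin [simp]: "0 \<notin> R" "0 \<notin> N"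
  by (auto simp: R_def N_def)

lemma one_in_R: "1 \<in> R"
  using p_gt_3 by (auto simp: R_def)

lemma R_Un_N: "R \<union> N = {1..<p}"
proof -
  have "r \<in> R \<union> N \<longleftrightarrow> r \<in> {1..<p}" for r
  proof (cases "r \<in> {1..<p}")
    case True
    then show ?thesis using chi_nonzero[OF True] chi_values[of "int r"] by (auto simp: R_def N_def)
  next
    case False
    then show ?thesis by (cases "r = 0") (auto simp: R_def N_def)
  qed
  then show ?thesis by blast
qed

lemma atLeast1_less: "{..<p} = insert 0 {1..<p}"
  using p_gt_3 by auto

lemma sum_chi_R_N:
  fixes f :: "nat \<Rightarrow> 'b::comm_ring_1"
  shows "(\<Sum>r<p. of_int (chi (int r)) * f r) = (\<Sum>r\<in>R. f r) - (\<Sum>r\<in>N. f r)"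
proof -
  have "(\<Sum>r<p. of_int (chi (int r)) * f r) = (\<Sum>r\<in>R \<union> N. of_int (chi (int r)) * f r)"
    unfolding R_Un_N atLeast1_less by (subst sum.insert) auto
  also have "\<dots> = (\<Sum>r\<in>R. of_int (chi (int r)) * f r) + (\<Sum>r\<in>N. of_int (chi (int r)) * f r)"
    by (rule sum.union_disjoint) (use R_N_disjoint in auto)
  also have "(\<Sum>r\<in>R. of_int (chi (int r)) * f r) = (\<Sum>r\<in>R. f r)"
    by (rule sum.cong) (auto simp: R_def)
  also have "(\<Sum>r\<in>N. of_int (chi (int r)) * f r) = (\<Sum>r\<in>N. - f r)"
    by (rule sum.cong) (auto simp: N_def)
  finally show ?thesis by (simp add: sum_negf)
qed

lemma card_R: "card R = n" and card_N: "card N = n"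
proof -
  have "int (card R) - int (card N) = 0"
    using sum_chi_R_N[of "\<lambda>_. 1 :: int"] sum_chi by simp
  moreover have "card R + card N = p - 1"
    using card_Un_disjoint[of R N] R_N_disjoint R_Un_N by simp
  ultimately show "card R = n" "card N = n" using p_eq by auto
qed

text \<open>The correlation sum \<open>\<Sum>\<^sub>t \<chi>(t) \<chi>(t - c)\<close> does not depend on \<open>c \<noteq> 0\<close>, and its sum over all \<open>c\<close> vanishes.\<close>

lemma sum_chi_shift: "(\<Sum>c<p. chi (t - int c)) = 0"
proof -
  have bij: "bij_betw (\<lambda>c. nat ((t - int c) mod int p)) {..<p} {..<p}"
  proof -
    have "inj_on (\<lambda>c. nat ((t - int c) mod int p)) {..<p}"
    proof (rule inj_onI)
      fix a b assume ab: "a \<in> {..<p}" "b \<in> {..<p}" and "nat ((t - int a) mod int p) = nat ((t - int b) mod int p)"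
      then have "(t - int a) mod int p = (t - int b) mod int p" using p_gt_3 by (simp add: eq_nat_nat_iff)
      then have "int p dvd (t - int a) - (t - int b)" by (simp add: mod_eq_dvd_iff)
      then have "int p dvd int b - int a" by simp
      then have "[int b = int a] (mod int p)" by (simp add: cong_iff_dvd_diff)
      then have "[b = a] (mod p)" by (simp add: cong_int_iff)
      then show "a = b" using ab by (simp add: unique_euclidean_semiring_class.cong_def)
    qed
    moreover have "(\<lambda>c. nat ((t - int c) mod int p)) ` {..<p} \<subseteq> {..<p}"
      using p_gt_3 by (auto simp: nat_less_iff)
    ultimately show ?thesis by (simp add: bij_betw_def endo_inj_surj)
  qed
  have "(\<Sum>c<p. chi (t - int c)) = (\<Sum>c<p. chi (int (nat ((t - int c) mod int p))))"
    by (rule sum.cong) (use p_gt_3 in simp_all)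
  also have "\<dots> = (\<Sum>c<p. chi (int c))"
    using sum.reindex_bij_betw[OF bij, of "\<lambda>c. chi (int c)"] by simp
  finally show ?thesis using sum_chi by simp
qed

lemma correlation: "(\<Sum>t<p. chi (int t) * chi (int t - 1)) = -1"
proof -
  define K where "K c = (\<Sum>t<p. chi (int t) * chi (int t - int c))" for c
  have K0: "K 0 = int p - 1"
  proof -
    have "K 0 = (\<Sum>t\<in>{1..<p}. chi (int t) * chi (int t))"
      unfolding K_def atLeast1_less by (subst sum.insert) auto
    also have "\<dots> = (\<Sum>t\<in>{1..<p}. 1)"
      by (rule sum.cong[OF refl]) (rule chi_square[OF not_dvd_nat])
    finally show ?thesis using p_gt_3 by (simp add: of_nat_diff)
  qed
  have Kc: "K c = K 1" if c: "c \<in> {1..<p}" for c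
  proof -
    have ndvd: "\<not> p dvd c" "\<not> int p dvd int c" using not_dvd_nat[OF c] by auto
    have "K c = (\<Sum>t<p. chi (int (t * c mod p)) * chi (int (t * c mod p) - int c))"
      unfolding K_def by (rule sum_mod_reindex[OF ndvd(1), of "\<lambda>t. chi (int t) * chi (int t - int c)", symmetric])
    also have "\<dots> = (\<Sum>t<p. chi (int t) * chi (int t - 1))"
    proof (rule sum.cong)
      fix t assume "t \<in> {..<p}"
      have 1: "chi (int (t * c mod p)) = chi (int t) * chi (int c)"
        by (simp add: zmod_int chi_mult)
      have cg: "[int (t * c mod p) - int c = (int t - 1) * int c] (mod int p)"
        using cong_diff[of "int (t * c mod p)" "int t * int c" "int p" "int c" "int c"]
        by (simp add: unique_euclidean_semiring_class.cong_def zmod_int left_diff_distrib)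
      have 2: "chi (int (t * c mod p) - int c) = chi (int t - 1) * chi (int c)"
        by (rule trans[OF chi_cong[OF cg] chi_mult])
      have "chi (int c) * chi (int c) = 1" using chi_square ndvd by blast
      then show "chi (int (t * c mod p)) * chi (int (t * c mod p) - int c) = chi (int t) * chi (int t - 1)"
        unfolding 1 2 by (metis mult.assoc mult.left_commute mult_1_right)
    qed simp
    finally show ?thesis by (simp add: K_def)
  qed
  have "(\<Sum>c<p. K c) = (\<Sum>t<p. \<Sum>c<p. chi (int t) * chi (int t - int c))"
    unfolding K_def by (rule sum.swap)
  then have "(\<Sum>c<p. K c) = (\<Sum>t<p. chi (int t) * (\<Sum>c<p. chi (int t - int c)))"
    by (simp only: sum_distrib_left)
  then have "(\<Sum>c<p. K c) = 0" by (simp add: sum_chi_shift)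
  moreover have "(\<Sum>c\<in>{1..<p}. K c) = (\<Sum>c\<in>{1..<p}. K 1)"
    by (rule sum.cong[OF refl Kc])
  moreover have "(\<Sum>c<p. K c) = K 0 + (\<Sum>c\<in>{1..<p}. K c)"
    unfolding atLeast1_less by (rule sum.insert) auto
  moreover have "(\<Sum>c\<in>{1..<p}. K 1) = (int p - 1) * K 1" using p_gt_3 by (simp add: of_nat_diff)
  ultimately have "(int p - 1) * (1 + K 1) = 0" unfolding K0 by (simp only: distrib_left mult_1_right)
  then show ?thesis using p_gt_3 by (simp add: K_def)
qed

end

section \<open>Determinants of Hankel matrices\<close>

lemma det_mat_upper_triangular:
  fixes f :: "nat \<Rightarrow> nat \<Rightarrow> 'a::comm_ring_1"
  assumes "\<And>i j. j < i \<Longrightarrow> i < n \<Longrightarrow> f i j = 0"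
  shows "det (mat n n (\<lambda>(i, j). f i j)) = (\<Prod>i<n. f i i)"
proof -
  have "det (mat n n (\<lambda>(i, j). f i j)) = prod_list (diag_mat (mat n n (\<lambda>(i, j). f i j)))"
    by (rule det_upper_triangular[of _ n]) (use assms in \<open>auto intro!: upper_triangularI\<close>)
  also have "diag_mat (mat n n (\<lambda>(i, j). f i j)) = map (\<lambda>i. f i i) [0..<n]"
    by (auto simp: diag_mat_def)
  also have "prod_list \<dots> = (\<Prod>i<n. f i i)"
    by (simp add: prod.list_conv_set_nth atLeast0LessThan)
  finally show ?thesis .
qed

lemma det_mat_transpose:
  fixes f :: "nat \<Rightarrow> nat \<Rightarrow> 'a::comm_ring_1"
  shows "det (mat n n (\<lambda>(i, j). f j i)) = det (mat n n (\<lambda>(i, j). f i j))"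
proof -
  have "mat n n (\<lambda>(i, j). f j i) = transpose_mat (mat n n (\<lambda>(i, j). f i j))"
    by (rule eq_matI) auto
  then show ?thesis using det_transpose[of "mat n n (\<lambda>(i, j). f i j)" n] by simp
qed

lemma det_mat_lower_triangular:
  fixes f :: "nat \<Rightarrow> nat \<Rightarrow> 'a::comm_ring_1"
  assumes "\<And>i j. i < j \<Longrightarrow> j < n \<Longrightarrow> f i j = 0"
  shows "det (mat n n (\<lambda>(i, j). f i j)) = (\<Prod>i<n. f i i)"
  using det_mat_upper_triangular[of n "\<lambda>i j. f j i"] det_mat_transpose[of n f] assms by simp

lemma mult_mat_mat:
  fixes f g :: "nat \<Rightarrow> nat \<Rightarrow> 'a::comm_ring_1"
  shows "mat n m (\<lambda>(i, j). f i j) * mat m l (\<lambda>(i, j). g i j) =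
         mat n l (\<lambda>(i, j). \<Sum>k<m. f i k * g k j)"
  by (rule eq_matI) (auto simp: scalar_prod_def atLeast0LessThan)

lemma det_mult_mat_mat:
  fixes f g :: "nat \<Rightarrow> nat \<Rightarrow> 'a::comm_ring_1"
  shows "det (mat n n (\<lambda>(i, j). \<Sum>k<n. f i k * g k j)) =
         det (mat n n (\<lambda>(i, j). f i j)) * det (mat n n (\<lambda>(i, j). g i j))"
  using det_mult[of "mat n n (\<lambda>(i, j). f i j)" n "mat n n (\<lambda>(i, j). g i j)"]
  by (simp add: mult_mat_mat)

text \<open>After subtracting column 0 from all other columns, \<open>y\<close> survives only in
  column 0, and expansion along that column is affine in \<open>y\<close>.\<close>

lemma det_affine_column:
  fixes a :: "nat \<Rightarrow> nat \<Rightarrow> 'a::comm_ring_1"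
  assumes n: "n > 0"
  shows "\<exists>\<alpha> \<beta>. \<forall>y. det (mat n n (\<lambda>(i, j). a i j + y * u i)) = \<alpha> + y * \<beta>"
proof -
  \<comment> \<open>Right multiplication by this unipotent matrix performs the column
    subtraction.\<close>
  define t :: "nat \<Rightarrow> nat \<Rightarrow> 'a" where
    "t k j = (if k = j then 1 else 0) - (if k = 0 then if j = 0 then 0 else 1 else 0)" for k j
  define b where "b y i j = (if j = 0 then a i 0 + y * u i else a i j - a i 0)" for y i j
  have det_t: "det (mat n n (\<lambda>(i, j). t i j)) = 1"
    by (subst det_mat_upper_triangular) (auto simp: t_def intro!: prod.neutral)
  have prod_t: "(\<Sum>k<n. (a i k + y * u i) * t k j) = b y i j" if "j < n" for y i j
    using that n by (simp add: t_def b_def right_diff_distrib sum_subtractf if_distrib[of "\<lambda>x. _ * x"] cong: if_cong)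
  have det_b: "det (mat n n (\<lambda>(i, j). a i j + y * u i)) = det (mat n n (\<lambda>(i, j). b y i j))" for y
  proof -
    have "mat n n (\<lambda>(i, j). b y i j) = mat n n (\<lambda>(i, j). \<Sum>k<n. (a i k + y * u i) * t k j)"
      by (rule eq_matI) (auto simp: prod_t)
    then show ?thesis using det_mult_mat_mat[of n "\<lambda>i k. a i k + y * u i" t] det_t by simp
  qed
  define c where "c i = cofactor (mat n n (\<lambda>(i, j). b 0 i j)) i 0" for i
  have cof: "cofactor (mat n n (\<lambda>(i, j). b y i j)) i 0 = c i" for y i
  proof -
    have "mat_delete (mat n n (\<lambda>(i, j). b y i j)) i 0 = mat_delete (mat n n (\<lambda>(i, j). b 0 i j)) i 0"
      by (rule eq_matI) (auto simp: mat_delete_def b_def)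
    then show ?thesis by (simp add: c_def cofactor_def)
  qed
  have "det (mat n n (\<lambda>(i, j). b y i j)) = (\<Sum>i<n. a i 0 * c i) + y * (\<Sum>i<n. u i * c i)" for y
  proof -
    have "det (mat n n (\<lambda>(i, j). b y i j)) = (\<Sum>i<n. b y i 0 * c i)"
      using laplace_expansion_column[of "mat n n (\<lambda>(i, j). b y i j)" n 0] n by (simp add: cof)
    then show ?thesis by (simp add: b_def algebra_simps sum.distrib sum_distrib_left)
  qed
  then show ?thesis using det_b by auto
qed

lemma affine_eqI:
  fixes f g :: "'a::comm_ring_1 \<Rightarrow> 'a"
  assumes "\<exists>\<alpha> \<beta>. \<forall>y. f y = \<alpha> + y * \<beta>" "\<exists>\<alpha> \<beta>. \<forall>y. g y = \<alpha> + y * \<beta>" "f 0 = g 0" "f 1 = g 1"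
  shows "f y = g y"
  using assms by auto

lemma det_add_const:
  fixes a :: "nat \<Rightarrow> nat \<Rightarrow> 'a::comm_ring_1"
  assumes n: "n > 0"
  shows "det (mat n n (\<lambda>(i, j). a i j + x)) =
    det (mat n n (\<lambda>(i, j). a i j)) + x * (det (mat n n (\<lambda>(i, j). a i j + 1)) - det (mat n n (\<lambda>(i, j). a i j)))"
proof -
  obtain \<alpha> \<beta> where ab: "\<And>y. det (mat n n (\<lambda>(i, j). a i j + y * 1)) = \<alpha> + y * \<beta>"
    using det_affine_column[OF n, of a "\<lambda>_. 1"] by blast
  show ?thesis using ab[of 0] ab[of 1] ab[of x] by simp
qed

text \<open>Adding \<open>y\<close> times column 0 and then \<open>z\<close> times row 0 to C + w J
  produces, thanks to \<open>C 0 0 = 1\<close>, the given entries with constant term yz +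
  w(1+y)(1+z). Solving for \<open>w\<close> needs 1+y and 1+z to be nonzero; the exceptional values
  are reached because both sides are affine in \<open>y\<close> and in \<open>z\<close>
  separately.\<close>

lemma det_bordering_shift:
  fixes C :: "nat \<Rightarrow> nat \<Rightarrow> 'a::field_char_0"
  assumes n: "n > 0" and C00: "C 0 0 = 1"
  shows "det (mat n n (\<lambda>(i, j). x + C i j + C i 0 * y + C 0 j * z)) =
    (1 + y) * (1 + z) * det (mat n n (\<lambda>(i, j). C i j)) +
    (x - y * z) * (det (mat n n (\<lambda>(i, j). C i j + 1)) - det (mat n n (\<lambda>(i, j). C i j)))"
proof -
  let ?d = "det (mat n n (\<lambda>(i, j). C i j))"
  let ?k = "det (mat n n (\<lambda>(i, j). C i j + 1)) - ?d"
  define f where "f y z = det (mat n n (\<lambda>(i, j). x + C i j + C i 0 * y + C 0 j * z))" for y z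
  define g where "g y z = (1 + y) * (1 + z) * ?d + (x - y * z) * ?k" for y z
  have generic: "f y z = g y z" if yz: "1 + y \<noteq> 0" "1 + z \<noteq> 0" for y z
  proof -
    \<comment> \<open>Chosen so that the constant term yz + w(1+y)(1+z) becomes
      \<open>x\<close>.\<close>
    define w where "w = (x - y * z) / ((1 + y) * (1 + z))"
    have w: "w * ((1 + y) * (1 + z)) = x - y * z" using yz by (simp add: w_def)
    let ?L = "\<lambda>i k :: nat. (if i = k then 1 else 0) + (if k = 0 then z else 0)"
    let ?U = "\<lambda>k j :: nat. (if k = j then 1 else 0) + (if k = 0 then y else 0)"
    have L: "det (mat n n (\<lambda>(i, j). ?L i j)) = 1 + z"
    proof -
      have "det (mat n n (\<lambda>(i, j). ?L i j)) = (\<Prod>i<n. ?L i i)"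
        by (rule det_mat_lower_triangular) auto
      also have "\<dots> = (\<Prod>i<n. if i = 0 then 1 + z else 1)" by (rule prod.cong) auto
      finally show ?thesis using n by simp
    qed
    have U: "det (mat n n (\<lambda>(i, j). ?U i j)) = 1 + y"
    proof -
      have "det (mat n n (\<lambda>(i, j). ?U i j)) = (\<Prod>i<n. ?U i i)"
        by (rule det_mat_upper_triangular) auto
      also have "\<dots> = (\<Prod>i<n. if i = 0 then 1 + y else 1)" by (rule prod.cong) auto
      finally show ?thesis using n by simp
    qed
    have 1: "(\<Sum>k<n. (C i k + w) * ?U k j) = C i j + w + y * (C i 0 + w)" if "i < n" "j < n" for i j
      using that n by (simp add: distrib_left sum.distrib if_distrib[of "\<lambda>x. _ * x"] mult.commute cong: if_cong)
    have 2: "(\<Sum>k<n. ?L i k * (C k j + w + y * (C k 0 + w))) = x + C i j + C i 0 * y + C 0 j * z"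
      if "i < n" "j < n" for i j
    proof -
      have "(\<Sum>k<n. ?L i k * (C k j + w + y * (C k 0 + w))) =
        (\<Sum>k<n. (if i = k then C k j + w + y * (C k 0 + w) else 0)) + (\<Sum>k<n. if k = 0 then z * (C k j + w + y * (C k 0 + w)) else 0)"
        unfolding sum.distrib[symmetric] by (rule sum.cong) (auto simp: algebra_simps)
      also have "\<dots> = C i j + w + y * (C i 0 + w) + z * (C 0 j + w + y * (1 + w))"
        using that n C00 by simp
      also have "\<dots> = C i j + C i 0 * y + C 0 j * z + y * z + w * ((1 + y) * (1 + z))"
        by (simp add: algebra_simps)
      finally show ?thesis unfolding w by simp
    qed
    have "f y z = det (mat n n (\<lambda>(i, j). \<Sum>k<n. ?L i k * (C k j + w + y * (C k 0 + w))))"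
      unfolding f_def by (rule arg_cong[of _ _ det], rule eq_matI) (simp_all add: 2)
    also have "\<dots> = (1 + z) * det (mat n n (\<lambda>(i, j). C i j + w + y * (C i 0 + w)))"
      unfolding L[symmetric] by (rule det_mult_mat_mat)
    also have "det (mat n n (\<lambda>(i, j). C i j + w + y * (C i 0 + w))) =
        det (mat n n (\<lambda>(i, j). \<Sum>k<n. (C i k + w) * ?U k j))"
      by (rule arg_cong[of _ _ det], rule eq_matI) (simp_all add: 1)
    also have "\<dots> = det (mat n n (\<lambda>(i, j). C i j + w)) * (1 + y)"
      unfolding U[symmetric] by (rule det_mult_mat_mat)
    also have "det (mat n n (\<lambda>(i, j). C i j + w)) = ?d + w * ?k"
      by (rule det_add_const[OF n])
    finally have "f y z = (1 + y) * (1 + z) * ?d + (w * ((1 + y) * (1 + z))) * ?k"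
      by (simp add: algebra_simps)
    then show ?thesis unfolding w g_def .
  qed
  have f_y: "\<exists>\<alpha> \<beta>. \<forall>y. f y z = \<alpha> + y * \<beta>" for z
  proof -
    have "f y z = det (mat n n (\<lambda>(i, j). (x + C i j + C 0 j * z) + y * C i 0))" for y
      unfolding f_def by (rule arg_cong[of _ _ det], rule eq_matI) (simp_all add: algebra_simps)
    then show ?thesis using det_affine_column[OF n, of "\<lambda>i j. x + C i j + C 0 j * z" "\<lambda>i. C i 0"] by simp
  qed
  have f_z: "\<exists>\<alpha> \<beta>. \<forall>z. f y z = \<alpha> + z * \<beta>" for y
  proof -
    have "f y z = det (mat n n (\<lambda>(i, j). (x + C j i + C j 0 * y) + z * C 0 i))" for z
      unfolding f_def by (subst det_mat_transpose[symmetric], rule arg_cong[of _ _ det], rule eq_matI)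
        (simp_all add: algebra_simps)
    then show ?thesis using det_affine_column[OF n, of "\<lambda>i j. x + C j i + C j 0 * y" "\<lambda>i. C 0 i"] by simp
  qed
  have g_y: "\<exists>\<alpha> \<beta>. \<forall>y. g y z = \<alpha> + y * \<beta>" for z
    by (rule exI[of _ "(1 + z) * ?d + x * ?k"], rule exI[of _ "(1 + z) * ?d - z * ?k"]) (simp add: g_def algebra_simps)
  have g_z: "\<exists>\<alpha> \<beta>. \<forall>z. g y z = \<alpha> + z * \<beta>" for y
    by (rule exI[of _ "(1 + y) * ?d + x * ?k"], rule exI[of _ "(1 + y) * ?d - y * ?k"]) (simp add: g_def algebra_simps)
  \<comment> \<open>In characteristic 0 the points 0 and 1 avoid the excluded value -1, so
    \<open>generic\<close> applies at all four corner points, and affinity extends it first in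
    \<open>y\<close>, then in \<open>z\<close>.\<close>
  have z01: "f y z = g y z" if "z \<in> {0, 1}" for y z
    by (rule affine_eqI[OF f_y g_y]; rule generic) (use that in auto)
  have "f y z = g y z"
    by (rule affine_eqI[OF f_z g_z]; rule z01) auto
  then show ?thesis by (simp add: f_def g_def)
qed

text \<open>The matrix determinant lemma. One block matrix is factored in two ways, once with A = 1
  + UV and once with the scalar 1 + VU on the diagonal; V(1 + UV) = (1 + VU)V makes the two products
  agree.\<close>

lemma det_one_plus_rank_one:
  fixes u v :: "nat \<Rightarrow> 'a::field"
  shows "det (mat n n (\<lambda>(i, j). (if i = j then 1 else 0) + u i * v j)) = 1 + (\<Sum>i<n. u i * v i)"
proof -
  let ?U = "mat n 1 (\<lambda>(i, j). u i)" and ?V = "mat 1 n (\<lambda>(i, j). v j)"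
  let ?V' = "mat 1 n (\<lambda>(i, j). - v j)"
  let ?A = "mat n n (\<lambda>(i, j). (if i = j then 1 else 0) + u i * v j)"
  let ?s = "mat 1 1 (\<lambda>_. 1 + (\<Sum>i<n. u i * v i))"
  let ?P = "four_block_mat (1\<^sub>m n) (0\<^sub>m n 1) ?V (1\<^sub>m 1)"
  let ?Q = "four_block_mat ?A ?U (0\<^sub>m 1 n) (1\<^sub>m 1)"
  let ?P' = "four_block_mat (1\<^sub>m n) ?U (0\<^sub>m 1 n) ?s"
  have VA: "?V * ?A = ?s * ?V"
  proof (rule eq_matI)
    fix i j assume ij: "i < dim_row (?s * ?V)" "j < dim_col (?s * ?V)"
    have "(\<Sum>k<n. v k * ((if k = j then 1 else 0) + u k * v j)) =
        (\<Sum>k<n. (if k = j then v k else 0) + u k * v k * v j)"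
      by (rule sum.cong) (auto simp: algebra_simps)
    also have "\<dots> = (1 + (\<Sum>i<n. u i * v i)) * v j"
      using ij by (simp add: sum.distrib sum_distrib_right[symmetric] distrib_right)
    finally show "(?V * ?A) $$ (i, j) = (?s * ?V) $$ (i, j)"
      using ij by (simp add: scalar_prod_def atLeast0LessThan)
  qed auto
  have VU: "?V * ?U + 1\<^sub>m 1 = ?s"
    by (rule eq_matI) (auto simp: scalar_prod_def atLeast0LessThan mult.commute)
  have UV: "1\<^sub>m n + ?U * ?V = ?A"
    by (rule eq_matI) (auto simp: scalar_prod_def)
  have carrier: "?V * ?A \<in> carrier_mat 1 n" "?s * ?V \<in> carrier_mat 1 n"
    by auto
  have PQ: "?P * ?Q = four_block_mat ?A ?U (?V * ?A) ?s"
    by (subst mult_four_block_mat[of _ n n _ 1 _ 1 _ _ n _ 1])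
      (auto simp: VU right_add_zero_mat[OF carrier(1)] simp del: One_nat_def)
  have P'P: "?P' * ?P = four_block_mat ?A ?U (?s * ?V) ?s"
    by (subst mult_four_block_mat[of _ n n _ 1 _ 1 _ _ n _ 1])
      (auto simp: UV left_add_zero_mat[OF carrier(2)] simp del: One_nat_def)
  have dP: "det ?P = 1"
    by (subst det_four_block_mat_upper_right_zero[of _ n _ 1]) auto
  have dQ: "det ?Q = det ?A"
    by (subst det_four_block_mat_lower_left_zero[of _ n _ 1]) auto
  have dP': "det ?P' = 1 + (\<Sum>i<n. u i * v i)"
    by (subst det_four_block_mat_lower_left_zero[of _ n _ 1]) (auto simp: det_single)
  have "?P * ?Q = ?P' * ?P" unfolding PQ P'P VA ..
  moreover have "det (?P * ?Q) = det ?P * det ?Q"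
    by (rule det_mult[of _ "n + 1"]) auto
  moreover have "det (?P' * ?P) = det ?P' * det ?P"
    by (rule det_mult[of _ "n + 1"]) auto
  ultimately show ?thesis using dP dQ dP' by simp
qed

lemma det_diag_plus_rank_one:
  fixes d v :: "nat \<Rightarrow> 'a::field"
  assumes "\<And>i. i < n \<Longrightarrow> d i \<noteq> 0"
  shows "det (mat n n (\<lambda>(i, j). (if i = j then d i else 0) + c * v i * v j)) =
         (\<Prod>i<n. d i) * (1 + c * (\<Sum>i<n. (v i)\<^sup>2 / d i))"
proof -
  let ?D = "\<lambda>i j. if i = j then d i else 0"
  let ?M = "\<lambda>i j. (if i = j then 1 else 0) + (c * v i / d i) * v j"
  have "(if i = j then d i else 0) + c * v i * v j = (\<Sum>k<n. ?D i k * ?M k j)" if "i < n" for i j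
  proof -
    have "(\<Sum>k<n. ?D i k * ?M k j) = (\<Sum>k<n. if i = k then d i * ?M i j else 0)"
      by (rule sum.cong) auto
    also have "\<dots> = d i * ?M i j" using that by simp
    also have "\<dots> = (if i = j then d i else 0) + c * v i * v j"
      using assms[OF that] by (simp add: field_simps)
    finally show ?thesis ..
  qed
  then have "mat n n (\<lambda>(i, j). (if i = j then d i else 0) + c * v i * v j) = mat n n (\<lambda>(i, j). \<Sum>k<n. ?D i k * ?M k j)"
    by (intro eq_matI) auto
  then have "det (mat n n (\<lambda>(i, j). (if i = j then d i else 0) + c * v i * v j)) =
      det (mat n n (\<lambda>(i, j). ?D i j)) * det (mat n n (\<lambda>(i, j). ?M i j))"
    by (simp only: det_mult_mat_mat)
  also have "det (mat n n (\<lambda>(i, j). ?D i j)) = (\<Prod>i<n. d i)"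
    by (subst det_mat_upper_triangular) auto
  also have "det (mat n n (\<lambda>(i, j). ?M i j)) = 1 + (\<Sum>i<n. c * v i / d i * v i)"
    by (rule det_one_plus_rank_one)
  also have "(\<Sum>i<n. c * v i / d i * v i) = c * (\<Sum>i<n. (v i)\<^sup>2 / d i)"
    by (simp add: sum_distrib_left power2_eq_square mult.assoc)
  finally show ?thesis .
qed

text \<open>A unitriangular change of basis replaces the monomials by the monic Newton polynomials
  \<open>q j\<close>. These vanish at the nodes with index below \<open>j\<close>, so the matrix of
  values is lower triangular.\<close>

lemma det_vandermonde:
  fixes z :: "nat \<Rightarrow> 'a::idom"
  shows "det (mat n n (\<lambda>(i, j). z i ^ j)) = (\<Prod>j<n. \<Prod>k<j. z j - z k)"
proof -
  define q where "q j = (\<Prod>k<j. [:- z k, 1:])" for j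
  have deg: "degree (q j) = j" for j
    unfolding q_def by (subst degree_prod_eq_sum_degree) auto
  have monic: "Polynomial.coeff (q j) j = 1" for j
  proof -
    have "lead_coeff (q j) = 1" unfolding q_def by (simp add: lead_coeff_prod)
    then show ?thesis by (simp add: deg)
  qed
  have ev: "poly (q j) (z i) = (\<Sum>k<n. z i ^ k * Polynomial.coeff (q j) k)" if "j < n" for i j
  proof -
    have "poly (q j) (z i) = (\<Sum>k\<le>j. Polynomial.coeff (q j) k * z i ^ k)"
      by (simp add: poly_altdef deg)
    also have "\<dots> = (\<Sum>k<n. Polynomial.coeff (q j) k * z i ^ k)"
      by (rule sum.mono_neutral_left) (use that deg in \<open>auto simp: Polynomial.coeff_eq_0\<close>)
    finally show ?thesis by (simp add: mult.commute)
  qed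
  have "mat n n (\<lambda>(i, j). poly (q j) (z i)) = mat n n (\<lambda>(i, j). \<Sum>k<n. z i ^ k * Polynomial.coeff (q j) k)"
    by (rule eq_matI) (auto simp: ev)
  then have "det (mat n n (\<lambda>(i, j). poly (q j) (z i))) =
      det (mat n n (\<lambda>(i, j). z i ^ j)) * det (mat n n (\<lambda>(i, j). Polynomial.coeff (q j) i))"
    by (simp only: det_mult_mat_mat)
  moreover have "det (mat n n (\<lambda>(i, j). Polynomial.coeff (q j) i)) = 1"
    by (subst det_mat_upper_triangular) (auto simp: monic deg Polynomial.coeff_eq_0)
  moreover have "det (mat n n (\<lambda>(i, j). poly (q j) (z i))) = (\<Prod>j<n. \<Prod>k<j. z j - z k)"
    by (subst det_mat_lower_triangular) (auto simp: q_def poly_prod intro!: prod_zero)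
  ultimately show ?thesis by simp
qed

text \<open>The hypothesis on \<open>h\<close> says that the matrix is the transpose of E times
  (diag(d) + c v v^T) times E, with E the Vandermonde matrix of the nodes. Both Hankel determinants
  are brought into this form.\<close>

lemma det_vandermonde_gram:
  fixes z d v :: "nat \<Rightarrow> 'a::field"
  assumes d: "\<And>i. i < n \<Longrightarrow> d i \<noteq> 0"
    and h: "\<And>j k. j < n \<Longrightarrow> k < n \<Longrightarrow>
      h j k = (\<Sum>i<n. d i * z i ^ (j + k)) + c * (\<Sum>i<n. v i * z i ^ j) * (\<Sum>i<n. v i * z i ^ k)"
  shows "det (mat n n (\<lambda>(j, k). h j k)) =
    (det (mat n n (\<lambda>(i, j). z i ^ j)))\<^sup>2 * (\<Prod>i<n. d i) * (1 + c * (\<Sum>i<n. (v i)\<^sup>2 / d i))"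
proof -
  let ?M = "\<lambda>i j. (if i = j then d i else 0) + c * v i * v j"
  have 1: "(\<Sum>l<n. ?M i l * z l ^ k) = d i * z i ^ k + c * v i * (\<Sum>l<n. v l * z l ^ k)" if "i < n" for i k
  proof -
    have "(\<Sum>l<n. ?M i l * z l ^ k) = (\<Sum>l<n. if i = l then d i * z i ^ k else 0) + (\<Sum>l<n. c * v i * (v l * z l ^ k))"
      unfolding sum.distrib[symmetric] by (rule sum.cong) (auto simp: algebra_simps)
    then show ?thesis using that by (simp add: sum_distrib_left)
  qed
  have 2: "h j k = (\<Sum>i<n. z i ^ j * (\<Sum>l<n. ?M i l * z l ^ k))" if "j < n" "k < n" for j k
  proof -
    have "(\<Sum>i<n. z i ^ j * (\<Sum>l<n. ?M i l * z l ^ k)) =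
      (\<Sum>i<n. d i * z i ^ (j + k) + c * (v i * z i ^ j) * (\<Sum>l<n. v l * z l ^ k))"
      by (rule sum.cong[OF refl], simp only: 1 lessThan_iff, simp add: algebra_simps power_add)
    also have "\<dots> = h j k"
      unfolding h[OF that] sum.distrib sum_distrib_right[symmetric] sum_distrib_left[symmetric] ..
    finally show ?thesis ..
  qed
  have "mat n n (\<lambda>(j, k). h j k) = mat n n (\<lambda>(j, k). \<Sum>i<n. z i ^ j * (\<Sum>l<n. ?M i l * z l ^ k))"
    by (rule eq_matI) (auto simp: 2)
  then have "det (mat n n (\<lambda>(j, k). h j k)) =
      det (mat n n (\<lambda>(j, i). z i ^ j)) * (det (mat n n (\<lambda>(i, j). ?M i j)) * det (mat n n (\<lambda>(i, j). z i ^ j)))"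
    by (simp only: det_mult_mat_mat)
  also have "det (mat n n (\<lambda>(j, i). z i ^ j)) = det (mat n n (\<lambda>(i, j). z i ^ j))"
    by (rule det_mat_transpose)
  also have "det (mat n n (\<lambda>(i, j). ?M i j)) = (\<Prod>i<n. d i) * (1 + c * (\<Sum>i<n. (v i)\<^sup>2 / d i))"
    by (rule det_diag_plus_rank_one[OF d])
  finally show ?thesis by (simp add: power2_eq_square algebra_simps)
qed

section \<open>Roots of unity and the Gauss sum\<close>

lemma det_mat_smult:
  fixes a :: "'a::comm_ring_1"
  shows "det (mat n n (\<lambda>(i, j). a * f i j)) = a ^ n * det (mat n n (\<lambda>(i, j). f i j))"
proof -
  have "mat n n (\<lambda>(i, j). a * f i j) = a \<cdot>\<^sub>m mat n n (\<lambda>(i, j). f i j)"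
    by (rule eq_matI) auto
  then show ?thesis by simp
qed

text \<open>Each unordered pair contributes (f j - f k)(f k - f j), minus a square, and there are
  n(n-1)/2 pairs.\<close>

lemma prod_differences_square:
  fixes f :: "nat \<Rightarrow> 'a::comm_ring_1"
  shows "(\<Prod>j<n. \<Prod>k<j. f j - f k)\<^sup>2 =
    (- 1) ^ (n * (n - 1) div 2) * (\<Prod>j<n. \<Prod>k\<in>{..<n} - {j}. f j - f k)"
proof (induction n)
  case (Suc n)
  have A: "{..<Suc n} - {j} = insert n ({..<n} - {j})" if "j < n" for j
    using that by auto
  have "(\<Prod>j<Suc n. \<Prod>k\<in>{..<Suc n} - {j}. f j - f k) =
      (\<Prod>j<n. (f j - f n) * (\<Prod>k\<in>{..<n} - {j}. f j - f k)) * (\<Prod>k<n. f n - f k)"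
  proof -
    have "{..<Suc n} - {n} = {..<n}" by auto
    moreover have "(\<Prod>j<n. \<Prod>k\<in>{..<Suc n} - {j}. f j - f k) =
        (\<Prod>j<n. (f j - f n) * (\<Prod>k\<in>{..<n} - {j}. f j - f k))"
      by (rule prod.cong) (auto simp: A)
    ultimately show ?thesis by simp
  qed
  also have "(\<Prod>j<n. (f j - f n) * (\<Prod>k\<in>{..<n} - {j}. f j - f k)) =
      (\<Prod>j<n. (- 1) * (f n - f j)) * (\<Prod>j<n. \<Prod>k\<in>{..<n} - {j}. f j - f k)"
    by (simp add: prod.distrib)
  also have "(\<Prod>j<n. (- 1) * (f n - f j)) = (- 1) ^ n * (\<Prod>j<n. f n - f j)"
    by (simp only: prod.distrib prod_constant card_lessThan)
  finally have "(\<Prod>j<Suc n. \<Prod>k\<in>{..<Suc n} - {j}. f j - f k) =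
      (- 1) ^ n * (\<Prod>j<n. f n - f j)\<^sup>2 * (\<Prod>j<n. \<Prod>k\<in>{..<n} - {j}. f j - f k)"
    by (simp add: power2_eq_square algebra_simps)
  moreover have "Suc n * (Suc n - 1) div 2 = n * (n - 1) div 2 + n"
  proof -
    have "Suc n * (Suc n - 1) = n * (n - 1) + 2 * n" by (cases n) (auto simp: algebra_simps)
    then show ?thesis by simp
  qed
  moreover have "(- 1 :: 'a) ^ n * (- 1) ^ n = 1" by (simp add: power_add[symmetric])
  ultimately show ?case using Suc by (simp add: power_add power_mult_distrib algebra_simps)
qed simp

locale root_of_unity = odd_prime +
  fixes z :: complex
  assumes z_p: "z ^ p = 1" and z_neq_1: "z \<noteq> 1"
begin

lemma z_nonzero: "z \<noteq> 0"
  using z_p p_gt_3 by (auto simp: power_0_left)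

lemma zpow_mod: "z ^ (m mod p) = z ^ m"
proof -
  have "z ^ m = z ^ (p * (m div p) + m mod p)" by simp
  also have "\<dots> = z ^ (m mod p)" by (simp only: power_add power_mult z_p power_one mult_1)
  finally show ?thesis ..
qed

lemma zpow_eq_1_iff: "z ^ m = 1 \<longleftrightarrow> p dvd m"
proof
  assume 1: "z ^ m = 1"
  show "p dvd m"
  proof (rule ccontr)
    assume "\<not> p dvd m"
    then have "coprime m p" using prime_p by (metis coprime_commute prime_imp_coprime)
    then obtain k where "[m * k = 1] (mod p)" using cong_solve_coprime_nat by (metis One_nat_def)
    then have "m * k mod p = 1" using p_gt_3 by (simp add: unique_euclidean_semiring_class.cong_def)
    then have "z ^ (m * k) = z" using zpow_mod[of "m * k"] by simp
    then show False using 1 z_neq_1 by (simp add: power_mult)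
  qed
qed (auto simp: power_mult z_p elim!: dvdE)

lemma zpow_inj: assumes "a < p" "b < p" "z ^ a = z ^ b" shows "a = b"
proof -
  have *: "a = b" if "a \<le> b" "a < p" "b < p" "z ^ a = z ^ b" for a b
  proof -
    have "z ^ (b - a) = 1"
      by (subst power_diff[OF z_nonzero that(1)]) (simp add: that(4) z_nonzero)
    then have "p dvd b - a" using zpow_eq_1_iff by blast
    then show ?thesis using that by (auto dest: dvd_imp_le)
  qed
  show ?thesis
  proof (cases "a \<le> b")
    case False
    then show ?thesis using *[OF _ assms(2,1) assms(3)[symmetric]] by simp
  qed (rule *[OF _ assms])
qed

lemma norm_z: "norm z = 1"
proof -
  have "norm z ^ p = 1" by (simp add: norm_power[symmetric] z_p)
  then show ?thesis using power_eq_iff_eq_base[of p "norm z" 1] p_gt_3 by simp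
qed

lemma orthogonality: "(\<Sum>m<p. z ^ (m * s)) = (if p dvd s then of_nat p else 0)"
proof (cases "p dvd s")
  case True
  then have "z ^ s = 1" by (simp add: zpow_eq_1_iff)
  then have "z ^ (m * s) = 1" for m by (metis mult.commute power_mult power_one)
  then show ?thesis using True by simp
next
  case False
  then have "z ^ s \<noteq> 1" by (simp add: zpow_eq_1_iff)
  then have "(\<Sum>m<p. (z ^ s) ^ m) = ((z ^ s) ^ p - 1) / (z ^ s - 1)" by (rule geometric_sum)
  also have "(z ^ s) ^ p = 1" by (metis mult.commute power_mult power_one z_p)
  finally show ?thesis using False by (simp add: power_mult[symmetric] mult.commute)
qed

section \<open>Interpolation weights at the residue powers of the root of unity\<close>

definition pol :: "nat set \<Rightarrow> complex poly" where "pol S = (\<Prod>r\<in>S. [:- (z ^ r), 1:])"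

definition \<rho> :: complex where "\<rho> = (\<Prod>r\<in>R. 1 - z ^ r)"
definition \<nu> :: complex where "\<nu> = (\<Prod>r\<in>N. 1 - z ^ r)"

lemma poly_pol: "poly (pol S) x = (\<Prod>r\<in>S. x - z ^ r)"
  by (simp add: pol_def poly_prod)

lemma degree_pol: "degree (pol S) = card S"
  unfolding pol_def by (subst degree_prod_eq_sum_degree) auto

lemma lead_coeff_pol: "Polynomial.coeff (pol S) (card S) = 1"
proof -
  have "lead_coeff (pol S) = 1" unfolding pol_def by (simp add: lead_coeff_prod)
  then show ?thesis by (simp add: degree_pol)
qed

text \<open>This is 1 + X + ... + X^(p-1) at X = 1: that polynomial and the product over all
  nontrivial powers have the same p - 1 zeros and the same leading coefficient.\<close>

lemma \<rho>_\<nu>: "\<rho> * \<nu> = of_nat p"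
proof -
  let ?g = "\<Sum>k<p. monom 1 k :: complex poly"
  have ev: "poly ?g x = (\<Sum>k<p. x ^ k)" for x by (simp add: poly_sum poly_monom)
  have "pol {1..<p} = ?g"
  proof (rule poly_eqI_degree_lead_coeff[of _ "p - 1" _ "(\<lambda>r. z ^ r) ` {1..<p}"])
    have inj: "inj_on (\<lambda>r. z ^ r) {1..<p}"
      by (rule inj_onI) (auto intro: zpow_inj)
    show "card ((\<lambda>r. z ^ r) ` {1..<p}) \<ge> p - 1" using card_image[OF inj] by simp
    have c: "Polynomial.coeff ?g k = (if k < p then 1 else 0)" for k
      by (simp add: coeff_sum)
    show "degree ?g \<le> p - 1" by (rule degree_le) (auto simp: c)
    show "degree (pol {1..<p}) \<le> p - 1" by (simp add: degree_pol)
    show "Polynomial.coeff (pol {1..<p}) (p - 1) = Polynomial.coeff ?g (p - 1)"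
      using lead_coeff_pol[of "{1..<p}"] p_gt_3 by (simp add: c)
    fix x assume "x \<in> (\<lambda>r. z ^ r) ` {1..<p}"
    then obtain r where r: "r \<in> {1..<p}" "x = z ^ r" by auto
    have "(\<Sum>k<p. x ^ k) = 0"
      using orthogonality[of r] r by (simp add: power_mult[symmetric] mult.commute nat_dvd_not_less)
    moreover have "poly (pol {1..<p}) x = 0" unfolding poly_pol using r by (intro prod_zero) auto
    ultimately show "poly (pol {1..<p}) x = poly ?g x" by (simp add: ev)
  qed
  then have "poly (pol {1..<p}) 1 = of_nat p" by (simp add: ev)
  moreover have "poly (pol {1..<p}) 1 = \<rho> * \<nu>"
    unfolding poly_pol \<rho>_def \<nu>_def R_Un_N[symmetric]
    by (rule prod.union_disjoint) (use R_N_disjoint in auto)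
  ultimately show ?thesis by simp
qed

lemma \<rho>_nonzero: "\<rho> \<noteq> 0" and \<nu>_nonzero: "\<nu> \<noteq> 0"
  using \<rho>_\<nu> p_gt_3 by auto

text \<open>By orthogonality the monomial X^k survives only if p divides k + 1, and within the
  degree bound this leaves k = p - 1.\<close>

lemma coeff_extraction:
  assumes "degree q \<le> p - 1"
  shows "(\<Sum>m<p. z ^ m * poly q (z ^ m)) = of_nat p * Polynomial.coeff q (p - 1)"
proof -
  have "(\<Sum>m<p. z ^ m * poly q (z ^ m)) = (\<Sum>m<p. \<Sum>k\<le>p - 1. Polynomial.coeff q k * z ^ (m * Suc k))"
  proof (rule sum.cong[OF refl])
    fix m
    have "poly q (z ^ m) = (\<Sum>k\<le>p - 1. Polynomial.coeff q k * (z ^ m) ^ k)"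
      unfolding poly_altdef by (rule sum.mono_neutral_left) (use assms in \<open>auto simp: Polynomial.coeff_eq_0\<close>)
    then show "z ^ m * poly q (z ^ m) = (\<Sum>k\<le>p - 1. Polynomial.coeff q k * z ^ (m * Suc k))"
      by (simp add: sum_distrib_left power_add power_mult[symmetric] algebra_simps)
  qed
  also have "\<dots> = (\<Sum>k\<le>p - 1. Polynomial.coeff q k * (\<Sum>m<p. z ^ (m * Suc k)))"
    by (subst sum.swap) (simp add: sum_distrib_left)
  also have "\<dots> = (\<Sum>k\<le>p - 1. if k = p - 1 then of_nat p * Polynomial.coeff q (p - 1) else 0)"
  proof (rule sum.cong[OF refl])
    fix k assume "k \<in> {..p - 1}"
    then have "p dvd Suc k \<longleftrightarrow> k = p - 1" using p_gt_3 by (auto dest: dvd_imp_le)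
    then show "Polynomial.coeff q k * (\<Sum>m<p. z ^ (m * Suc k)) = (if k = p - 1 then of_nat p * Polynomial.coeff q (p - 1) else 0)"
      unfolding orthogonality by auto
  qed
  finally show ?thesis by simp
qed

text \<open>The factor \<open>pol N\<close> kills all nonresidue terms of
  \<open>coeff_extraction\<close>, leaving the residues and the term m = 0, which carries \<nu>. The
  following two lemmas are the cases of a monomial and of \<open>pol N\<close> itself.\<close>

lemma sum_R_extraction:
  assumes "degree g \<le> n"
  shows "(\<Sum>r\<in>R. z ^ r * poly (pol N) (z ^ r) * poly g (z ^ r)) + \<nu> * poly g 1 =
    of_nat p * Polynomial.coeff (pol N * g) (2 * n)"
proof -
  have deg: "degree (pol N * g) \<le> p - 1"
    using degree_mult_le[of "pol N" g] assms unfolding p_minus_1 by (simp add: degree_pol card_N)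
  let ?f = "\<lambda>m. z ^ m * poly (pol N * g) (z ^ m)"
  have "(\<Sum>m<p. ?f m) = ?f 0 + (\<Sum>m\<in>R \<union> N. ?f m)"
    unfolding atLeast1_less R_Un_N by (rule sum.insert) auto
  also have "(\<Sum>m\<in>R \<union> N. ?f m) = (\<Sum>m\<in>R. ?f m) + (\<Sum>m\<in>N. ?f m)"
    by (rule sum.union_disjoint) (use R_N_disjoint in auto)
  also have "(\<Sum>m\<in>N. ?f m) = 0"
    by (rule sum.neutral) (auto simp: poly_pol intro!: prod_zero)
  also have "?f 0 = \<nu> * poly g 1" by (simp add: poly_pol \<nu>_def)
  finally show ?thesis using coeff_extraction[OF deg] by (simp add: p_minus_1 mult.assoc add.commute del: One_nat_def)
qed

lemma sum_R_power:
  assumes "j \<le> n"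
  shows "(\<Sum>r\<in>R. z ^ r * poly (pol N) (z ^ r) * (z ^ r) ^ j) + \<nu> = (if j = n then of_nat p else 0)"
proof -
  have c: "Polynomial.coeff (pol N * monom 1 j) (2 * n) = (if j = n then 1 else 0)"
  proof -
    have "Polynomial.coeff (pol N * monom 1 j) (2 * n) = Polynomial.coeff (pol N) (2 * n - j)"
      using assms by (simp add: mult.commute[of "pol N"] coeff_monom_mult)
    also have "\<dots> = (if j = n then 1 else 0)"
      using assms lead_coeff_pol[of N] by (auto simp: card_N degree_pol Polynomial.coeff_eq_0)
    finally show ?thesis .
  qed
  show ?thesis
    using sum_R_extraction[of "monom 1 j"] assms by (simp add: poly_monom degree_monom_eq c split: if_splits)
qed

text \<open>This supplies the quadratic form sum v^2/d that the rank-one correction contributes to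
  the Hankel determinants.\<close>

lemma sum_R_square: "(\<Sum>r\<in>R. z ^ r * (poly (pol N) (z ^ r))\<^sup>2) = of_nat p - \<nu>\<^sup>2"
proof -
  have "Polynomial.coeff (pol N * pol N) (2 * n) = 1"
    using coeff_mult_degree_sum[of "pol N" "pol N"] lead_coeff_pol[of N] by (simp add: degree_pol card_N mult_2)
  moreover have "poly (pol N) 1 = \<nu>" by (simp add: poly_pol \<nu>_def)
  ultimately show ?thesis
    using sum_R_extraction[of "pol N"] by (simp add: degree_pol card_N power2_eq_square algebra_simps)
qed

section \<open>The Gauss sum\<close>

definition G :: complex where "G = (\<Sum>m<p. of_int (chi (int m)) * z ^ m)"

lemma gauss_sum_twist: "(\<Sum>m<p. of_int (chi (int m)) * z ^ (m * s)) = of_int (chi (int s)) * G"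
proof (cases "p dvd s")
  case True
  then have "z ^ (m * s) = 1" for m by (simp add: zpow_eq_1_iff)
  moreover have "chi (int s) = 0" using True chi_eq_0_iff by simp
  moreover have "(\<Sum>m<p. of_int (chi (int m)) :: complex) = of_int (\<Sum>m<p. chi (int m))" by simp
  ultimately show ?thesis by (simp add: sum_chi)
next
  case False
  have cs: "of_int (chi (int s)) * of_int (chi (int s)) = (1 :: complex)"
    using chi_square[of "int s"] False by (metis int_dvd_int_iff of_int_1 of_int_mult)
  have "of_int (chi (int s)) * G = (\<Sum>m<p. of_int (chi (int s)) * (of_int (chi (int (m * s mod p))) * z ^ (m * s mod p)))"
    unfolding G_def sum_mod_reindex[OF False, of "\<lambda>m. of_int (chi (int m)) * z ^ m", symmetric] sum_distrib_left ..
  also have "\<dots> = (\<Sum>m<p. of_int (chi (int m)) * z ^ (m * s))"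
  proof (rule sum.cong[OF refl])
    fix m
    have "chi (int (m * s mod p)) = chi (int m) * chi (int s)"
      by (simp add: zmod_int chi_mult)
    then show "of_int (chi (int s)) * (of_int (chi (int (m * s mod p))) * z ^ (m * s mod p)) = of_int (chi (int m)) * z ^ (m * s)"
      using cs unfolding zpow_mod by (simp add: algebra_simps)
  qed
  finally show ?thesis ..
qed

text \<open>The residue sum and the nonresidue sum have the twisted Gauss sum as difference, while
  orthogonality gives their sum; the nonresidue sum is eliminated.\<close>

lemma gauss_sum_moment:
  "G * of_int (chi (int s)) = 2 * (\<Sum>r\<in>R. (z ^ r) ^ s) + 1 - (if p dvd s then of_nat p else 0)"
proof -
  have 1: "of_int (chi (int s)) * G = (\<Sum>r\<in>R. z ^ (r * s)) - (\<Sum>r\<in>N. z ^ (r * s))"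
    using gauss_sum_twist[of s] sum_chi_R_N[of "\<lambda>m. z ^ (m * s)"] by simp
  have "(\<Sum>m<p. z ^ (m * s)) = 1 + (\<Sum>m\<in>R \<union> N. z ^ (m * s))"
    unfolding atLeast1_less R_Un_N by (subst sum.insert) auto
  also have "(\<Sum>m\<in>R \<union> N. z ^ (m * s)) = (\<Sum>r\<in>R. z ^ (r * s)) + (\<Sum>r\<in>N. z ^ (r * s))"
    by (rule sum.union_disjoint) (use R_N_disjoint in auto)
  finally have "(\<Sum>r\<in>N. z ^ (r * s)) = (if p dvd s then of_nat p else 0) - 1 - (\<Sum>r\<in>R. z ^ (r * s))"
    unfolding orthogonality by (simp add: algebra_simps)
  then show ?thesis using 1 by (simp add: power_mult mult.commute)
qed

text \<open>The squares of all twists chi(t) G are summed in two ways: directly, and by expanding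
  into double sums in which orthogonality leaves only the pairs m + k = p.\<close>

lemma gauss_sum_square: "G\<^sup>2 = of_int (chi (- 1)) * of_nat p"
proof -
  have "(\<Sum>t<p. (of_int (chi (int t)) * G) * (of_int (chi (int t)) * G)) = of_nat (p - 1) * G\<^sup>2"
  proof -
    have "(\<Sum>t<p. (of_int (chi (int t)) * G) * (of_int (chi (int t)) * G)) =
        (\<Sum>t\<in>{1..<p}. (of_int (chi (int t)) * G) * (of_int (chi (int t)) * G))"
      unfolding atLeast1_less by (subst sum.insert) auto
    also have "\<dots> = (\<Sum>t\<in>{1..<p}. G\<^sup>2)"
    proof (rule sum.cong[OF refl])
      fix t assume t: "t \<in> {1..<p}"
      have "of_int (chi (int t)) * of_int (chi (int t)) = (1 :: complex)"
        using chi_square[OF not_dvd_nat[OF t]] by (metis of_int_1 of_int_mult)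
      then show "(of_int (chi (int t)) * G) * (of_int (chi (int t)) * G) = G\<^sup>2"
        by (simp add: power2_eq_square algebra_simps)
    qed
    finally show ?thesis by simp
  qed
  moreover have "(\<Sum>t<p. (of_int (chi (int t)) * G) * (of_int (chi (int t)) * G)) =
      of_nat (p - 1) * (of_int (chi (- 1)) * of_nat p)"
  proof -
    have "(\<Sum>t<p. (of_int (chi (int t)) * G) * (of_int (chi (int t)) * G)) =
        (\<Sum>t<p. \<Sum>m<p. \<Sum>k<p. of_int (chi (int m)) * of_int (chi (int k)) * z ^ (t * (m + k)))"
    proof (rule sum.cong[OF refl])
      fix t
      show "(of_int (chi (int t)) * G) * (of_int (chi (int t)) * G) =
        (\<Sum>m<p. \<Sum>k<p. of_int (chi (int m)) * of_int (chi (int k)) * z ^ (t * (m + k)))"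
        unfolding gauss_sum_twist[symmetric] sum_product
        by (intro sum.cong refl) (simp add: power_add algebra_simps)
    qed
    also have "\<dots> = (\<Sum>m<p. \<Sum>k<p. \<Sum>t<p. of_int (chi (int m)) * of_int (chi (int k)) * z ^ (t * (m + k)))"
      by (subst sum.swap, rule sum.cong[OF refl], rule sum.swap)
    also have "\<dots> = (\<Sum>m<p. \<Sum>k<p. of_int (chi (int m)) * of_int (chi (int k)) * (if p dvd m + k then of_nat p else 0))"
      by (simp only: sum_distrib_left[symmetric] orthogonality)
    also have "\<dots> = (\<Sum>m\<in>{1..<p}. of_int (chi (- 1)) * of_nat p)"
    proof -
      have "(\<Sum>k<p. of_int (chi (int m)) * of_int (chi (int k)) * (if p dvd m + k then of_nat p else 0)) =
          (of_int (chi (- 1)) * of_nat p :: complex)" if m: "m \<in> {1..<p}" for m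
      proof -
        have "(\<Sum>k<p. of_int (chi (int m)) * of_int (chi (int k)) * (if p dvd m + k then of_nat p else (0::complex))) =
          (\<Sum>k<p. if k = p - m then of_int (chi (int m)) * of_int (chi (int (p - m))) * of_nat p else 0)"
        proof (rule sum.cong[OF refl])
          fix k assume k: "k \<in> {..<p}"
          have "p dvd m + k \<longleftrightarrow> k = p - m"
          proof
            assume "p dvd m + k"
            then obtain c where c: "m + k = p * c" by auto
            moreover have "0 < m + k" "m + k < 2 * p" using m k by auto
            ultimately have "0 < c" "c < 2" by (auto intro: ccontr simp: not_less)
            then have "c = 1" by simp
            then show "k = p - m" using c by simp
          qed (use m in auto)
          then show "of_int (chi (int m)) * of_int (chi (int k)) * (if p dvd m + k then of_nat p else (0::complex)) =
            (if k = p - m then of_int (chi (int m)) * of_int (chi (int (p - m))) * of_nat p else 0)" by simp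
        qed
        also have "\<dots> = of_int (chi (int m)) * of_int (chi (int (p - m))) * of_nat p"
          using m by simp
        also have "chi (int (p - m)) = chi (- 1) * chi (int m)"
        proof -
          have "[int (p - m) = - 1 * int m] (mod int p)"
            using m by (simp add: of_nat_diff cong_iff_dvd_diff)
          from trans[OF chi_cong[OF this] chi_mult] show ?thesis .
        qed
        also have "of_int (chi (int m)) * of_int (chi (- 1) * chi (int m)) * of_nat p =
            of_int (chi (int m) * chi (int m)) * (of_int (chi (- 1)) * of_nat p :: complex)"
          by (simp add: algebra_simps)
        also have "chi (int m) * chi (int m) = 1" by (rule chi_square[OF not_dvd_nat[OF m]])
        finally show ?thesis by simp
      qed
      then show ?thesis unfolding atLeast1_less by (subst sum.insert) auto
    qed
    finally show ?thesis by simp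
  qed
  ultimately show ?thesis using p_gt_3 by simp
qed

lemma G_nonzero: "G \<noteq> 0"
  using gauss_sum_square p_gt_3 by (auto simp: chi_minus_1)

text \<open>Needed because 1 + G x is a diagonal entry, later divided by, when the larger
  determinant is evaluated at x = 1.\<close>

lemma G_neq_minus_1: "1 + G \<noteq> 0"
proof
  assume "1 + G = 0"
  then have "G\<^sup>2 = 1" by (simp add: add_eq_0_iff power2_eq_square)
  then have "of_int (chi (- 1) * int p) = (of_int 1 :: complex)" using gauss_sum_square by simp
  then have "chi (- 1) * int p = 1" by (simp only: of_int_eq_iff)
  then have "int p dvd 1" by (metis dvd_triv_right)
  then show False using p_gt_3 by simp
qed

end

section \<open>Evaluation of the two Hankel determinants\<close>

context odd_prime
begin

lemma R_N_not_dvd: "t \<in> R \<union> N \<Longrightarrow> \<not> p dvd t"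
  using chi_eq_0_iff[of "int t"] by (auto simp: R_def N_def)

lemma R_times: "t \<in> R \<Longrightarrow> bij_betw (\<lambda>r. r * t mod p) R R"
proof -
  assume t: "t \<in> R"
  then have "\<not> p dvd t" using R_N_not_dvd by simp
  from bij_times_chi[OF this, of 1] t show ?thesis by (simp add: R_def)
qed

lemma R_times_N: "t \<in> N \<Longrightarrow> bij_betw (\<lambda>r. r * t mod p) R N"
proof -
  assume t: "t \<in> N"
  then have "\<not> p dvd t" using R_N_not_dvd by simp
  from bij_times_chi[OF this, of 1] t show ?thesis by (simp add: R_def N_def)
qed

text \<open>|A| - |B| is the sum of chi(t - 1) over the residues t. The correlation sum gives
  residues minus nonresidues, and the vanishing full sum gives residues plus nonresidues as
  -chi(-1), the missing term t = 0.\<close>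

lemma R_split:
  defines "A \<equiv> {t \<in> R - {1}. chi (int t - 1) = 1}" and "B \<equiv> {t \<in> R - {1}. chi (int t - 1) = -1}"
  shows "R - {1} = A \<union> B" "A \<inter> B = {}" "card A + card B = n - 1"
    "2 * (int (card A) - int (card B)) = - 1 - chi (- 1)"
proof -
  have nz: "chi (int t - 1) \<noteq> 0" if "t \<in> R - {1}" for t
  proof -
    have "t \<in> {1..<p}" using that R_Un_N by auto
    with that have "t - 1 \<in> {1..<p}" "int (t - 1) = int t - 1" by auto
    then show ?thesis using chi_nonzero by metis
  qed
  show un: "R - {1} = A \<union> B"
    using nz chi_values by (auto simp: A_def B_def)
  show disj: "A \<inter> B = {}" by (auto simp: A_def B_def)
  have fin: "finite A" "finite B" by (auto simp: A_def B_def)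
  show "card A + card B = n - 1"
    using card_Un_disjoint[OF fin disj] un[symmetric] one_in_R by (simp add: card_R)
  have "int (card A) - int (card B) = (\<Sum>t\<in>A. chi (int t - 1)) + (\<Sum>t\<in>B. chi (int t - 1))"
    by (simp add: A_def B_def)
  also have "\<dots> = (\<Sum>t\<in>R - {1}. chi (int t - 1))"
    unfolding un by (rule sum.union_disjoint[symmetric]) (use fin disj in auto)
  also have "\<dots> = (\<Sum>t\<in>R. chi (int t - 1))"
    by (rule sum.mono_neutral_left) (use one_in_R in auto)
  finally have card: "int (card A) - int (card B) = (\<Sum>t\<in>R. chi (int t - 1))" .
  have 1: "(\<Sum>t\<in>R. chi (int t - 1)) - (\<Sum>t\<in>N. chi (int t - 1)) = - 1"
    using correlation sum_chi_R_N[of "\<lambda>t. chi (int t - 1)"] by simp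
  have bij1: "(\<Sum>t<p. chi (1 - int t)) = 0" by (rule sum_chi_shift)
  have "(\<Sum>t<p. chi (int t - 1)) = chi (- 1) * (\<Sum>t<p. chi (1 - int t))"
    unfolding sum_distrib_left by (rule sum.cong) (simp_all add: chi_mult[symmetric])
  then have "(\<Sum>t<p. chi (int t - 1)) = 0" by (simp add: bij1)
  moreover have "(\<Sum>t<p. chi (int t - 1)) = chi (- 1) + (\<Sum>t\<in>R \<union> N. chi (int t - 1))"
    unfolding atLeast1_less R_Un_N by (subst sum.insert) auto
  moreover have "(\<Sum>t\<in>R \<union> N. chi (int t - 1)) = (\<Sum>t\<in>R. chi (int t - 1)) + (\<Sum>t\<in>N. chi (int t - 1))"
    by (rule sum.union_disjoint) (use R_N_disjoint in auto)
  ultimately have "2 * (\<Sum>t\<in>R. chi (int t - 1)) = - 1 - chi (- 1)" using 1 by linarith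
  then show "2 * (int (card A) - int (card B)) = - 1 - chi (- 1)" unfolding card .
qed

end

context root_of_unity
begin

lemma prod_R_twist: "t \<in> R \<Longrightarrow> (\<Prod>r\<in>R. f (z ^ (r * t))) = (\<Prod>r\<in>R. f (z ^ r))"
  using prod.reindex_bij_betw[OF R_times, of t "\<lambda>r. f (z ^ r)"] by (simp add: zpow_mod)

lemma prod_R_twist_N: "t \<in> N \<Longrightarrow> (\<Prod>r\<in>R. f (z ^ (r * t))) = (\<Prod>r\<in>N. f (z ^ r))"
  using prod.reindex_bij_betw[OF R_times_N, of t "\<lambda>r. f (z ^ r)"] by (simp add: zpow_mod)

text \<open>Multiplication by the square 4 permutes \<open>R\<close>, so the product P satisfies P^4
  = P, that is P^3 = 1. As a power of \<open>z\<close>, and since p is not 3, P is then 1.\<close>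

lemma prod_R_zpow: "(\<Prod>r\<in>R. z ^ r) = 1"
proof -
  let ?P = "\<Prod>r\<in>R. z ^ r"
  have P: "?P = z ^ (\<Sum>r\<in>R. r)" by (simp add: power_sum)
  have "\<not> int p dvd 2" using p_gt_3 by (auto dest!: zdvd_imp_le)
  then have "chi 2 * chi 2 = 1" by (rule chi_square)
  then have c4: "chi 4 = 1" using chi_mult[of 2 2] by simp
  have "p \<noteq> 4" using p_eq by presburger
  then have "4 \<in> R" using c4 p_gt_3 by (auto simp: R_def)
  then have "(\<Prod>r\<in>R. z ^ (r * 4)) = ?P" using prod_R_twist[of 4 "\<lambda>x. x"] by simp
  then have "?P ^ 4 = ?P" by (simp add: power_mult prod_power_distrib)
  moreover have "?P \<noteq> 0" using z_nonzero by auto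
  ultimately have "?P ^ 3 = 1" by (simp add: eval_nat_numeral)
  then have "z ^ ((\<Sum>r\<in>R. r) * 3) = 1" by (simp add: P power_mult)
  then have "p dvd (\<Sum>r\<in>R. r) * 3" by (simp add: zpow_eq_1_iff)
  moreover have "\<not> p dvd 3" using p_gt_3 by (auto dest: dvd_imp_le)
  ultimately have "p dvd (\<Sum>r\<in>R. r)" using prime_p prime_dvd_mult_iff by blast
  then show ?thesis by (simp add: P zpow_eq_1_iff)
qed

text \<open>Put s = t r mod p. The difference is then z^r (1 - z^(r(t-1))), and for fixed t the
  product over r is \<rho> or \<nu> according to the character of t - 1; the factors z^r multiply to
  1.\<close>

lemma prod_R_differences:
  defines "A \<equiv> {t \<in> R - {1}. chi (int t - 1) = 1}" and "B \<equiv> {t \<in> R - {1}. chi (int t - 1) = -1}"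
  shows "(\<Prod>r\<in>R. \<Prod>s\<in>R - {r}. z ^ r - z ^ s) = \<rho> ^ card A * \<nu> ^ card B"
proof -
  have "(\<Prod>s\<in>R - {r}. z ^ r - z ^ s) = (\<Prod>t\<in>R - {1}. z ^ r * (1 - z ^ (r * (t - 1))))" if r: "r \<in> R" for r
  proof -
    have bij: "bij_betw (\<lambda>t. t * r mod p) R R" by (rule R_times[OF r])
    have r1: "1 * r mod p = r" using r by (simp add: R_def)
    have im: "(\<lambda>t. t * r mod p) ` (R - {1}) = R - {1 * r mod p}"
      using inj_on_image_set_diff[of "\<lambda>t. t * r mod p" R R "{1}"] bij one_in_R unfolding bij_betw_def
      by (simp only: image_insert image_empty Diff_subset insert_subset empty_subsetI simp_thms)
    have "inj_on (\<lambda>t. t * r mod p) (R - {1})"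
      using bij inj_on_diff unfolding bij_betw_def by blast
    with im have "bij_betw (\<lambda>t. t * r mod p) (R - {1}) (R - {r})"
      unfolding bij_betw_def r1 by blast
    from prod.reindex_bij_betw[OF this, of "\<lambda>s. z ^ r - z ^ s"]
    have "(\<Prod>s\<in>R - {r}. z ^ r - z ^ s) = (\<Prod>t\<in>R - {1}. z ^ r - z ^ (t * r))"
      by (simp add: zpow_mod)
    also have "\<dots> = (\<Prod>t\<in>R - {1}. z ^ r * (1 - z ^ (r * (t - 1))))"
    proof (rule prod.cong[OF refl])
      fix t assume "t \<in> R - {1}"
      then obtain u where "t = Suc u" by (cases t) auto
      then show "z ^ r - z ^ (t * r) = z ^ r * (1 - z ^ (r * (t - 1)))"
        by (simp add: power_add right_diff_distrib mult.commute)
    qed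
    finally show ?thesis .
  qed
  then have "(\<Prod>r\<in>R. \<Prod>s\<in>R - {r}. z ^ r - z ^ s) =
      (\<Prod>r\<in>R. \<Prod>t\<in>R - {1}. z ^ r * (1 - z ^ (r * (t - 1))))" by (rule prod.cong[OF refl])
  also have "\<dots> = (\<Prod>t\<in>R - {1}. \<Prod>r\<in>R. z ^ r * (1 - z ^ (r * (t - 1))))"
    by (rule prod.swap)
  also have "\<dots> = (\<Prod>t\<in>R - {1}. \<Prod>r\<in>R. 1 - z ^ (r * (t - 1)))"
    by (simp add: prod.distrib prod_R_zpow)
  also have "\<dots> = (\<Prod>t\<in>A \<union> B. \<Prod>r\<in>R. 1 - z ^ (r * (t - 1)))"
    unfolding A_def B_def by (rule prod.cong[OF R_split(1) refl])
  also have "\<dots> = (\<Prod>t\<in>A. \<Prod>r\<in>R. 1 - z ^ (r * (t - 1))) * (\<Prod>t\<in>B. \<Prod>r\<in>R. 1 - z ^ (r * (t - 1)))"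
    by (rule prod.union_disjoint) (auto simp: A_def B_def)
  also have "(\<Prod>t\<in>A. \<Prod>r\<in>R. 1 - z ^ (r * (t - 1))) = (\<Prod>t\<in>A. \<rho>)"
  proof (rule prod.cong[OF refl])
    fix t assume "t \<in> A"
    then have t: "t \<in> R" "t \<noteq> 1" "chi (int t - 1) = 1" by (auto simp: A_def)
    then have "t - 1 \<in> R" using zero_notin(1) by (cases t) (auto simp: R_def)
    then show "(\<Prod>r\<in>R. 1 - z ^ (r * (t - 1))) = \<rho>" unfolding \<rho>_def by (rule prod_R_twist)
  qed
  also have "(\<Prod>t\<in>B. \<Prod>r\<in>R. 1 - z ^ (r * (t - 1))) = (\<Prod>t\<in>B. \<nu>)"
  proof (rule prod.cong[OF refl])
    fix t assume "t \<in> B"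
    then have t: "t \<in> R" "t \<noteq> 1" "chi (int t - 1) = - 1" by (auto simp: B_def)
    then have "t - 1 \<in> N" using zero_notin(1) by (cases t) (auto simp: R_def N_def)
    then show "(\<Prod>r\<in>R. 1 - z ^ (r * (t - 1))) = \<nu>" unfolding \<nu>_def by (rule prod_R_twist_N)
  qed
  finally show ?thesis by simp
qed

section \<open>The Hankel determinants as Vandermonde Gram determinants\<close>

definition e :: "nat \<Rightarrow> nat" where "e = (SOME e. bij_betw e {..<n} R)"

lemma bij_e: "bij_betw e {..<n} R"
proof -
  have "\<exists>e. bij_betw e {..<n} R"
    using ex_bij_betw_nat_finite[OF finite_R] by (simp add: card_R atLeast0LessThan)
  then show ?thesis unfolding e_def by (rule someI_ex)
qed

lemma sum_e: "(\<Sum>i<n. f (e i)) = (\<Sum>r\<in>R. f r)"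
  by (rule sum.reindex_bij_betw[OF bij_e])

lemma prod_e: "(\<Prod>i<n. f (e i)) = (\<Prod>r\<in>R. f r)"
  by (rule prod.reindex_bij_betw[OF bij_e])

text \<open>Squaring removes the dependence on the enumeration \<open>e\<close> chosen for the
  residues.\<close>

definition V2 :: complex where "V2 = (det (mat n n (\<lambda>(i, j). (z ^ e i) ^ j)))\<^sup>2"

lemma V2_eq: "V2 = (- 1) ^ (n * (n - 1) div 2) * (\<Prod>r\<in>R. \<Prod>s\<in>R - {r}. z ^ r - z ^ s)"
proof -
  have "(\<Prod>k\<in>{..<n} - {j}. z ^ e j - z ^ e k) = (\<Prod>s\<in>R - {e j}. z ^ e j - z ^ s)" if "j < n" for j
  proof -
    have "bij_betw e ({..<n} - {j}) (R - {e j})"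
      using bij_e that inj_on_diff[of e "{..<n}" "{j}"] inj_on_image_set_diff[of e "{..<n}" "{..<n}" "{j}"]
      unfolding bij_betw_def by auto
    from prod.reindex_bij_betw[OF this] show ?thesis .
  qed
  then have "(\<Prod>j<n. \<Prod>k\<in>{..<n} - {j}. z ^ e j - z ^ e k) = (\<Prod>j<n. \<Prod>s\<in>R - {e j}. z ^ e j - z ^ s)"
    by simp
  also have "\<dots> = (\<Prod>r\<in>R. \<Prod>s\<in>R - {r}. z ^ r - z ^ s)" by (rule prod_e)
  finally show ?thesis
    unfolding V2_def det_vandermonde prod_differences_square by simp
qed

text \<open>With indices counted from 0, the argument (j+1) + (k+1) - 1 of the character becomes j +
  k + 1.\<close>

definition H :: "nat \<Rightarrow> complex \<Rightarrow> complex" where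
  "H m x = det (mat m m (\<lambda>(j, k). of_int (chi (int (j + k + 1))) + x))"

text \<open>Here 0 < j + k + 1 < p, so the moment formula has no multiple of p in it. What remains
  beside the diagonal part is the constant matrix with entry 1 + G x, which becomes a rank-one term
  once the all-ones vector is expressed by the nodes.\<close>

lemma hankel_det_n: "G ^ n * H n x = V2 * 2 ^ n * (1 + (1 + G * x) * (of_nat p - \<nu>\<^sup>2) / (2 * \<nu>\<^sup>2))"
proof -
  define y where "y i = z ^ e i" for i
  \<comment> \<open>By \<open>sum_R_power\<close> these weights have all moments of order below n
    equal to 1, so their image under the transposed Vandermonde matrix is the all-ones
    vector.\<close>
  define v where "v i = - (y i * poly (pol N) (y i)) / \<nu>" for i
  have v: "(\<Sum>i<n. v i * y i ^ j) = 1" if "j < n" for j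
  proof -
    have "(\<Sum>i<n. y i * poly (pol N) (y i) * y i ^ j) = - \<nu>"
      using sum_R_power[of j] that sum_e[of "\<lambda>r. z ^ r * poly (pol N) (z ^ r) * (z ^ r) ^ j"]
      by (simp add: y_def add_eq_0_iff2)
    moreover have "(\<Sum>i<n. v i * y i ^ j) = - (\<Sum>i<n. y i * poly (pol N) (y i) * y i ^ j) / \<nu>"
      by (simp add: v_def sum_negf[symmetric] sum_divide_distrib)
    ultimately show ?thesis using \<nu>_nonzero by simp
  qed
  have "det (mat n n (\<lambda>(j, k). G * (of_int (chi (int (j + k + 1))) + x))) =
      (det (mat n n (\<lambda>(i, j). y i ^ j)))\<^sup>2 * (\<Prod>i<n. 2 * y i) * (1 + (1 + G * x) * (\<Sum>i<n. (v i)\<^sup>2 / (2 * y i)))"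
  proof (rule det_vandermonde_gram)
    fix j k assume jk: "j < n" "k < n"
    have "\<not> p dvd j + k + 1" using jk p_eq by (auto dest!: dvd_imp_le)
    then have "G * of_int (chi (int (j + k + 1))) = 2 * (\<Sum>r\<in>R. (z ^ r) ^ (j + k + 1)) + 1"
      using gauss_sum_moment[of "j + k + 1"] by simp
    also have "(\<Sum>r\<in>R. (z ^ r) ^ (j + k + 1)) = (\<Sum>i<n. y i ^ (j + k + 1))"
      unfolding y_def by (rule sum_e[symmetric])
    finally have "G * (of_int (chi (int (j + k + 1))) + x) = (\<Sum>i<n. 2 * y i * y i ^ (j + k)) + (1 + G * x)"
      by (simp add: distrib_left sum_distrib_left algebra_simps)
    then show "G * (of_int (chi (int (j + k + 1))) + x) = (\<Sum>i<n. 2 * y i * y i ^ (j + k)) +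
        (1 + G * x) * (\<Sum>i<n. v i * y i ^ j) * (\<Sum>i<n. v i * y i ^ k)"
      using v[OF jk(1)] v[OF jk(2)] by simp
  qed (use z_nonzero in \<open>simp add: y_def\<close>)
  also have "(\<Prod>i<n. 2 * y i) = 2 ^ n"
    using prod_e[of "\<lambda>r. z ^ r"] by (simp add: prod.distrib y_def prod_R_zpow)
  also have "(\<Sum>i<n. (v i)\<^sup>2 / (2 * y i)) = (of_nat p - \<nu>\<^sup>2) / (2 * \<nu>\<^sup>2)"
  proof -
    have "(\<Sum>i<n. (v i)\<^sup>2 / (2 * y i)) = (\<Sum>i<n. y i * (poly (pol N) (y i))\<^sup>2 / (2 * \<nu>\<^sup>2))"
      by (rule sum.cong) (simp_all add: v_def y_def power_divide power_mult_distrib power2_eq_square z_nonzero mult_ac)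
    also have "\<dots> = (\<Sum>i<n. y i * (poly (pol N) (y i))\<^sup>2) / (2 * \<nu>\<^sup>2)"
      by (simp add: sum_divide_distrib)
    also have "(\<Sum>i<n. y i * (poly (pol N) (y i))\<^sup>2) = of_nat p - \<nu>\<^sup>2"
      unfolding y_def using sum_e[of "\<lambda>r. z ^ r * (poly (pol N) (z ^ r))\<^sup>2"] sum_R_square by simp
    finally show ?thesis .
  qed
  finally show ?thesis
    unfolding det_mat_smult H_def V2_def y_def by simp
qed

text \<open>With one more node, equal to 1, the constant 1 + G x becomes a diagonal entry. The only
  index with p dividing j + k + 1 is the corner j = k = n, which gives a rank-one correction with
  factor -p. The extra node multiplies the squared Vandermonde determinant by the square of
  \<rho>.\<close>

lemma hankel_det_Suc_n:
  assumes "1 + G * x \<noteq> 0"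
  shows "G ^ (n + 1) * H (n + 1) x = V2 * \<rho>\<^sup>2 * 2 ^ n * (1 + G * x) *
    (1 - (of_nat p - \<nu>\<^sup>2) / (2 * of_nat p) - \<nu>\<^sup>2 / (of_nat p * (1 + G * x)))"
proof -
  define y where "y i = (if i < n then z ^ e i else 1)" for i
  \<comment> \<open>These weights have moments 0 below order n and 1 at order n, hence represent the
    last unit vector.\<close>
  define w where "w i = y i * poly (pol N) (y i) / of_nat p" for i
  define d where "d i = (if i < n then 2 * y i else 1 + G * x)" for i
  have yn: "y n = 1" by (simp add: y_def)
  have wn: "w n = \<nu> / of_nat p" by (simp add: w_def y_def poly_pol \<nu>_def)
  have p0: "(of_nat p :: complex) \<noteq> 0" using p_gt_3 by simp
  have w: "(\<Sum>i<n + 1. w i * y i ^ j) = (if j = n then 1 else 0)" if "j < n + 1" for j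
  proof -
    have "(\<Sum>i<n. y i * poly (pol N) (y i) * y i ^ j) + \<nu> = (if j = n then of_nat p else 0)"
      using sum_R_power[of j] that sum_e[of "\<lambda>r. z ^ r * poly (pol N) (z ^ r) * (z ^ r) ^ j"]
      by (simp add: y_def)
    moreover have "(\<Sum>i<n + 1. w i * y i ^ j) = ((\<Sum>i<n. y i * poly (pol N) (y i) * y i ^ j) + \<nu>) / of_nat p"
      by (simp add: wn yn) (simp add: w_def sum_divide_distrib add_divide_distrib)
    ultimately show ?thesis using p0 by simp
  qed
  have "det (mat (n + 1) (n + 1) (\<lambda>(j, k). G * (of_int (chi (int (j + k + 1))) + x))) =
      (det (mat (n + 1) (n + 1) (\<lambda>(i, j). y i ^ j)))\<^sup>2 * (\<Prod>i<n + 1. d i) *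
      (1 + (- of_nat p) * (\<Sum>i<n + 1. (w i)\<^sup>2 / d i))"
  proof (rule det_vandermonde_gram)
    fix j k assume jk: "j < n + 1" "k < n + 1"
    have "p dvd j + k + 1 \<longleftrightarrow> j = n \<and> k = n"
    proof
      assume "p dvd j + k + 1"
      then have "p \<le> j + k + 1" by (auto dest: dvd_imp_le)
      then show "j = n \<and> k = n" using jk p_eq by auto
    next
      assume "j = n \<and> k = n"
      then have "j + k + 1 = p" using p_eq by simp
      then show "p dvd j + k + 1" by simp
    qed
    then have "G * of_int (chi (int (j + k + 1))) =
        2 * (\<Sum>r\<in>R. (z ^ r) ^ (j + k + 1)) + 1 - (if j = n \<and> k = n then of_nat p else 0)"
      using gauss_sum_moment[of "j + k + 1"] by simp
    also have "(\<Sum>r\<in>R. (z ^ r) ^ (j + k + 1)) = (\<Sum>i<n. y i ^ (j + k + 1))"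
      unfolding sum_e[symmetric] by (simp add: y_def)
    finally have "G * (of_int (chi (int (j + k + 1))) + x) =
        (\<Sum>i<n + 1. d i * y i ^ (j + k)) - (if j = n \<and> k = n then of_nat p else 0)"
      by (simp add: d_def distrib_left sum_distrib_left algebra_simps yn)
    then show "G * (of_int (chi (int (j + k + 1))) + x) = (\<Sum>i<n + 1. d i * y i ^ (j + k)) +
        (- of_nat p) * (\<Sum>i<n + 1. w i * y i ^ j) * (\<Sum>i<n + 1. w i * y i ^ k)"
      unfolding w[OF jk(1)] w[OF jk(2)] by simp
  qed (use z_nonzero assms in \<open>auto simp: d_def y_def\<close>)
  also have "(\<Prod>i<n + 1. d i) = 2 ^ n * (1 + G * x)"
    using prod_e[of "\<lambda>r. z ^ r"] by (simp add: d_def prod.distrib y_def prod_R_zpow)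
  also have "(\<Sum>i<n + 1. (w i)\<^sup>2 / d i) = (of_nat p - \<nu>\<^sup>2) / (2 * (of_nat p)\<^sup>2) + \<nu>\<^sup>2 / ((of_nat p)\<^sup>2 * (1 + G * x))"
  proof -
    have "(\<Sum>i<n. (w i)\<^sup>2 / d i) = (\<Sum>i<n. y i * (poly (pol N) (y i))\<^sup>2 / (2 * (of_nat p)\<^sup>2))"
      by (rule sum.cong) (simp_all add: w_def y_def d_def power_divide power_mult_distrib power2_eq_square z_nonzero mult_ac)
    also have "\<dots> = (\<Sum>i<n. y i * (poly (pol N) (y i))\<^sup>2) / (2 * (of_nat p)\<^sup>2)"
      by (simp add: sum_divide_distrib)
    also have "(\<Sum>i<n. y i * (poly (pol N) (y i))\<^sup>2) = of_nat p - \<nu>\<^sup>2"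
      using sum_e[of "\<lambda>r. z ^ r * (poly (pol N) (z ^ r))\<^sup>2"] sum_R_square by (simp add: y_def)
    finally show ?thesis by (simp add: wn d_def power_divide)
  qed
  also have "(det (mat (n + 1) (n + 1) (\<lambda>(i, j). y i ^ j)))\<^sup>2 = V2 * \<rho>\<^sup>2"
  proof -
    have "(\<Prod>j<n. \<Prod>k<j. y j - y k) = (\<Prod>j<n. \<Prod>k<j. z ^ e j - z ^ e k)"
      by (intro prod.cong refl) (auto simp: y_def)
    moreover have "(\<Prod>k<n. y n - y k) = \<rho>"
      unfolding \<rho>_def prod_e[symmetric] by (simp add: y_def)
    ultimately show ?thesis
      unfolding V2_def det_vandermonde by (simp add: power_mult_distrib)
  qed
  also have "1 + (- of_nat p) * ((of_nat p - \<nu>\<^sup>2) / (2 * (of_nat p)\<^sup>2) + \<nu>\<^sup>2 / ((of_nat p)\<^sup>2 * (1 + G * x))) =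
     1 - (of_nat p - \<nu>\<^sup>2) / (2 * of_nat p) - \<nu>\<^sup>2 / (of_nat p * (1 + G * x))"
    using p0 assms by (simp add: divide_simps power2_eq_square) (simp add: algebra_simps)
  finally show ?thesis
    unfolding det_mat_smult H_def by (simp only: mult.assoc)
qed

end

context odd_prime
begin

text \<open>Gauss's lemma with n = 2m: among 2, 4, ..., 2n exactly the doubles of m+1, ..., 2m
  exceed (p-1)/2.\<close>

lemma chi_2:
  assumes "p mod 4 = 1"
  shows "chi 2 = (- 1) ^ (n div 2)"
proof -
  have ev: "even n" using assms p_eq by presburger
  have "\<not> int p dvd 2" using p_gt_3 by (auto dest!: zdvd_imp_le)
  then have "[2 \<noteq> 0] (mod int p)" by (simp add: cong_0_iff)
  then have gauss: "GAUSS p 2"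
    unfolding GAUSS_def using prime_p p_gt_3 by simp
  note defs = GAUSS.A_def[OF gauss] GAUSS.B_def[OF gauss] GAUSS.C_def[OF gauss] GAUSS.E_def[OF gauss]
  have hn: "(int p - 1) div 2 = int n" using p_eq by linarith
  have C: "GAUSS.C p 2 = (\<lambda>x. x * 2) ` {0<..int n}"
  proof -
    have "x * 2 mod int p = x * 2" if "x \<in> {0<..int n}" for x
      using that p_eq by (intro mod_pos_pos_trivial; simp only: greaterThanAtMost_iff; linarith)
    then show ?thesis unfolding defs hn image_image by simp
  qed
  obtain m where m: "n = 2 * m" using ev by (rule evenE)
  have "GAUSS.E p 2 = (\<lambda>x. x * 2) ` {int m <.. 2 * int m}"
    unfolding GAUSS.E_def[OF gauss] C hn m of_nat_mult of_nat_numeral by fastforce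
  moreover have "inj_on (\<lambda>x. x * 2 :: int) {int m <.. 2 * int m}"
    by (rule inj_onI) simp
  ultimately have "card (GAUSS.E p 2) = card {int m <.. 2 * int m}"
    by (simp only: card_image)
  also have "\<dots> = n div 2" by (simp add: m)
  finally show ?thesis using GAUSS.gauss_lemma[OF gauss] by simp
qed

text \<open>All entries are 1 or -1, that is 2D - 1 for an integer matrix D. The determinant of 2D +
  x J is affine in x, and its values at 0 and at 2 are both divisible by 2^n, which makes the slope
  divisible by 2^(n-1). This later yields the half-integrality of the two coefficients.\<close>

lemma det_legendre_parity:
  "\<exists>a b. det (mat n n (\<lambda>(j, k). chi (int (j + k + 1)))) = 2 ^ (n - 1) * a \<and>
    det (mat n n (\<lambda>(j, k). chi (int (j + k + 1)) + 1)) - det (mat n n (\<lambda>(j, k). chi (int (j + k + 1)))) = 2 ^ (n - 1) * b"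
proof -
  define D :: "nat \<Rightarrow> nat \<Rightarrow> int" where "D j k = (chi (int (j + k + 1)) + 1) div 2" for j k
  have n0: "n > 0" using n_ge_2 by simp
  have D: "chi (int (j + k + 1)) = 2 * D j k + (- 1)" if "j < n" "k < n" for j k
  proof -
    have "j + k + 1 \<in> {1..<p}" using that p_eq by auto
    from chi_nonzero[OF this] chi_values[of "int (j + k + 1)"] show ?thesis
      unfolding D_def by auto
  qed
  define \<delta> where "\<delta> = det (mat n n (\<lambda>(j, k). D j k))"
  define \<delta>' where "\<delta>' = det (mat n n (\<lambda>(j, k). D j k + 1))"
  define \<kappa> where "\<kappa> = det (mat n n (\<lambda>(j, k). 2 * D j k + 1)) - det (mat n n (\<lambda>(j, k). 2 * D j k))"
  have aff: "det (mat n n (\<lambda>(j, k). 2 * D j k + x)) = 2 ^ n * \<delta> + x * \<kappa>" for x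
    using det_add_const[OF n0, of "\<lambda>j k. 2 * D j k" x] by (simp add: \<kappa>_def \<delta>_def det_mat_smult)
  have "det (mat n n (\<lambda>(j, k). 2 * (D j k + 1))) = 2 ^ n * \<delta>'"
    by (simp only: det_mat_smult \<delta>'_def)
  \<comment> \<open>The shift 2 is the useful one because 2D + 2J = 2(D + J) again yields a full
    factor 2^n.\<close>
  then have "2 ^ n * \<delta>' = 2 ^ n * \<delta> + 2 * \<kappa>" using aff[of 2] by simp
  moreover have pw: "(2 :: int) ^ n = 2 * 2 ^ (n - 1)" by (rule power_eq_if[THEN trans]) (use n0 in simp)
  ultimately have \<kappa>: "\<kappa> = 2 ^ (n - 1) * (\<delta>' - \<delta>)" by (simp add: algebra_simps)
  have m1: "mat n n (\<lambda>(j, k). chi (int (j + k + 1))) = mat n n (\<lambda>(j, k). 2 * D j k + (- 1))"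
    by (rule eq_matI) (auto simp: D[simplified])
  have m2: "mat n n (\<lambda>(j, k). chi (int (j + k + 1)) + 1) = mat n n (\<lambda>(j, k). 2 * D j k + 0)"
    by (rule eq_matI) (auto simp: D[simplified])
  have "det (mat n n (\<lambda>(j, k). chi (int (j + k + 1)))) = 2 ^ (n - 1) * (2 * \<delta> - (\<delta>' - \<delta>))"
    unfolding m1 aff \<kappa> pw by (simp add: algebra_simps)
  moreover have "det (mat n n (\<lambda>(j, k). chi (int (j + k + 1)) + 1)) - det (mat n n (\<lambda>(j, k). chi (int (j + k + 1)))) = 2 ^ (n - 1) * (\<delta>' - \<delta>)"
    unfolding m1 m2 aff \<kappa> pw by (simp add: algebra_simps)
  ultimately show ?thesis by blast
qed

end

section \<open>Closed values of the Hankel determinants\<close>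

context root_of_unity
begin

lemma H_of_int: "H m (of_int x) = of_int (det (mat m m (\<lambda>(j, k). chi (int (j + k + 1)) + x)))"
proof -
  have "mat m m (\<lambda>(j, k). of_int (chi (int (j + k + 1))) + of_int x :: complex) =
      map_mat of_int (mat m m (\<lambda>(j, k). chi (int (j + k + 1)) + x))"
    by (rule eq_matI) auto
  then show ?thesis unfolding H_def by (simp add: of_int_hom.hom_det)
qed

lemma det_legendre_mat:
  assumes "m > 0"
  shows "det (legendre_mat p x y w m) = (1 + y) * (1 + w) * H m 0 + (x - y * w) * (H m 1 - H m 0)"
proof -
  have "legendre_mat p x y w m = mat m m (\<lambda>(j, k). x + of_int (chi (int (j + k + 1)))
      + of_int (chi (int (j + 0 + 1))) * y + of_int (chi (int (0 + k + 1))) * w)"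
    unfolding legendre_mat_def legendre_entry_def by (rule eq_matI) (auto simp: algebra_simps)
  then show ?thesis
    using det_bordering_shift[OF assms, of "\<lambda>j k. of_int (chi (int (j + k + 1)))" x y w]
    unfolding H_def by simp
qed

text \<open>Twisting by the nonresidue -1 turns each factor 1 - z^r into 1 - z^(-r) = -z^(-r) (1 -
  z^r); the powers of z multiply to 1 and the signs to (-1)^n = chi(-1).\<close>

lemma \<nu>_eq_minus_\<rho>:
  assumes "chi (- 1) = - 1"
  shows "\<nu> = - \<rho>"
proof -
  have "[int (p - 1) = - 1] (mod int p)" using p_gt_3 by (simp add: of_nat_diff cong_iff_dvd_diff)
  then have "chi (int (p - 1)) = - 1" using chi_cong assms by metis
  then have N: "p - 1 \<in> N" using p_gt_3 by (simp add: N_def)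
  have "\<nu> = (\<Prod>r\<in>R. 1 - z ^ (r * (p - 1)))"
    unfolding \<nu>_def by (rule prod_R_twist_N[OF N, symmetric])
  also have "\<dots> * (\<Prod>r\<in>R. z ^ r) = (\<Prod>r\<in>R. - 1 * (1 - z ^ r))"
    unfolding prod.distrib[symmetric]
  proof (rule prod.cong[OF refl])
    fix r
    have "z ^ (r * (p - 1)) * z ^ r = z ^ (r * p)"
      using p_gt_3 by (simp add: power_add[symmetric] algebra_simps)
    also have "\<dots> = 1" by (simp add: zpow_eq_1_iff)
    finally show "(1 - z ^ (r * (p - 1))) * z ^ r = - 1 * (1 - z ^ r)" by (simp add: algebra_simps)
  qed
  finally have "\<nu> = (- 1) ^ n * \<rho>"
    by (simp only: prod_R_zpow mult_1_right prod.distrib prod_constant card_R \<rho>_def)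
  moreover have "(- 1 :: complex) ^ n = of_int (chi (- 1))" by (simp add: chi_minus_1)
  ultimately show ?thesis using assms by simp
qed

text \<open>Here \<rho> and \<nu> both have square -p and the two sets of \<open>R_split\<close>
  have equal size, so everything collapses to powers of -p that cancel against the powers of
  \<open>G\<close>. For size n + 1 the dependence on x cancels as well.\<close>

lemma hankel_dets_3_mod_4:
  assumes "p mod 4 = 3"
  shows "H n 0 = 0" "H n 1 = - (2 ^ n)" "H (n + 1) 0 = 2 ^ n" "H (n + 1) 1 = 2 ^ n"
proof -
  have odd: "odd n" using assms p_eq by presburger
  then have c: "chi (- 1) = - 1" by (simp add: chi_minus_1)
  have G2: "G\<^sup>2 = - of_nat p" using gauss_sum_square c by simp
  have \<nu>2: "\<nu>\<^sup>2 = - of_nat p" and \<rho>2: "\<rho>\<^sup>2 = - of_nat p"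
  proof -
    have "- (\<rho> * \<rho>) = of_nat p" using \<rho>_\<nu> unfolding \<nu>_eq_minus_\<rho>[OF c] by simp
    then show "\<rho>\<^sup>2 = - of_nat p" by (metis minus_minus power2_eq_square)
    then show "\<nu>\<^sup>2 = - of_nat p" unfolding \<nu>_eq_minus_\<rho>[OF c] by simp
  qed
  obtain m where m: "n = 2 * m + 1" using odd by (elim oddE)
  define A where "A = {t \<in> R - {1}. chi (int t - 1) = 1}"
  define B where "B = {t \<in> R - {1}. chi (int t - 1) = - 1}"
  have "card A + card B = n - 1" "2 * (int (card A) - int (card B)) = - 1 - chi (- 1)"
    unfolding A_def B_def by (rule R_split)+
  then have "card A = m" "card B = m" using c m by auto
  then have "(\<Prod>r\<in>R. \<Prod>s\<in>R - {r}. z ^ r - z ^ s) = of_nat p ^ m"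
    using prod_R_differences unfolding A_def[symmetric] B_def[symmetric]
    by (simp add: power_mult_distrib[symmetric] \<rho>_\<nu>)
  moreover have "(- 1 :: complex) ^ (n * (n - 1) div 2) = (- 1) ^ m"
    by (simp add: m power_add power_mult)
  ultimately have V2: "V2 = (- of_nat p) ^ m"
    unfolding V2_eq by (simp add: power_mult_distrib[symmetric])
  have Gn: "G ^ n = (- of_nat p) ^ m * G" "G ^ (n + 1) = (- of_nat p) ^ m * (- of_nat p)"
  proof -
    have "G ^ n = (G\<^sup>2) ^ m * G" "G ^ (n + 1) = (G\<^sup>2) ^ m * G\<^sup>2"
      by (simp_all add: m power_mult power2_eq_square)
    then show "G ^ n = (- of_nat p) ^ m * G" "G ^ (n + 1) = (- of_nat p) ^ m * (- of_nat p)"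
      unfolding G2 .
  qed
  have p0: "(- of_nat p :: complex) \<noteq> 0" "(- of_nat p :: complex) ^ m \<noteq> 0" using p_gt_3 by auto
  have small: "H n x = - (2 ^ n * x)" for x
  proof -
    have "(of_nat p - \<nu>\<^sup>2) / (2 * \<nu>\<^sup>2) = - 1" unfolding \<nu>2 using p0 by (simp add: field_simps)
    then have "(- of_nat p) ^ m * G * H n x = (- of_nat p) ^ m * G * (- (2 ^ n * x))"
      using hankel_det_n[of x] unfolding Gn V2 times_divide_eq_right[symmetric] by (simp add: algebra_simps)
    moreover have "(- of_nat p) ^ m * G \<noteq> 0" using p0 G_nonzero by simp
    ultimately show ?thesis by (metis mult_left_cancel)
  qed
  then show "H n 0 = 0" "H n 1 = - (2 ^ n)" by simp_all
  have large: "H (n + 1) x = 2 ^ n" if x: "1 + G * x \<noteq> 0" for x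
  proof -
    have "(of_nat p - \<nu>\<^sup>2) / (2 * of_nat p) = 1" unfolding \<nu>2 using p0 by (simp add: field_simps)
    moreover have gen: "- of_nat p / (of_nat p * y) = - 1 / y" if "y \<noteq> 0" for y :: complex
      using p0 that by (simp add: field_simps)
    moreover have cancel: "y * (1 - 1 - - 1 / y) = 1" if "y \<noteq> 0" for y :: complex
      using that by simp
    ultimately have "(- of_nat p) ^ m * (- of_nat p) * H (n + 1) x = (- of_nat p) ^ m * (- of_nat p) * 2 ^ n"
      using hankel_det_Suc_n[OF x] unfolding Gn V2 \<rho>2 \<nu>2 gen[OF x] by (simp only: mult.assoc cancel[OF x] mult_1_right)
    moreover have "(- of_nat p) ^ m * (- of_nat p :: complex) \<noteq> 0" using p0 by simp
    ultimately show ?thesis by (metis mult_left_cancel)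
  qed
  show "H (n + 1) 0 = 2 ^ n" "H (n + 1) 1 = 2 ^ n"
    using large[of 0] large[of 1] G_neq_minus_1 by simp_all
qed

text \<open>Here the two sets of \<open>R_split\<close> have sizes m - 1 and m for n = 2m, so V2
  times \<rho> is p^m up to the sign chi(2). The names A and B anticipate that A + B G is \<nu>/G,
  the number to be identified with the power of the fundamental unit.\<close>

lemma hankel_dets_1_mod_4:
  assumes "p mod 4 = 1" and G2: "G\<^sup>2 = of_nat p"
  defines "s \<equiv> of_int (chi 2) :: complex"
  defines "A \<equiv> (\<nu> - \<rho>) / (2 * G)" and "B \<equiv> (\<rho> + \<nu>) / (2 * of_nat p)"
  shows "H n 0 = s * 2 ^ n * B" "H n 1 - H n 0 = - (s * 2 ^ n * A)"
    "H (n + 1) 0 = - (s * 2 ^ n * A)" "H (n + 1) 1 - H (n + 1) 0 = s * 2 ^ n * of_nat p * B"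
proof -
  have ev: "even n" using assms p_eq by presburger
  then have c: "chi (- 1) = 1" by (simp add: chi_minus_1)
  obtain m where m: "n = 2 * m" using ev by (elim evenE)
  have m0: "m > 0" using m n_ge_2 by simp
  define A' where "A' = {t \<in> R - {1}. chi (int t - 1) = 1}"
  define B' where "B' = {t \<in> R - {1}. chi (int t - 1) = - 1}"
  have "card A' + card B' = n - 1" "2 * (int (card A') - int (card B')) = - 1 - chi (- 1)"
    unfolding A'_def B'_def by (rule R_split)+
  then have "card A' = m - 1" "card B' = m" using c m by auto
  then have "(\<Prod>r\<in>R. \<Prod>s\<in>R - {r}. z ^ r - z ^ s) * \<rho> = \<rho> ^ (m - 1) * \<nu> ^ m * \<rho>"
    using prod_R_differences unfolding A'_def[symmetric] B'_def[symmetric] by simp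
  also have "\<dots> = of_nat p ^ m"
  proof -
    obtain k where "m = Suc k" using m0 by (cases m) auto
    then show ?thesis unfolding \<rho>_\<nu>[symmetric] by (simp add: power_mult_distrib)
  qed
  finally have d: "(\<Prod>r\<in>R. \<Prod>s\<in>R - {r}. z ^ r - z ^ s) * \<rho> = of_nat p ^ m" .
  have "n * (n - 1) div 2 = m * (n - 1)" by (simp add: m)
  then have "(- 1 :: complex) ^ (n * (n - 1) div 2) = ((- 1) ^ (n - 1)) ^ m"
    by (simp add: power_mult[symmetric] mult.commute)
  also have "(- 1 :: complex) ^ (n - 1) = - 1" using ev m0 m by simp
  also have "(- 1 :: complex) ^ m = s" unfolding s_def chi_2[OF assms(1)] by (simp add: m)
  finally have V2: "V2 * \<rho> = s * of_nat p ^ m"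
    unfolding V2_eq using d by (simp add: mult.assoc)
  have V2': "V2 = s * of_nat p ^ m / \<rho>" using V2 \<rho>_nonzero by (simp add: field_simps)
  have Gn: "G ^ n = of_nat p ^ m" "G ^ (n + 1) = of_nat p ^ m * G"
    using G2 by (simp_all add: m power_mult)
  have p0: "(of_nat p :: complex) ^ m \<noteq> 0" using p_gt_3 by auto
  have pr: "of_nat p = \<rho> * \<nu>" by (simp add: \<rho>_\<nu>)
  have "of_nat p ^ m * H n x = of_nat p ^ m * (s * 2 ^ n / \<rho> * (1 + (1 + G * x) * (of_nat p - \<nu>\<^sup>2) / (2 * \<nu>\<^sup>2)))" for x
    using hankel_det_n[of x] unfolding Gn V2' by (simp add: algebra_simps)
  then have small: "H n x = s * 2 ^ n / \<rho> * (1 + (1 + G * x) * (of_nat p - \<nu>\<^sup>2) / (2 * \<nu>\<^sup>2))" for x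
    using p0 by (simp only: mult_cancel_left) simp
  have r: "(of_nat p - \<nu>\<^sup>2) / (2 * \<nu>\<^sup>2) = (\<rho> - \<nu>) / (2 * \<nu>)"
    unfolding pr using \<nu>_nonzero by (simp add: field_simps power2_eq_square)
  have small': "H n x = s * 2 ^ n / \<rho> * (1 + (1 + G * x) * ((\<rho> - \<nu>) / (2 * \<nu>)))" for x
    unfolding small times_divide_eq_right[symmetric] r ..
  show "H n 0 = s * 2 ^ n * B"
    unfolding small' B_def pr using \<rho>_nonzero \<nu>_nonzero by (simp add: field_simps)
  have "H n 1 - H n 0 = s * 2 ^ n * (G * (\<rho> - \<nu>) / (2 * (\<rho> * \<nu>)))"
    unfolding small' using \<rho>_nonzero \<nu>_nonzero by (simp add: field_simps)
  also have "\<rho> * \<nu> = G * G" using G2 by (simp add: pr power2_eq_square)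
  also have "G * (\<rho> - \<nu>) / (2 * (G * G)) = - A"
    unfolding A_def using G_nonzero by (simp add: field_simps)
  finally show "H n 1 - H n 0 = - (s * 2 ^ n * A)" by simp
  have large: "H (n + 1) x = s * 2 ^ n * ((1 + G * x) * (\<rho> + \<nu>) / (2 * G) - \<nu> / G)" if x: "1 + G * x \<noteq> 0" for x
  proof -
    define Y where "Y = (1 + G * x) * (1 - (of_nat p - \<nu>\<^sup>2) / (2 * of_nat p) - \<nu>\<^sup>2 / (of_nat p * (1 + G * x)))"
    have "of_nat p ^ m * G * H (n + 1) x = s * of_nat p ^ m / \<rho> * \<rho>\<^sup>2 * 2 ^ n * Y"
      using hankel_det_Suc_n[OF x] unfolding Gn V2' Y_def by (simp only: mult.assoc)
    then have "of_nat p ^ m * H (n + 1) x = of_nat p ^ m * (s * 2 ^ n * \<rho> / G * Y)"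
      using \<rho>_nonzero G_nonzero by (simp add: field_simps power2_eq_square)
    then have "of_nat p ^ m * H (n + 1) x = of_nat p ^ m * (s * 2 ^ n * \<rho> / G * ((1 + G * x) *
        (1 - (of_nat p - \<nu>\<^sup>2) / (2 * of_nat p) - \<nu>\<^sup>2 / (of_nat p * (1 + G * x)))))"
      unfolding Y_def .
    then have "H (n + 1) x = s * 2 ^ n * \<rho> / G * ((1 + G * x) *
        (1 - (of_nat p - \<nu>\<^sup>2) / (2 * of_nat p) - \<nu>\<^sup>2 / (of_nat p * (1 + G * x))))"
      using p0 by (simp only: mult_cancel_left) simp
    also have "(of_nat p - \<nu>\<^sup>2) / (2 * of_nat p) = (\<rho> - \<nu>) / (2 * \<rho>)"
      unfolding pr using \<nu>_nonzero \<rho>_nonzero by (simp add: divide_simps power2_eq_square) (simp add: algebra_simps)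
    also have "\<nu>\<^sup>2 / (of_nat p * (1 + G * x)) = \<nu> / (\<rho> * (1 + G * x))"
      unfolding pr using \<nu>_nonzero \<rho>_nonzero x by (simp add: divide_simps power2_eq_square)
    finally show ?thesis using \<rho>_nonzero \<nu>_nonzero G_nonzero x
      by (simp add: divide_simps) (simp add: algebra_simps)
  qed
  have l0: "H (n + 1) 0 = s * 2 ^ n * ((\<rho> + \<nu>) / (2 * G) - \<nu> / G)"
    using large[of 0] by simp
  moreover have "(\<rho> + \<nu>) / (2 * G) - \<nu> / G = - A"
    unfolding A_def using G_nonzero by (simp add: field_simps)
  ultimately show "H (n + 1) 0 = - (s * 2 ^ n * A)" by simp
  have l1: "H (n + 1) 1 = s * 2 ^ n * ((1 + G) * (\<rho> + \<nu>) / (2 * G) - \<nu> / G)"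
    using large[of 1] G_neq_minus_1 by simp
  show "H (n + 1) 1 - H (n + 1) 0 = s * 2 ^ n * of_nat p * B"
    unfolding l0 l1 B_def using G_nonzero p_gt_3 by (simp add: field_simps)
qed

text \<open>As chi(-1) = 1, the set is stable under r -> p - r, which has no fixed point because p
  is odd. Paired factors are complex conjugates, so each pair gives a squared modulus.\<close>

lemma prod_even_real:
  assumes c: "chi (- 1) = 1" and c0: "c \<noteq> 0"
  defines "S \<equiv> {r \<in> {..<p}. chi (int r) = c}"
  shows "\<exists>x>0. (\<Prod>r\<in>S. 1 - z ^ r) = of_real x"
proof -
  define S1 where "S1 = {r \<in> S. 2 * r < p}"
  define S2 where "S2 = {r \<in> S. 2 * r > p}"
  have S: "S = S1 \<union> S2"
  proof -
    have "2 * r \<noteq> p" for r using p_eq by presburger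
    then show ?thesis unfolding S1_def S2_def by (auto simp: nat_neq_iff)
  qed
  have fin: "finite S1" "finite S2" by (auto simp: S1_def S2_def S_def)
  have pos: "0 < r" if "r \<in> S" for r using that c0 by (cases r) (auto simp: S_def)
  have chi: "chi (int (p - r)) = chi (int r)" if "r \<le> p" for r
  proof -
    have "[int (p - r) = - 1 * int r] (mod int p)"
      using that by (simp add: of_nat_diff cong_iff_dvd_diff)
    from trans[OF chi_cong[OF this] chi_mult] show ?thesis using c by simp
  qed
  have bij: "bij_betw (\<lambda>r. p - r) S1 S2"
    by (rule bij_betwI[of _ _ _ "\<lambda>r. p - r"])
      (use pos in \<open>auto simp: S1_def S2_def S_def chi simp del: of_nat_diff\<close>)
  have "(\<Prod>r\<in>S. 1 - z ^ r) = (\<Prod>r\<in>S1. 1 - z ^ r) * (\<Prod>r\<in>S2. 1 - z ^ r)"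
    unfolding S by (rule prod.union_disjoint) (use fin in \<open>auto simp: S1_def S2_def\<close>)
  also have "(\<Prod>r\<in>S2. 1 - z ^ r) = (\<Prod>r\<in>S1. 1 - z ^ (p - r))"
    by (rule prod.reindex_bij_betw[OF bij, symmetric])
  also have "(\<Prod>r\<in>S1. 1 - z ^ r) * \<dots> = (\<Prod>r\<in>S1. of_real ((norm (1 - z ^ r))\<^sup>2))"
    unfolding prod.distrib[symmetric]
  proof (rule prod.cong[OF refl])
    fix r assume "r \<in> S1"
    then have "r \<le> p" by (auto simp: S1_def)
    have "z ^ (p - r) * z ^ r = 1" using \<open>r \<le> p\<close> by (simp add: power_add[symmetric] z_p)
    moreover have "cnj (z ^ r) * z ^ r = 1"
      by (metis complex_norm_square mult.commute norm_power norm_z of_real_1 power_one)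
    ultimately have "z ^ (p - r) = cnj (z ^ r)" using z_nonzero by (metis mult_cancel_right power_not_zero)
    then show "(1 - z ^ r) * (1 - z ^ (p - r)) = of_real ((norm (1 - z ^ r))\<^sup>2)"
      using complex_norm_square[of "1 - z ^ r"] by simp
  qed
  also have "\<dots> = of_real (\<Prod>r\<in>S1. (norm (1 - z ^ r))\<^sup>2)" by simp
  finally have "(\<Prod>r\<in>S. 1 - z ^ r) = of_real (\<Prod>r\<in>S1. (norm (1 - z ^ r))\<^sup>2)" .
  moreover have "(\<Prod>r\<in>S1. (norm (1 - z ^ r))\<^sup>2) > 0"
  proof (rule prod_pos)
    fix r assume r: "r \<in> S1"
    then have "0 < r" "r < p" using pos by (auto simp: S1_def)
    then have "z ^ r \<noteq> 1" by (auto simp: zpow_eq_1_iff dest: dvd_imp_le)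
    then show "(norm (1 - z ^ r))\<^sup>2 > 0" by simp
  qed
  ultimately show ?thesis by blast
qed

lemma \<rho>_real:
  assumes "chi (- 1) = 1"
  shows "\<rho> = of_real (norm \<rho>) \<and> norm \<rho> > 0"
proof -
  obtain x where "x > 0" "\<rho> = of_real x"
    using prod_even_real[OF assms, of 1] unfolding \<rho>_def R_def by auto
  then show ?thesis by simp
qed

lemma \<nu>_real:
  assumes "chi (- 1) = 1"
  shows "\<nu> = of_real (norm \<nu>) \<and> norm \<nu> > 0"
proof -
  obtain x where "x > 0" "\<nu> = of_real x"
    using prod_even_real[OF assms, of "- 1"] unfolding \<nu>_def N_def by auto
  then show ?thesis by simp
qed

end

section \<open>The value of the L-series at 1\<close>

text \<open>Along the segment from 0 to \<open>w\<close> the remainder after N terms has derivative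
  w (t w)^N / (1 - t w). The denominator stays away from 0 because \<open>w\<close> is not 1, so the
  remainder at t = 1 is of order 1/N.\<close>

lemma tendsto_log_series_boundary:
  fixes w :: complex
  assumes w: "norm w = 1" "w \<noteq> 1"
  shows "(\<lambda>N. \<Sum>m=1..N. w ^ m / of_nat m) \<longlonglongrightarrow> - Ln (1 - w)"
proof -
  have Re_w: "Re w < 1"
  proof -
    have "Re w \<le> 1" using w(1) complex_Re_le_cmod[of w] by simp
    moreover have "Re w \<noteq> 1"
    proof
      assume "Re w = 1"
      then have "Im w = 0" using w(1) by (simp add: cmod_def)
      with \<open>Re w = 1\<close> w(2) show False by (simp add: complex_eq_iff)
    qed
    ultimately show ?thesis by simp
  qed
  \<comment> \<open>A lower bound for Re (1 - t w) on the whole segment; the 1 covers the case of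
    nonpositive Re w.\<close>
  define \<delta> where "\<delta> = min 1 (1 - Re w)"
  have \<delta>: "\<delta> > 0" using Re_w by (simp add: \<delta>_def)
  have Re_ge: "\<delta> \<le> Re (1 - of_real t * w)" if "0 \<le> t" "t \<le> 1" for t
  proof -
    have "t * Re w \<le> max 0 (Re w)"
      using that mult_left_le_one_le[of "Re w" t] mult_nonneg_nonpos[of t "Re w"] by (cases "Re w \<ge> 0") auto
    then show ?thesis by (simp add: \<delta>_def)
  qed
  have bound: "norm ((\<Sum>m=1..N. w ^ m / of_nat m) + Ln (1 - w)) \<le> 1 / (of_nat (Suc N) * \<delta>)" for N
  proof -
    define D where "D t = - Ln (1 - of_real t * w) - (\<Sum>m=1..N. (of_real t * w) ^ m / of_nat m)" for t :: real
    define D' where "D' t = w * (of_real t * w) ^ N / (1 - of_real t * w)" for t :: real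
    \<comment> \<open>An antiderivative of the bound t^N / \<delta> for the norm of
      \<open>D'\<close>.\<close>
    define \<phi> where "\<phi> t = t ^ Suc N / (of_nat (Suc N) * \<delta>)" for t :: real
    have D: "(D has_vector_derivative D' t) (at t)" if t: "0 \<le> t" "t \<le> 1" for t
    proof -
      have ne: "1 - of_real t * w \<noteq> 0" using Re_ge[OF t] \<delta> by (auto simp: complex_eq_iff)
      have nn: "1 - of_real t * w \<notin> \<real>\<^sub>\<le>\<^sub>0"
        using Re_ge[OF t] \<delta> by (auto simp: complex_nonpos_Reals_iff)
      have s: "(\<Sum>m=1..N. of_nat m * (u * w) ^ (m - 1) * w / of_nat m) = w * (\<Sum>m<N. (u * w) ^ m)" for u :: complex
      proof -
        have "(\<Sum>m=1..N. of_nat m * (u * w) ^ (m - 1) * w / of_nat m) = (\<Sum>m=1..N. w * (u * w) ^ (m - 1))"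
          by (rule sum.cong) auto
        also have "\<dots> = (\<Sum>m<N. w * (u * w) ^ m)"
          by (rule sum.reindex_bij_witness[of _ Suc "\<lambda>m. m - 1"]) auto
        finally show ?thesis by (simp add: sum_distrib_left)
      qed
      have g: "(\<Sum>m<N. (of_real t * w) ^ m) = (1 - (of_real t * w) ^ N) / (1 - of_real t * w)"
        using one_diff_power_eq[of "of_real t * w" N] ne by (simp add: field_simps)
      have "((\<lambda>u. - Ln (1 - u * w) - (\<Sum>m=1..N. (u * w) ^ m / of_nat m)) has_field_derivative
          (w / (1 - of_real t * w) - (\<Sum>m=1..N. of_nat m * (of_real t * w) ^ (m - 1) * w / of_nat m))) (at (of_real t))"
        by (rule derivative_eq_intros refl nn | (use nn in \<open>simp add: field_simps\<close>))+
      then have "((\<lambda>u. - Ln (1 - u * w) - (\<Sum>m=1..N. (u * w) ^ m / of_nat m)) has_field_derivative D' t) (at (of_real t))"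
      proof -
        have "w / (1 - of_real t * w) - w * ((1 - (of_real t * w) ^ N) / (1 - of_real t * w)) = D' t"
          unfolding D'_def by (simp add: diff_divide_distrib right_diff_distrib)
        with \<open>(_ has_field_derivative _) _\<close> show ?thesis unfolding s g by simp
      qed
      from has_vector_derivative_real_field[OF this] show ?thesis unfolding D_def .
    qed
    have "norm (D 1 - D 0) \<le> \<phi> 1 - \<phi> 0"
    proof (rule differentiable_bound_general[where f' = D' and \<phi>' = "\<lambda>t. t ^ N / \<delta>"])
      show "continuous_on {0..1} D"
        using D by (intro continuous_at_imp_continuous_on ballI has_vector_derivative_continuous) auto
      show "continuous_on {0..1} \<phi>" unfolding \<phi>_def using \<delta> by (intro continuous_intros) auto
      fix t :: real assume t: "0 < t" "t < 1"
      show "(D has_vector_derivative D' t) (at t)" using D t by simp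
      have "(\<phi> has_real_derivative (of_nat (Suc N) * t ^ N / (of_nat (Suc N) * \<delta>))) (at t)"
        unfolding \<phi>_def by (rule DERIV_cdivide) (use DERIV_pow[of "Suc N" t UNIV] in simp)
      then show "(\<phi> has_vector_derivative t ^ N / \<delta>) (at t)"
        by (simp add: has_real_derivative_iff_has_vector_derivative)
      have "\<delta> \<le> norm (1 - of_real t * w)"
        using Re_ge[of t] complex_Re_le_cmod[of "1 - of_real t * w"] t by simp
      then show "norm (D' t) \<le> t ^ N / \<delta>"
        unfolding D'_def using \<delta> t w(1) by (simp add: norm_mult norm_divide norm_power power_mult_distrib frac_le)
    qed simp
    moreover have "D 0 = 0" by (simp add: D_def power_0_left)
    moreover have "D 1 = - ((\<Sum>m=1..N. w ^ m / of_nat m) + Ln (1 - w))" by (simp add: D_def)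
    moreover have "\<phi> 0 = 0" "\<phi> 1 = 1 / (of_nat (Suc N) * \<delta>)" by (simp_all add: \<phi>_def)
    ultimately show ?thesis by (simp only: norm_minus_cancel diff_0_right)
  qed
  have lim: "(\<lambda>N. 1 / (of_nat (Suc N) * \<delta>)) \<longlonglongrightarrow> 0"
  proof -
    have "(\<lambda>N. inverse (of_nat (Suc N)) * (1 / \<delta>)) \<longlonglongrightarrow> 0 * (1 / \<delta>)"
      by (intro tendsto_mult tendsto_const LIMSEQ_inverse_real_of_nat)
    then show ?thesis by (simp add: field_simps)
  qed
  have "(\<lambda>N. (\<Sum>m=1..N. w ^ m / of_nat m) - (- Ln (1 - w))) \<longlonglongrightarrow> 0"
    by (rule Lim_null_comparison[OF _ lim]) (use bound in simp)
  then show ?thesis by (rule LIM_zero_cancel)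
qed

text \<open>Summation by parts; the differences of \<open>g\<close> are nonnegative and
  telescope.\<close>

lemma abel_inequality:
  fixes a g :: "nat \<Rightarrow> real"
  assumes A: "\<And>k. \<bar>\<Sum>i<k. a i\<bar> \<le> M" and g: "\<And>i. g (Suc i) \<le> g i" "\<And>i. g i \<ge> 0"
  shows "\<bar>\<Sum>i<k. a i * g i\<bar> \<le> M * g 0"
proof -
  have parts: "(\<Sum>i<k. a i * g i) = (\<Sum>i<k. a i) * g k + (\<Sum>i<k. (\<Sum>j<Suc i. a j) * (g i - g (Suc i)))"
    by (induction k) (auto simp: algebra_simps)
  have "\<bar>\<Sum>i<k. a i * g i\<bar> \<le> \<bar>(\<Sum>i<k. a i) * g k\<bar> + (\<Sum>i<k. \<bar>(\<Sum>j<Suc i. a j) * (g i - g (Suc i))\<bar>)"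
    unfolding parts by (rule order_trans[OF abs_triangle_ineq add_left_mono[OF sum_abs]])
  also have "\<dots> \<le> M * g k + (\<Sum>i<k. M * (g i - g (Suc i)))"
  proof -
    have "M \<ge> 0" using A[of 0] by simp
    then show ?thesis
      unfolding abs_mult using g
      by (intro add_mono sum_mono mult_mono A) (auto simp: abs_of_nonneg)
  qed
  also have "\<dots> = M * g 0"
    unfolding sum_distrib_left[symmetric] sum_lessThan_telescope' by (simp add: algebra_simps)
  finally show ?thesis .
qed

lemma card_multiples:
  assumes "d > 0"
  shows "card {m \<in> {1..X}. d dvd m} = X div (d :: nat)"
proof -
  have "bij_betw (\<lambda>k. d * k) {1..X div d} {m \<in> {1..X}. d dvd m}"
    by (rule bij_betwI[of _ _ _ "\<lambda>m. m div d"])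
      (use assms in \<open>auto simp: div_le_mono mult.commute less_eq_div_iff_mult_less_eq elim!: dvdE\<close>)
  from bij_betw_same_card[OF this] show ?thesis by simp
qed

section \<open>The average order of the divisor sums of the character\<close>

context odd_prime
begin

text \<open>The coefficients of the Dirichlet series zeta(s) L(s, chi). For p = 1 mod 4 they are
  identified in \<open>ideal_count_eq\<close> and \<open>card_triples\<close> with the numbers of
  ideals of norm m.\<close>

definition r :: "nat \<Rightarrow> int" where "r m = (\<Sum>d | d dvd m. chi (int d))"

lemma sum_chi_bound: "\<bar>\<Sum>i<k. chi (int i)\<bar> \<le> int p"
proof (induction k rule: less_induct)
  case (less k)
  show ?case
  proof (cases "k < p")
    case True
    have "\<bar>\<Sum>i<k. chi (int i)\<bar> \<le> (\<Sum>i<k. \<bar>chi (int i)\<bar>)" by (rule sum_abs)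
    also have "\<dots> \<le> (\<Sum>i<k. 1)"
    proof (rule sum_mono)
      fix i show "\<bar>chi (int i)\<bar> \<le> 1" using chi_values[of "int i"] by auto
    qed
    finally show ?thesis using True by simp
  next
    case False
    then obtain j where k: "k = p + j" using le_Suc_ex not_less by blast
    have "(\<Sum>i<k. chi (int i)) = (\<Sum>i<p. chi (int i)) + (\<Sum>i<j. chi (int (p + i)))"
      unfolding k by (induction j) (auto simp: add.assoc)
    also have "(\<Sum>i<j. chi (int (p + i))) = (\<Sum>i<j. chi (int i))"
      by (rule sum.cong[OF refl], rule chi_cong) (simp add: cong_iff_dvd_diff)
    finally show ?thesis using less[of j] k p_gt_3 by (simp add: sum_chi)
  qed
qed

lemma sum_chi_shift_bound: "\<bar>\<Sum>i<k. real_of_int (chi (int (c + i)))\<bar> \<le> 2 * real p"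
proof -
  have "(\<Sum>i<c + k. chi (int i)) = (\<Sum>i<c. chi (int i)) + (\<Sum>i<k. chi (int (c + i)))"
    by (induction k) (auto simp: add.assoc)
  then have "\<bar>\<Sum>i<k. chi (int (c + i))\<bar> \<le> 2 * int p"
    using sum_chi_bound[of "c + k"] sum_chi_bound[of c] by linarith
  then have "real_of_int \<bar>\<Sum>i<k. chi (int (c + i))\<bar> \<le> real_of_int (2 * int p)" by (simp only: of_int_le_iff)
  then show ?thesis by simp
qed

lemma sum_r: "(\<Sum>m=1..X. r m) = (\<Sum>d=1..X. chi (int d) * int (X div d))"
proof -
  have "(\<Sum>m=1..X. r m) = (\<Sum>m=1..X. \<Sum>d\<in>{d \<in> {1..X}. d dvd m}. chi (int d))"
  proof (rule sum.cong[OF refl])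
    fix m assume "m \<in> {1..X}"
    then have "{d. d dvd m} = {d \<in> {1..X}. d dvd m}"
      by (auto simp: Suc_le_eq dvd_pos_nat intro: order_trans dest: dvd_imp_le)
    then show "r m = (\<Sum>d\<in>{d \<in> {1..X}. d dvd m}. chi (int d))" by (simp add: r_def)
  qed
  also have "\<dots> = (\<Sum>d=1..X. \<Sum>m\<in>{m \<in> {1..X}. d dvd m}. chi (int d))"
    by (rule sum.swap_restrict) auto
  also have "\<dots> = (\<Sum>d=1..X. chi (int d) * int (X div d))"
    by (rule sum.cong[OF refl]) (simp add: card_multiples[symmetric] mult.commute)
  finally show ?thesis .
qed

definition S :: "nat \<Rightarrow> real" where "S K = (\<Sum>d=1..K. of_int (chi (int d)) / of_nat d)"

text \<open>For d up to \<open>Z\<close>, replacing X div d by X/d costs at most 1 per term. For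
  larger d the quotients X div d decrease and the character sums are bounded, so Abel's inequality
  applies.\<close>

lemma sum_r_approx:
  assumes "Z \<le> X"
  shows "\<bar>of_int (\<Sum>m=1..X. r m) - real X * S Z\<bar> \<le> real Z + 2 * real p * (real X / real (Suc Z))"
proof -
  let ?c = "\<lambda>d. real_of_int (chi (int d))"
  have "of_int (\<Sum>m=1..X. r m) = (\<Sum>d=1..X. ?c d * real (X div d))"
    unfolding sum_r by simp
  also have "\<dots> = (\<Sum>d\<in>{1..Z} \<union> {Z + 1..X}. ?c d * real (X div d))"
    by (rule sum.cong) (use assms in auto)
  also have "(\<Sum>d\<in>{1..Z} \<union> {Z + 1..X}. ?c d * real (X div d)) =
      (\<Sum>d=1..Z. ?c d * real (X div d)) + (\<Sum>d=Z + 1..X. ?c d * real (X div d))"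
    by (rule sum.union_disjoint) auto
  also have "(\<Sum>d=Z + 1..X. ?c d * real (X div d)) = (\<Sum>i<X - Z. ?c (Suc Z + i) * real (X div (Suc Z + i)))"
    by (rule sum.reindex_bij_witness[of _ "\<lambda>i. Suc Z + i" "\<lambda>d. d - Suc Z"]) auto
  finally have split: "of_int (\<Sum>m=1..X. r m) - real X * S Z =
      (\<Sum>d=1..Z. ?c d * (real (X div d) - real X / real d)) + (\<Sum>i<X - Z. ?c (Suc Z + i) * real (X div (Suc Z + i)))"
    unfolding S_def by (simp add: sum_distrib_left right_diff_distrib sum_subtractf algebra_simps)
  have "\<bar>\<Sum>d=1..Z. ?c d * (real (X div d) - real X / real d)\<bar> \<le> (\<Sum>d=1..Z. \<bar>?c d * (real (X div d) - real X / real d)\<bar>)"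
    by (rule sum_abs)
  also have "\<dots> \<le> (\<Sum>d=1..Z. 1)"
  proof (rule sum_mono)
    fix d assume "d \<in> {1..Z}"
    have "\<bar>?c d\<bar> \<le> 1" using chi_values[of "int d"] by auto
    moreover have "\<bar>real (X div d) - real X / real d\<bar> \<le> 1"
      using floor_divide_of_nat_eq[of X d, where ?'a = real] by linarith
    ultimately show "\<bar>?c d * (real (X div d) - real X / real d)\<bar> \<le> 1"
      unfolding abs_mult using mult_mono[of "\<bar>?c d\<bar>" 1 "\<bar>real (X div d) - real X / real d\<bar>" 1] by simp
  qed
  finally have 1: "\<bar>\<Sum>d=1..Z. ?c d * (real (X div d) - real X / real d)\<bar> \<le> real Z" by simp
  have "\<bar>\<Sum>i<X - Z. ?c (Suc Z + i) * real (X div (Suc Z + i))\<bar> \<le> 2 * real p * real (X div (Suc Z + 0))"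
    by (rule abel_inequality[OF sum_chi_shift_bound]) (auto intro: div_le_mono2)
  also have "\<dots> \<le> 2 * real p * (real X / real (Suc Z))"
    by (rule mult_left_mono) (use of_nat_div_le_of_nat[of X "Suc Z", where ?'a = real] in auto)
  finally have 2: "\<bar>\<Sum>i<X - Z. ?c (Suc Z + i) * real (X div (Suc Z + i))\<bar> \<le> 2 * real p * (real X / real (Suc Z))" .
  show ?thesis unfolding split using 1 2 by linarith
qed

lemma sum_r_asymp:
  assumes "S \<longlonglongrightarrow> l"
  shows "(\<lambda>X. of_int (\<Sum>m=1..X. r m) / real X) \<longlonglongrightarrow> l"
proof -
  \<comment> \<open>The cut at sqrt X balances the two error terms; both are then of order sqrt
    X.\<close>
  define Z where "Z X = nat \<lfloor>sqrt (real X)\<rfloor>" for X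
  have Z: "real (Z X) \<le> sqrt (real X)" "sqrt (real X) \<le> real (Suc (Z X))" for X
    unfolding Z_def by (auto simp: le_nat_floor) linarith+
  have ZX: "Z X \<le> X" for X
  proof -
    have "sqrt (real X) \<le> real X" by (cases "X = 0") (auto simp: real_le_lsqrt power2_eq_square real_sqrt_le_iff' intro!: real_le_lsqrt)
    then show ?thesis using Z(1)[of X] by linarith
  qed
  have Zlim: "filterlim Z at_top sequentially"
    unfolding Z_def
    by (rule filterlim_compose[OF filterlim_nat_sequentially])
      (intro filterlim_compose[OF filterlim_floor_sequentially] filterlim_compose[OF sqrt_at_top] filterlim_real_sequentially)
  have lim: "(\<lambda>X. (1 + 2 * real p) * (1 / sqrt (real X))) \<longlonglongrightarrow> (1 + 2 * real p) * 0"
    by (intro tendsto_intros tendsto_divide_0[OF tendsto_const] filterlim_at_top_imp_at_infinity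
        filterlim_compose[OF sqrt_at_top filterlim_real_sequentially])
  have "(\<lambda>X. of_int (\<Sum>m=1..X. r m) / real X - S (Z X)) \<longlonglongrightarrow> 0"
  proof (rule Lim_null_comparison)
    show "\<forall>\<^sub>F X in sequentially. norm (of_int (\<Sum>m=1..X. r m) / real X - S (Z X)) \<le> (1 + 2 * real p) * (1 / sqrt (real X))"
      using eventually_gt_at_top[of 0]
    proof eventually_elim
      fix X :: nat assume X: "X > 0"
      have sq: "real X = sqrt (real X) * sqrt (real X)" by simp
      have "real X / real (Suc (Z X)) \<le> real X / sqrt (real X)"
        using Z(2)[of X] X by (intro divide_left_mono) auto
      also have "\<dots> = sqrt (real X)" by (simp add: real_div_sqrt)
      finally have "\<bar>of_int (\<Sum>m=1..X. r m) - real X * S (Z X)\<bar> \<le> sqrt (real X) + 2 * real p * sqrt (real X)"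
        using sum_r_approx[OF ZX[of X]] Z(1)[of X] mult_left_mono[of "real X / real (Suc (Z X))" "sqrt (real X)" "2 * real p"]
        by linarith
      then have "\<bar>of_int (\<Sum>m=1..X. r m) - real X * S (Z X)\<bar> / real X \<le> (1 + 2 * real p) * sqrt (real X) / real X"
        by (intro divide_right_mono) (auto simp: algebra_simps)
      also have "(1 + 2 * real p) * sqrt (real X) / real X = (1 + 2 * real p) * (1 / sqrt (real X))"
        using X by (subst (2) sq) (simp del: real_sqrt_mult_self)
      finally have le: "\<bar>of_int (\<Sum>m=1..X. r m) - real X * S (Z X)\<bar> / real X \<le> (1 + 2 * real p) * (1 / sqrt (real X))" .
      show "norm (of_int (\<Sum>m=1..X. r m) / real X - S (Z X)) \<le> (1 + 2 * real p) * (1 / sqrt (real X))"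
      proof -
        have "of_int (\<Sum>m=1..X. r m) / real X - S (Z X) = (of_int (\<Sum>m=1..X. r m) - real X * S (Z X)) / real X"
          using X by (simp add: field_simps del: of_int_sum)
        then show ?thesis
          using le by (simp only: real_norm_def abs_divide abs_of_nat)
      qed
    qed
  qed (use lim in simp)
  moreover have "(\<lambda>X. S (Z X)) \<longlonglongrightarrow> l" by (rule filterlim_compose[OF assms Zlim])
  ultimately show ?thesis using tendsto_add by fastforce
qed

end

context root_of_unity
begin

text \<open>Multiplication by \<open>G\<close> turns chi(d) into a difference of sums of z^(m d),
  hence the partial sums into logarithm series on the unit circle. Since \<open>G\<close> is real,
  only real parts matter, and the real part of \<open>Ln\<close> is the logarithm of the norm,
  whatever the branch.\<close>

lemma S_limit:
  assumes c: "chi (- 1) = 1" and G: "G = of_real (sqrt (real p))"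
  shows "S \<longlonglongrightarrow> (ln (norm \<nu>) - ln (norm \<rho>)) / sqrt (real p)"
proof -
  let ?T = "\<lambda>w K. \<Sum>d=1..K. w ^ d / of_nat d :: complex"
  have "of_real (S K) = (1 / G) * (\<Sum>m\<in>R. ?T (z ^ m) K) - (1 / G) * (\<Sum>m\<in>N. ?T (z ^ m) K)" for K
  proof -
    have "G * of_real (S K) = (\<Sum>d=1..K. (of_int (chi (int d)) * G) / of_nat d)"
      by (simp add: S_def sum_distrib_left mult.commute)
    also have "\<dots> = (\<Sum>d=1..K. (\<Sum>m\<in>R. z ^ (m * d) / of_nat d) - (\<Sum>m\<in>N. z ^ (m * d) / of_nat d))"
    proof (rule sum.cong[OF refl])
      fix d
      have "of_int (chi (int d)) * G = (\<Sum>m\<in>R. z ^ (m * d)) - (\<Sum>m\<in>N. z ^ (m * d))"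
        unfolding gauss_sum_twist[symmetric] by (rule sum_chi_R_N)
      then show "(of_int (chi (int d)) * G) / of_nat d = (\<Sum>m\<in>R. z ^ (m * d) / of_nat d) - (\<Sum>m\<in>N. z ^ (m * d) / of_nat d)"
        by (simp add: diff_divide_distrib sum_divide_distrib)
    qed
    also have "\<dots> = (\<Sum>m\<in>R. ?T (z ^ m) K) - (\<Sum>m\<in>N. ?T (z ^ m) K)"
      unfolding sum_subtractf power_mult by (simp only: sum.swap[of _ R] sum.swap[of _ N])
    finally show ?thesis using G_nonzero by (simp add: field_simps)
  qed
  moreover have T: "(\<lambda>K. ?T (z ^ m) K) \<longlonglongrightarrow> - Ln (1 - z ^ m)" if "m \<in> R \<union> N" for m
    by (rule tendsto_log_series_boundary)
      (use that R_N_not_dvd in \<open>auto simp: norm_power norm_z zpow_eq_1_iff\<close>)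
  ultimately have "(\<lambda>K. of_real (S K)) \<longlonglongrightarrow>
      (1 / G) * (\<Sum>m\<in>R. - Ln (1 - z ^ m)) - (1 / G) * (\<Sum>m\<in>N. - Ln (1 - z ^ m))"
    by (simp only:) (intro tendsto_intros T; simp)
  then have "(\<lambda>K. Re (of_real (S K))) \<longlonglongrightarrow>
      Re ((1 / G) * (\<Sum>m\<in>R. - Ln (1 - z ^ m)) - (1 / G) * (\<Sum>m\<in>N. - Ln (1 - z ^ m)))"
    by (rule tendsto_Re)
  moreover have nz: "1 - z ^ m \<noteq> 0" if "m \<in> R \<union> N" for m
    using that R_N_not_dvd zpow_eq_1_iff by fastforce
  have "Re (\<Sum>m\<in>R. - Ln (1 - z ^ m)) = - ln (norm \<rho>)"
    unfolding \<rho>_def prod_norm[symmetric] using nz by (subst ln_prod) (auto simp: sum_negf)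
  moreover have "Re (\<Sum>m\<in>N. - Ln (1 - z ^ m)) = - ln (norm \<nu>)"
    unfolding \<nu>_def prod_norm[symmetric] using nz by (subst ln_prod) (auto simp: sum_negf)
  moreover have "Re ((1 / G) * a) = Re a / sqrt (real p)" for a
    unfolding G by simp
  ultimately show ?thesis by (simp add: diff_divide_distrib)
qed

end

section \<open>Counting roots of a quadratic polynomial modulo integers\<close>

text \<open>The norm of \<open>b + \<omega>\<close> is \<open>b\<^sup>2 + b - q\<close>, where \<open>\<omega> = (1 + \<surd>p)/2\<close> and \<open>p = 4 q + 1\<close>; its roots modulo \<open>a\<close>
  are the \<open>b\<close> for which \<open>\<int> a + \<int> (b + \<omega>)\<close> is an ideal.\<close>

definition root_poly :: "int \<Rightarrow> int \<Rightarrow> int" where "root_poly q b = b\<^sup>2 + b - q"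

definition root_count :: "int \<Rightarrow> nat \<Rightarrow> nat" where
  "root_count q a = card {b \<in> {0..<int a}. int a dvd root_poly q b}"

lemma root_poly_cong: "[x = y] (mod m) \<Longrightarrow> m dvd root_poly q x \<longleftrightarrow> m dvd root_poly q y"
proof -
  assume "[x = y] (mod m)"
  then have "[root_poly q x = root_poly q y] (mod m)" unfolding root_poly_def by (intro cong_add cong_diff cong_pow cong_refl)
  then show ?thesis by (rule cong_dvd_iff)
qed

lemma root_count_1 [simp]: "root_count q (Suc 0) = 1"
proof -
  have "{b \<in> {0..<int 1}. int 1 dvd root_poly q b} = {0}" by auto
  then show ?thesis by (simp add: root_count_def)
qed

text \<open>The Chinese remainder theorem, applied to pairs of roots.\<close>

lemma root_count_mult:
  assumes "coprime a b" "a > 0" "b > 0"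
  shows "root_count q (a * b) = root_count q a * root_count q b"
proof -
  let ?A = "\<lambda>a. {x \<in> {0..<int a}. int a dvd root_poly q x}"
  have cop: "coprime (int a) (int b)" using assms by simp
  have "bij_betw (\<lambda>x. (x mod int a, x mod int b)) (?A (a * b)) (?A a \<times> ?A b)"
  proof (rule bij_betw_imageI)
    show "inj_on (\<lambda>x. (x mod int a, x mod int b)) (?A (a * b))"
    proof (rule inj_onI)
      fix x y assume xy: "x \<in> ?A (a * b)" "y \<in> ?A (a * b)" and "(x mod int a, x mod int b) = (y mod int a, y mod int b)"
      then have "[x = y] (mod int a)" "[x = y] (mod int b)"
        by (auto simp: unique_euclidean_semiring_class.cong_def)
      then have "[x = y] (mod int a * int b)" using cop by (simp add: coprime_cong_mult)
      then show "x = y" using xy by (simp add: unique_euclidean_semiring_class.cong_def)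
    qed
    show "(\<lambda>x. (x mod int a, x mod int b)) ` ?A (a * b) = ?A a \<times> ?A b"
    proof (intro equalityI subsetI)
      fix w assume "w \<in> (\<lambda>x. (x mod int a, x mod int b)) ` ?A (a * b)"
      then obtain x where x: "w = (x mod int a, x mod int b)" "int a * int b dvd root_poly q x" by auto
      have "int a dvd root_poly q (x mod int a)" "int b dvd root_poly q (x mod int b)"
        using x(2) root_poly_cong[of "x mod int a" x "int a" q] root_poly_cong[of "x mod int b" x "int b" q]
        by (auto simp: unique_euclidean_semiring_class.cong_def dest: dvd_mult_left dvd_mult_right)
      then show "w \<in> ?A a \<times> ?A b" using x assms by auto
    next
      fix w assume "w \<in> ?A a \<times> ?A b"
      then obtain u v where w: "w = (u, v)" "u \<in> ?A a" "v \<in> ?A b" by auto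
      obtain x where x: "[x = u] (mod int a)" "[x = v] (mod int b)"
        using binary_chinese_remainder_int[OF cop] by blast
      define y where "y = x mod (int a * int b)"
      have y: "[y = u] (mod int a)" "[y = v] (mod int b)"
        using x unfolding y_def by (auto simp: unique_euclidean_semiring_class.cong_def mod_mod_cancel)
      have "int a dvd root_poly q y" "int b dvd root_poly q y" using root_poly_cong[OF y(1)] root_poly_cong[OF y(2)] w by auto
      then have "int a * int b dvd root_poly q y" using cop by (simp add: divides_mult)
      moreover have "0 \<le> y" "y < int a * int b" using assms by (auto simp: y_def)
      moreover have "y mod int a = u" "y mod int b = v"
        using y w by (auto simp: unique_euclidean_semiring_class.cong_def)
      ultimately show "w \<in> (\<lambda>x. (x mod int a, x mod int b)) ` ?A (a * b)"
        using w by (intro image_eqI[of _ _ y]) auto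
    qed
  qed
  from bij_betw_same_card[OF this] show ?thesis by (simp add: root_count_def card_cartesian_product)
qed

lemma residue_iff:
  fixes y c M :: int
  assumes "M > 0"
  shows "y \<in> {0..<M} \<and> M dvd y - c \<longleftrightarrow> y = c mod M"
proof
  assume "y \<in> {0..<M} \<and> M dvd y - c"
  then show "y = c mod M" by (metis atLeastLessThan_iff mod_eq_dvd_iff mod_pos_pos_trivial)
qed (use assms in \<open>auto simp: mod_eq_dvd_iff[symmetric]\<close>)

lemma coprime_4: "odd (l :: int) \<Longrightarrow> coprime l 4"
proof -
  assume "odd l"
  then have "coprime l 2" by (simp add: coprime_right_2_iff_odd)
  then have "coprime l (2 * 2)" by (simp only: coprime_mult_right_iff)
  then show ?thesis by simp
qed

text \<open>The roots are x0 and -x0 - 1. Indeed the values at y and x0 differ by (y - x0)(y + x0 +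
  1); the two factors differ by 2 x0 + 1, which l does not divide because its square is congruent to
  the discriminant 4q + 1. So the whole prime power divides one factor.\<close>

lemma root_count_prime_power_two:
  assumes l: "prime l" and e: "e \<ge> 1" and root: "int (l ^ e) dvd root_poly q x0"
    and disc: "\<not> int l dvd 4 * q + 1"
  shows "root_count q (l ^ e) = 2"
proof -
  let ?m = "int (l ^ e)"
  have m: "?m > 1" using l e by (metis of_nat_1 of_nat_less_iff one_less_power prime_gt_1_nat zero_less_one less_le_trans zero_less_iff_neq_zero not_one_le_zero)
  have lm: "int l dvd ?m" using e by (simp add: dvd_power)
  have disc_eq: "(2 * x + 1)\<^sup>2 = 4 * root_poly q x + (4 * q + 1)" for x
    by (simp add: root_poly_def power2_eq_square algebra_simps)
  have unit: "\<not> int l dvd 2 * x0 + 1"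
  proof
    assume "int l dvd 2 * x0 + 1"
    then have "int l dvd (2 * x0 + 1)\<^sup>2" by (simp add: power2_eq_square)
    moreover have "int l dvd 4 * root_poly q x0" using root lm by (meson dvd_mult dvd_trans)
    ultimately have "int l dvd 4 * q + 1" unfolding disc_eq by (simp add: dvd_add_right_iff)
    then show False using disc by simp
  qed
  have iff: "?m dvd root_poly q y \<longleftrightarrow> ?m dvd y - x0 \<or> ?m dvd y + x0 + 1" for y
  proof
    have eq: "root_poly q y = root_poly q x0 + (y - x0) * (y + x0 + 1)" by (simp add: root_poly_def power2_eq_square algebra_simps)
    show "?m dvd root_poly q y" if "?m dvd y - x0 \<or> ?m dvd y + x0 + 1"
      unfolding eq using root that by (metis dvd_add dvd_mult dvd_mult2)
    assume "?m dvd root_poly q y"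
    then have d: "?m dvd (y - x0) * (y + x0 + 1)" unfolding eq using root by (simp add: dvd_add_right_iff)
    have pl: "prime (int l)" using l by simp
    have "\<not> int l dvd y - x0 \<or> \<not> int l dvd y + x0 + 1"
    proof (rule ccontr)
      assume "\<not> ?thesis"
      then have "int l dvd (y + x0 + 1) - (y - x0)" by (meson dvd_diff)
      then show False using unit by simp
    qed
    then have "coprime ?m (y - x0) \<or> coprime ?m (y + x0 + 1)"
      using pl by (auto intro: prime_imp_coprime)
    then show "?m dvd y - x0 \<or> ?m dvd y + x0 + 1"
      using d by (auto simp: coprime_dvd_mult_right_iff coprime_dvd_mult_left_iff)
  qed
  have "{y \<in> {0..<?m}. ?m dvd root_poly q y} = {x0 mod ?m, (- x0 - 1) mod ?m}"
  proof -
    have "?m > 0" using m by linarith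
    note res = residue_iff[OF this]
    have "?m dvd y + x0 + 1 \<longleftrightarrow> ?m dvd y - (- x0 - 1)" for y by (simp add: algebra_simps)
    then have "{y \<in> {0..<?m}. ?m dvd root_poly q y} = {y. (y \<in> {0..<?m} \<and> ?m dvd y - x0) \<or> (y \<in> {0..<?m} \<and> ?m dvd y - (- x0 - 1))}"
      unfolding iff by blast
    also have "\<dots> = {x0 mod ?m, (- x0 - 1) mod ?m}"
      unfolding res by blast
    finally show ?thesis .
  qed
  moreover have "x0 mod ?m \<noteq> (- x0 - 1) mod ?m"
  proof
    assume "x0 mod ?m = (- x0 - 1) mod ?m"
    then have "?m dvd x0 - (- x0 - 1)" by (simp only: mod_eq_dvd_iff)
    then have "int l dvd 2 * x0 + 1" using lm by (auto intro: dvd_trans simp: algebra_simps)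
    then show False using unit by simp
  qed
  ultimately show ?thesis by (simp add: root_count_def)
qed

text \<open>The derivative 2x + 1 is invertible modulo l, as its square is congruent to 4q + 1
  there; this also covers l = 2. The correction \<open>t\<close> solves the linearised
  congruence.\<close>

lemma hensel:
  assumes l: "prime l" and root: "int l dvd root_poly q x0" and disc: "\<not> int l dvd 4 * q + 1"
  shows "\<exists>x. int (l ^ Suc e) dvd root_poly q x"
proof (induction e)
  case 0
  then show ?case using root by auto
next
  case (Suc e)
  then obtain x where x: "int (l ^ Suc e) dvd root_poly q x" by blast
  then obtain k where k: "root_poly q x = int l ^ Suc e * k" by (auto simp del: power_Suc)
  have "int l dvd root_poly q x" using x by (auto intro: dvd_trans[of _ "int (l ^ Suc e)"])
  have "\<not> int l dvd 2 * x + 1"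
  proof
    assume "int l dvd 2 * x + 1"
    then have "int l dvd (2 * x + 1)\<^sup>2 - 4 * root_poly q x"
      using \<open>int l dvd root_poly q x\<close> by (simp add: power2_eq_square)
    moreover have "(2 * x + 1)\<^sup>2 - 4 * root_poly q x = 4 * q + 1"
      by (simp add: root_poly_def power2_eq_square algebra_simps)
    ultimately show False using disc by simp
  qed
  then have "coprime (2 * x + 1) (int l)"
    using l by (metis coprime_commute prime_imp_coprime prime_nat_int_transfer)
  then obtain t where "[(2 * x + 1) * t = - k] (mod int l)"
    using cong_solve_coprime_int by (metis cong_scalar_right mult.assoc mult_1)
  then have t: "int l dvd k + (2 * x + 1) * t" by (simp add: cong_iff_dvd_diff algebra_simps)
  have "root_poly q (x + t * int l ^ Suc e) = int l ^ Suc e * (k + (2 * x + 1) * t) + int l ^ Suc e * int l ^ Suc e * t\<^sup>2"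
  proof -
    define L where "L = int l ^ Suc e"
    have "root_poly q (x + t * L) = root_poly q x + (2 * x + 1) * (t * L) + (t * L)\<^sup>2"
      by (simp add: root_poly_def power2_eq_square algebra_simps)
    then show ?thesis unfolding k L_def[symmetric] by (simp add: power2_eq_square algebra_simps)
  qed
  moreover have "int l ^ Suc (Suc e) dvd int l ^ Suc e * (k + (2 * x + 1) * t)"
    using t by (metis mult_dvd_mono dvd_refl power_Suc2)
  moreover have "int l ^ Suc (Suc e) dvd int l ^ Suc e * int l ^ Suc e * t\<^sup>2"
    by (metis dvd_mult2 le_imp_power_dvd power_add add_Suc_right add_Suc le_add2 Suc_le_mono)
  ultimately have "int l ^ Suc (Suc e) dvd root_poly q (x + t * int l ^ Suc e)" by (metis dvd_add)
  then show ?case by (metis of_nat_power)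
qed

section \<open>From roots modulo prime powers to the number of ideals of a given norm\<close>

lemma sum_divisors_prime_power_mult:
  fixes g :: "nat \<Rightarrow> 'a::comm_monoid_add"
  assumes l: "prime l" and m: "\<not> l dvd m" "m > 0"
  shows "(\<Sum>d | d dvd l ^ e * m. g d) = (\<Sum>i\<le>e. \<Sum>d | d dvd m. g (l ^ i * d))"
proof -
  have "bij_betw (\<lambda>(i, d). l ^ i * d) ({..e} \<times> {d. d dvd m}) {d. d dvd l ^ e * m}"
  proof (rule bij_betw_imageI)
    have ndvd: "\<not> l dvd d" if "d dvd m" for d using that m by (meson dvd_trans)
    show "inj_on (\<lambda>(i, d). l ^ i * d) ({..e} \<times> {d. d dvd m})"
    proof (rule inj_onI, clarify)
      fix i d j d' assume *: "d dvd m" "d' dvd m" "l ^ i * d = l ^ j * d'"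
      have "multiplicity l (l ^ i * d) = i" if "d dvd m" for i d
        using that l m ndvd by (subst prime_elem_multiplicity_mult_distrib) (auto simp: not_dvd_imp_multiplicity_0 multiplicity_same_power)
      then have "i = j" using * by metis
      then show "i = j \<and> d = d'" using * l by auto
    qed
    show "(\<lambda>(i, d). l ^ i * d) ` ({..e} \<times> {d. d dvd m}) = {d. d dvd l ^ e * m}"
    proof (intro equalityI subsetI)
      fix d assume "d \<in> {d. d dvd l ^ e * m}"
      then have "d dvd l ^ e * m" by simp
      then obtain a b where ab: "d = a * b" "a dvd l ^ e" "b dvd m" by (metis division_decomp)
      then obtain i where "i \<le> e" "a = l ^ i" using l divides_primepow_nat by blast
      then show "d \<in> (\<lambda>(i, d). l ^ i * d) ` ({..e} \<times> {d. d dvd m})" using ab by force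
    qed (auto intro: mult_dvd_mono le_imp_power_dvd)
  qed
  from sum.reindex_bij_betw[OF this, of g] show ?thesis
    by (simp add: sum.cartesian_product case_prod_beta)
qed

text \<open>The possible integer contents k of an ideal of norm m, whose primitive part then has
  norm m/k^2.\<close>

definition sqdiv :: "nat \<Rightarrow> nat set" where "sqdiv m = {k. k\<^sup>2 dvd m}"

lemma sqdiv_prime_power_mult:
  fixes g :: "nat \<Rightarrow> 'a::comm_monoid_add"
  assumes l: "prime l" and m: "\<not> l dvd m" "m > 0"
  shows "(\<Sum>k\<in>sqdiv (l ^ e * m). g k) = (\<Sum>j | 2 * j \<le> e. \<Sum>k\<in>sqdiv m. g (l ^ j * k))"
proof -
  have "bij_betw (\<lambda>(i, d). l ^ i * d) ({j. 2 * j \<le> e} \<times> sqdiv m) (sqdiv (l ^ e * m))"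
  proof (rule bij_betw_imageI)
    have ndvd: "\<not> l dvd d" if "d \<in> sqdiv m" for d
      using that m unfolding sqdiv_def by (metis dvd_power dvd_trans mem_Collect_eq zero_less_numeral)
    show "inj_on (\<lambda>(i, d). l ^ i * d) ({j. 2 * j \<le> e} \<times> sqdiv m)"
    proof (rule inj_onI, clarify)
      fix i d j d' assume *: "d \<in> sqdiv m" "d' \<in> sqdiv m" "l ^ i * d = l ^ j * d'"
      have "multiplicity l (l ^ i * d) = i" if "d \<in> sqdiv m" for i d
      proof -
        have "d \<noteq> 0" using that m by (auto simp: sqdiv_def)
        then show ?thesis using that l ndvd
          by (subst prime_elem_multiplicity_mult_distrib) (auto simp: not_dvd_imp_multiplicity_0 multiplicity_same_power)
      qed
      then have "i = j" using * by metis
      then show "i = j \<and> d = d'" using * l by auto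
    qed
    show "(\<lambda>(i, d). l ^ i * d) ` ({j. 2 * j \<le> e} \<times> sqdiv m) = sqdiv (l ^ e * m)"
    proof (intro equalityI subsetI)
      fix k assume "k \<in> (\<lambda>(i, d). l ^ i * d) ` ({j. 2 * j \<le> e} \<times> sqdiv m)"
      then obtain j d where jd: "k = l ^ j * d" "2 * j \<le> e" "d\<^sup>2 dvd m" by (auto simp: sqdiv_def)
      have "k\<^sup>2 = l ^ (2 * j) * d\<^sup>2" unfolding jd by (simp add: power_mult_distrib power_mult[symmetric] mult.commute)
      then show "k \<in> sqdiv (l ^ e * m)" unfolding sqdiv_def using jd by (auto intro: mult_dvd_mono le_imp_power_dvd)
    next
      fix k assume "k \<in> sqdiv (l ^ e * m)"
      then have k: "k\<^sup>2 dvd l ^ e * m" by (simp add: sqdiv_def)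
      have k0: "k \<noteq> 0"
      proof
        assume "k = 0"
        then have "l ^ e * m = 0" using k by simp
        then show False using m l by auto
      qed
      obtain d where d: "k = l ^ multiplicity l k * d" "\<not> l dvd d"
        using multiplicity_decompose'[of k l] k0 l by (metis not_prime_unit)
      define j where "j = multiplicity l k"
      have k2: "k\<^sup>2 = l ^ (2 * j) * d\<^sup>2"
        using d(1) unfolding j_def[symmetric] by (simp add: power_mult_distrib power_mult[symmetric] mult.commute)
      have "coprime l m" "coprime l d"
        using l m d(2) by (auto intro: prime_imp_coprime)
      then have "coprime (l ^ (2 * j)) m" "coprime (d\<^sup>2) (l ^ e)"
        by (simp_all add: coprime_commute[of l d])
      moreover have "l ^ (2 * j) dvd l ^ e * m" "d\<^sup>2 dvd l ^ e * m"
        using k unfolding k2 by (auto dest: dvd_mult_left dvd_mult_right)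
      ultimately have "l ^ (2 * j) dvd l ^ e" "d\<^sup>2 dvd m"
        by (simp_all add: coprime_dvd_mult_left_iff coprime_dvd_mult_right_iff)
      then have "2 * j \<le> e" "d \<in> sqdiv m"
        using l by (auto simp: sqdiv_def dest: power_dvd_imp_le prime_gt_1_nat)
      then show "k \<in> (\<lambda>(i, d). l ^ i * d) ` ({j. 2 * j \<le> e} \<times> sqdiv m)"
        using d(1) unfolding j_def[symmetric] by force
    qed
  qed
  from sum.reindex_bij_betw[OF this, of g] show ?thesis
    by (simp add: sum.cartesian_product case_prod_beta)
qed

locale prime_1_mod_4 = odd_prime +
  assumes p_mod_4: "p mod 4 = 1"
begin

definition q :: int where "q = int ((p - 1) div 4)"

lemma p_eq_q: "int p = 4 * q + 1"
proof -
  have "p = 4 * ((p - 1) div 4) + 1" using p_mod_4 by presburger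
  then show ?thesis unfolding q_def by linarith
qed

text \<open>For odd l, quadratic reciprocity exchanges l and p without a sign, and (2x+1)^2 - p is 4
  times the polynomial. For l = 2 the value has the parity of q because x^2 + x is even, and
  \<open>chi_2\<close> gives the same parity condition.\<close>

lemma chi_prime_root:
  assumes l: "prime l" and lp: "l \<noteq> p"
  shows "chi (int l) = 1 \<longleftrightarrow> (\<exists>x. int l dvd root_poly q x)"
proof (cases "l = 2")
  case True
  have n: "int (n div 2) = q" unfolding q_def n_def by (simp add: div_mult2_eq[symmetric])
  have "even (root_poly q x) \<longleftrightarrow> even q" for x by (auto simp: root_poly_def)
  moreover have "chi 2 = 1 \<longleftrightarrow> even (n div 2)"
    unfolding chi_2[OF p_mod_4] by (simp add: minus_one_power_iff)
  moreover have "even q \<longleftrightarrow> even (n div 2)" unfolding n[symmetric] by (rule even_of_nat)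
  ultimately show ?thesis unfolding True of_nat_numeral by blast
next
  case False
  then have l2: "l > 2" using l prime_ge_2_nat by (metis le_neq_implies_less)
  then have lodd: "odd l" using l prime_odd_nat by blast
  have ndvd: "\<not> int l dvd int p" using primes_dvd_imp_eq[OF l prime_p] lp by auto
  have "even ((p - 1) div 2)" using p_mod_4 by presburger
  then have "Legendre (int p) (int l) * Legendre (int l) (int p) = 1"
    using Quadratic_Reciprocity[of p l] prime_p p_gt_3 l l2 lp by (simp add: power_mult)
  then have "chi (int l) = 1 \<longleftrightarrow> Legendre (int p) (int l) = 1"
    by (auto simp: zmult_eq_1_iff)
  also have "\<dots> \<longleftrightarrow> QuadRes (int l) (int p)"
    using ndvd by (auto simp: Legendre_def cong_0_iff)
  also have "\<dots> \<longleftrightarrow> (\<exists>x. int l dvd root_poly q x)"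
  proof
    have eq: "(2 * x + 1)\<^sup>2 - int p = 4 * root_poly q x" for x
      unfolding p_eq_q by (simp add: root_poly_def power2_eq_square algebra_simps)
    show "\<exists>x. int l dvd root_poly q x" if Q: "QuadRes (int l) (int p)"
    proof -
      obtain y where y: "[y\<^sup>2 = int p] (mod int l)" using Q by (auto simp: QuadRes_def)
      \<comment> \<open>The odd modulus l is added if necessary, so that the square root of p has
        the form 2x + 1.\<close>
      define y' where "y' = (if odd y then y else y + int l)"
      have "odd y'" using lodd by (simp add: y'_def)
      then obtain x where x: "y' = 2 * x + 1" by (elim oddE)
      have "[y' = y] (mod int l)" by (simp add: y'_def unique_euclidean_semiring_class.cong_def)
      then have "[y'\<^sup>2 = int p] (mod int l)" using y by (meson cong_pow cong_trans)
      then have "int l dvd 4 * root_poly q x" unfolding eq[symmetric] x by (simp add: cong_iff_dvd_diff)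
      moreover have "coprime (int l) 4" using lodd by (intro coprime_4) simp
      ultimately show ?thesis by (auto simp: coprime_dvd_mult_right_iff)
    qed
    assume "\<exists>x. int l dvd root_poly q x"
    then obtain x where "int l dvd root_poly q x" by blast
    then have "int l dvd (2 * x + 1)\<^sup>2 - int p" unfolding eq by simp
    then have "[(2 * x + 1)\<^sup>2 = int p] (mod int l)" by (simp only: cong_iff_dvd_diff)
    then show "QuadRes (int l) (int p)" unfolding QuadRes_def by (rule exI)
  qed
  finally show ?thesis .
qed

text \<open>One formula for three cases: 2 roots if l splits, none if it is inert, and for l = p one
  root modulo p but none modulo higher powers, where 0^0 = 1 yields the single root.\<close>

lemma root_count_prime_power:
  assumes l: "prime l"
  shows "int (root_count q (l ^ Suc e)) = chi (int l) ^ e + chi (int l) ^ Suc e"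
proof (cases "l = p")
  case True
  have eq: "(2 * x + 1)\<^sup>2 = 4 * root_poly q x + int p" for x
    unfolding p_eq_q by (simp add: root_poly_def power2_eq_square algebra_simps)
  have dvd: "int p dvd 2 * x + 1" if "int p dvd root_poly q x" for x
  proof -
    have "int p dvd (2 * x + 1)\<^sup>2" unfolding eq using that by simp
    then show ?thesis using prime_int_p prime_dvd_power by blast
  qed
  have chi: "chi (int l) = 0" using True chi_eq_0_iff by simp
  show ?thesis
  proof (cases e)
    case 0
    have iff: "int p dvd root_poly q x \<longleftrightarrow> x = int n" if "x \<in> {0..<int p}" for x
    proof
      assume "int p dvd root_poly q x"
      then obtain k where k: "2 * x + 1 = int p * k" using dvd by blast
      have "0 < int p * k" "int p * k < int p * 2" using that k[symmetric] by auto
      then have "0 < k" "k < 2" using p_gt_3 by (auto simp: zero_less_mult_iff)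
      then have "k = 1" by simp
      with k have "2 * x + 1 = int p" by simp
      then show "x = int n" using p_eq by linarith
    next
      assume x: "x = int n"
      have "4 * root_poly q x = (2 * x + 1)\<^sup>2 - int p" using eq[of x] by simp
      also have "2 * x + 1 = int p" using p_eq x by linarith
      finally have "int p dvd 4 * root_poly q x" by (simp add: power2_eq_square)
      moreover have "coprime (int p) 4"
        by (rule coprime_4) (simp add: p_eq_q)
      ultimately show "int p dvd root_poly q x" by (auto simp: coprime_dvd_mult_right_iff)
    qed
    have "{x \<in> {0..<int p}. int p dvd root_poly q x} = {int n}"
      using iff p_eq by auto
    then show ?thesis using 0 True chi by (simp add: root_count_def)
  next
    case (Suc e')
    \<comment> \<open>A root modulo p^2 would make 2x + 1 divisible by p, and then p = (2x+1)^2 - 4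
      \<open>root_poly q x\<close> divisible by p^2.\<close>
    have "\<not> int (p ^ Suc e) dvd root_poly q x" for x
    proof
      assume "int (p ^ Suc e) dvd root_poly q x"
      moreover have "int p * int p dvd int (p ^ Suc e)" using Suc by simp
      ultimately have d: "int p * int p dvd root_poly q x" by (meson dvd_trans)
      then have "int p dvd 2 * x + 1" using dvd by (meson dvd_mult_left)
      then have "int p * int p dvd (2 * x + 1)\<^sup>2" unfolding power2_eq_square by (intro mult_dvd_mono)
      then have "int p * int p dvd int p" unfolding eq using d by (simp add: dvd_add_right_iff)
      then show False using p_gt_3 by (auto dest!: zdvd_imp_le)
    qed
    then show ?thesis using Suc True chi by (simp add: root_count_def del: power_Suc of_nat_power)
  qed
next
  case False
  have disc: "\<not> int l dvd 4 * q + 1"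
    using False primes_dvd_imp_eq[OF l prime_p] unfolding p_eq_q[symmetric] by auto
  show ?thesis
  proof (cases "chi (int l) = 1")
    case True
    then obtain x0 where "int l dvd root_poly q x0" using chi_prime_root[OF l False] by blast
    then obtain x where "int (l ^ Suc e) dvd root_poly q x" using hensel[OF l _ disc] by blast
    then have "root_count q (l ^ Suc e) = 2" by (intro root_count_prime_power_two[OF l _ _ disc]) simp_all
    then show ?thesis using True by (simp del: power_Suc)
  next
    case ne: False
    then have m1: "chi (int l) = - 1"
      using chi_values[of "int l"] chi_eq_0_iff[of "int l"] False l prime_p
      by (auto simp: primes_dvd_imp_eq dest: primes_dvd_imp_eq)
    have "\<not> int (l ^ Suc e) dvd root_poly q x" for x
    proof
      assume "int (l ^ Suc e) dvd root_poly q x"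
      then have "int l dvd root_poly q x" by (auto dest: dvd_mult_left)
      then show False using chi_prime_root[OF l False] ne by blast
    qed
    then show ?thesis using m1 by (simp add: root_count_def del: of_nat_power)
  qed
qed

text \<open>The term j contributes the two powers of chi(l) with exponents e - 2j - 1 and e - 2j, so
  the terms tile the geometric sum; the induction therefore goes in steps of two.\<close>

lemma sum_root_count_prime_power:
  assumes l: "prime l"
  shows "(\<Sum>j | 2 * j \<le> e. int (root_count q (l ^ (e - 2 * j)))) = (\<Sum>i\<le>e. chi (int l) ^ i)"
proof (induction e rule: less_induct)
  case (less e)
  consider "e = 0" | "e = 1" | e' where "e = Suc (Suc e')" by (metis One_nat_def not0_implies_Suc)
  then show ?case
  proof cases
    case 1
    then have "{j. 2 * j \<le> e} = {0}" by auto
    then show ?thesis using 1 by simp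
  next
    case 2
    then have "{j. 2 * j \<le> e} = {0}" by auto
    then show ?thesis using 2 root_count_prime_power[OF l, of 0] by simp
  next
    case 3
    have set: "{j. 2 * j \<le> e} = insert 0 (Suc ` {j. 2 * j \<le> e'})"
    proof -
      have "j \<in> insert 0 (Suc ` {j. 2 * j \<le> e'})" if "2 * j \<le> e" for j
        using that 3 by (cases j) auto
      then show ?thesis using 3 by auto
    qed
    have fin: "finite {j. 2 * j \<le> e'}" by (rule finite_subset[of _ "{..e'}"]) auto
    have "(\<Sum>j | 2 * j \<le> e. int (root_count q (l ^ (e - 2 * j)))) =
        int (root_count q (l ^ e)) + (\<Sum>j | 2 * j \<le> e'. int (root_count q (l ^ (e' - 2 * j))))"
      unfolding set by (subst sum.insert) (auto simp: fin sum.reindex 3)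
    also have "\<dots> = chi (int l) ^ Suc e' + chi (int l) ^ Suc (Suc e') + (\<Sum>i\<le>e'. chi (int l) ^ i)"
      using root_count_prime_power[OF l, of "Suc e'"] less[of e'] 3 by simp
    finally show ?thesis using 3 by simp
  qed
qed

definition ideal_count :: "nat \<Rightarrow> nat" where
  "ideal_count m = (\<Sum>k\<in>sqdiv m. root_count q (m div k\<^sup>2))"

lemma chi_power: "chi (x ^ i) = chi x ^ i"
  by (induction i) (simp_all add: chi_mult)

text \<open>Both sides are multiplicative. The induction splits off the full power of one prime
  factor and uses \<open>sum_root_count_prime_power\<close> for that power.\<close>

lemma ideal_count_eq: "m > 0 \<Longrightarrow> int (ideal_count m) = r m"
proof (induction m rule: less_induct)
  case (less m)
  show ?case
  proof (cases "m = 1")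
    case True
    have "sqdiv 1 = {1}" by (auto simp: sqdiv_def)
    then show ?thesis using True by (simp add: ideal_count_def r_def)
  next
    case False
    then obtain l where l: "prime l" "l dvd m" using prime_factor_nat by blast
    define e where "e = multiplicity l m"
    obtain m' where m': "m = l ^ e * m'" "\<not> l dvd m'"
      using multiplicity_decompose'[of m l] less.prems l unfolding e_def by (metis not_prime_unit less_not_refl)
    have e: "e \<ge> 1" using l m' by (cases e) auto
    have m'0: "m' > 0" using m' less.prems by (cases m') auto
    have "m' < m"
    proof -
      have "1 < l ^ e" using l e by (intro one_less_power) (auto dest: prime_gt_1_nat)
      then show ?thesis unfolding m'(1) using m'0 by simp
    qed
    then have IH: "int (ideal_count m') = r m'" using less.IH m'0 by blast
    have "int (ideal_count m) = (\<Sum>j | 2 * j \<le> e. \<Sum>k\<in>sqdiv m'. int (root_count q (m div (l ^ j * k)\<^sup>2)))"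
      unfolding ideal_count_def m'(1) sqdiv_prime_power_mult[OF l(1) m'(2) m'0] by simp
    also have "\<dots> = (\<Sum>j | 2 * j \<le> e. \<Sum>k\<in>sqdiv m'. int (root_count q (l ^ (e - 2 * j))) * int (root_count q (m' div k\<^sup>2)))"
    proof (intro sum.cong refl)
      fix j k assume "j \<in> {j. 2 * j \<le> e}" and k: "k \<in> sqdiv m'"
      then have j: "2 * j \<le> e" by simp
      obtain c where c: "m' = k\<^sup>2 * c" using k by (auto simp: sqdiv_def)
      have k0: "k\<^sup>2 > 0" "c > 0" using c m'0 by (auto intro: Nat.gr0I)
      have "m = (l ^ j * k)\<^sup>2 * (l ^ (e - 2 * j) * c)"
      proof -
        have "l ^ e = l ^ (2 * j) * l ^ (e - 2 * j)" using j by (simp add: power_add[symmetric])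
        then show ?thesis unfolding m'(1) c
          by (simp add: power_mult_distrib power_mult[symmetric] mult.commute mult.left_commute)
      qed
      then have "m div (l ^ j * k)\<^sup>2 = l ^ (e - 2 * j) * c" using k0 l by (simp add: prime_gt_0_nat)
      moreover have "m' div k\<^sup>2 = c" using c k0 by simp
      moreover have "coprime (l ^ (e - 2 * j)) c"
      proof -
        have "\<not> l dvd c" using m'(2) c by auto
        then show ?thesis using l by (simp add: prime_imp_coprime)
      qed
      ultimately show "int (root_count q (m div (l ^ j * k)\<^sup>2)) = int (root_count q (l ^ (e - 2 * j))) * int (root_count q (m' div k\<^sup>2))"
        using k0 l by (simp add: root_count_mult prime_gt_0_nat)
    qed
    also have "\<dots> = (\<Sum>i\<le>e. chi (int l) ^ i) * int (ideal_count m')"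
      unfolding sum_root_count_prime_power[OF l(1), symmetric] ideal_count_def of_nat_sum sum_product ..
    also have "\<dots> = (\<Sum>i\<le>e. \<Sum>d | d dvd m'. chi (int (l ^ i * d)))"
      unfolding IH r_def sum_product by (simp add: chi_mult chi_power)
    also have "\<dots> = r m"
      unfolding r_def m'(1) by (rule sum_divisors_prime_power_mult[OF l(1) m'(2) m'0, symmetric])
    finally show ?thesis .
  qed
qed

end

section \<open>The ring of integers\<close>

text \<open>If M/gcd(M, N) were not a unit, all its powers would divide the fixed nonzero
  \<open>C\<close>. In effect: a rational whose powers have a common denominator is an
  integer.\<close>

lemma power_dvd_bounded:
  fixes M N C :: int
  assumes "C \<noteq> 0" "M \<noteq> 0" and dvd: "\<And>k. M ^ k dvd C * N ^ k"
  shows "M dvd N"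
proof -
  define g where "g = gcd M N"
  have g: "g \<noteq> 0" using assms by (simp add: g_def)
  obtain m n' where mn: "M = m * g" "N = n' * g" "coprime m n'"
    using gcd_coprime_exists[of M N] g unfolding g_def by auto
  have m_dvd: "m ^ k dvd C" for k
  proof -
    have "m ^ k * g ^ k dvd C * n' ^ k * g ^ k"
      using dvd[of k] unfolding mn by (simp add: power_mult_distrib mult.assoc)
    then have "m ^ k dvd C * n' ^ k" using g by simp
    moreover have "coprime (m ^ k) (n' ^ k)" using mn(3) by simp
    ultimately show ?thesis by (simp add: coprime_dvd_mult_left_iff)
  qed
  have "\<bar>m\<bar> = 1"
  proof (rule ccontr)
    assume "\<bar>m\<bar> \<noteq> 1"
    moreover have "m \<noteq> 0" using mn assms by auto
    ultimately have m2: "2 \<le> \<bar>m\<bar>" by linarith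
    define k where "k = nat \<bar>C\<bar>"
    have "\<bar>m ^ k\<bar> \<le> \<bar>C\<bar>" using dvd_imp_le_int[OF assms(1) m_dvd] .
    moreover have "int k < 2 ^ k" by (metis of_nat_less_two_power)
    moreover have "(2 :: int) ^ k \<le> \<bar>m\<bar> ^ k" using m2 by (intro power_mono) auto
    ultimately show False by (simp add: power_abs k_def)
  qed
  then have "m dvd 1" by simp
  then have "M dvd 1 * g" unfolding mn by (intro mult_dvd_mono) auto
  moreover have "g dvd N" by (simp add: g_def)
  ultimately show ?thesis by (simp only: mult_1) (rule dvd_trans)
qed

text \<open>After removing gcd(d, v), the square of what remains of \<open>d\<close> divides the
  prime \<open>P\<close>, which is squarefree.\<close>

lemma square_dvd_prime_mult:
  fixes d v P :: int
  assumes P: "prime P" and d: "d\<^sup>2 dvd P * v\<^sup>2"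
  shows "d dvd v"
proof (cases "d = 0")
  case True
  then show ?thesis using d P by auto
next
  case False
  define g where "g = gcd d v"
  have g: "g \<noteq> 0" using False by (simp add: g_def)
  obtain d' v' where dv: "d = d' * g" "v = v' * g" "coprime d' v'"
    using gcd_coprime_exists[of d v] g unfolding g_def by auto
  have "d'\<^sup>2 * g\<^sup>2 dvd P * v'\<^sup>2 * g\<^sup>2" using d unfolding dv by (simp add: power_mult_distrib mult.assoc)
  then have "d'\<^sup>2 dvd P * v'\<^sup>2" using g by simp
  moreover have "coprime (d'\<^sup>2) (v'\<^sup>2)" using dv(3) by simp
  ultimately have "d'\<^sup>2 dvd P" by (simp add: coprime_dvd_mult_left_iff)
  then obtain c where c: "P = d' * (d' * c)" unfolding power2_eq_square by (metis dvdE mult.assoc)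
  have "irreducible P" using P by (rule prime_elem_imp_irreducible[OF prime_imp_prime_elem])
  then have "is_unit d' \<or> is_unit (d' * c)" using c by (rule irreducibleD)
  then have "is_unit d'" unfolding is_unit_mult_iff by blast
  then show ?thesis unfolding dv by (rule mult_dvd_mono[OF unit_imp_dvd dvd_refl])
qed

lemma algebraic_int_quadratic:
  fixes x :: real
  assumes "x * x = of_int s * x + of_int t"
  shows "algebraic_int x"
proof (rule algebraic_int.intros[of "[:- of_int t, - of_int s, 1:]"])
  show "\<forall>i. Polynomial.coeff [:- of_int t, - of_int s, 1 :: real:] i \<in> \<int>"
    by (auto simp: coeff_pCons split: nat.splits)
qed (use assms in \<open>simp_all add: algebra_simps\<close>)

context prime_1_mod_4
begin

abbreviation sq :: real where "sq \<equiv> sqrt (real p)"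
definition \<omega> :: real where "\<omega> = (1 + sq) / 2"
definition el :: "int \<Rightarrow> int \<Rightarrow> real" where "el u v = of_int u + of_int v * \<omega>"
definition L :: "real set" where "L = {el u v | u v. True}"
text \<open>Conjugation, with a junk value outside \<open>L\<close>.\<close>

definition cj :: "real \<Rightarrow> real" where "cj x = (THE y. \<exists>u v. x = el u v \<and> y = of_int u + of_int v * (1 - \<omega>))"
definition Nm :: "real \<Rightarrow> real" where "Nm x = x * cj x"

lemma sq: "sq * sq = real p" "sq > 0"
  using p_gt_3 by auto

lemma sq_irrational: "sq \<notin> \<rat>"
proof
  assume "sq \<in> \<rat>"
  moreover have "algebraic_int sq" by (intro algebraic_int_sqrt int_imp_algebraic_int) auto
  ultimately have "sq \<in> \<int>" by (intro rational_algebraic_int_is_int)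
  then obtain m where "sq = of_int m" by (auto elim: Ints_cases)
  then have "of_int (m * m) = (of_int (int p) :: real)" using sq(1) by simp
  then have m: "int p = m * m" by (simp only: of_int_eq_iff)
  have "irreducible (int p)" using prime_int_p by (intro prime_elem_imp_irreducible prime_imp_prime_elem)
  then have "is_unit m" using irreducibleD[OF _ m] by blast
  then have "is_unit (int p)" unfolding m is_unit_mult_iff by blast
  then show False using prime_int_p not_prime_unit by blast
qed

lemma rat_sq_unique:
  assumes "a \<in> \<rat>" "b \<in> \<rat>" "c \<in> \<rat>" "d \<in> \<rat>" "a + b * sq = c + d * sq"
  shows "a = c \<and> b = d"
proof (rule ccontr)
  assume "\<not> ?thesis"
  then have bd: "b - d \<noteq> 0" using assms(5) by auto
  have "(b - d) * sq = c - a" using assms(5) by (simp add: algebra_simps)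
  then have "sq = (c - a) / (b - d)" using bd by (simp add: field_simps)
  then show False using sq_irrational assms by auto
qed

lemma \<omega>_square: "\<omega> * \<omega> = \<omega> + of_int q"
proof -
  have "real p = 4 * of_int q + 1" using p_eq_q by (metis of_int_1 of_int_add of_int_mult of_int_numeral of_int_of_nat_eq)
  then show ?thesis unfolding \<omega>_def using sq(1) by (simp add: field_simps)
qed

lemma el_unique: "el u v = el u' v' \<longleftrightarrow> u = u' \<and> v = v'"
proof
  assume "el u v = el u' v'"
  then have "(of_int u + of_int v / 2) + (of_int v / 2) * sq = (of_int u' + of_int v' / 2) + (of_int v' / 2) * sq"
    unfolding el_def \<omega>_def by (simp add: field_simps)
  then have "(of_int u :: real) + of_int v / 2 = of_int u' + of_int v' / 2 \<and> (of_int v :: real) / 2 = of_int v' / 2"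
    by (intro rat_sq_unique) auto
  then show "u = u' \<and> v = v'" by simp
qed simp

lemma cj_el: "cj (el u v) = of_int u + of_int v * (1 - \<omega>)"
  unfolding cj_def by (rule the_equality) (auto simp: el_unique)

lemma el_add: "el u v + el u' v' = el (u + u') (v + v')"
  by (simp add: el_def algebra_simps)

lemma el_mult: "el u v * el u' v' = el (u * u' + q * v * v') (u * v' + u' * v + v * v')"
proof -
  have "el u v * el u' v' = of_int u * of_int u' + of_int v * of_int v' * (\<omega> * \<omega>) + (of_int u * of_int v' + of_int u' * of_int v) * \<omega>"
    by (simp add: el_def algebra_simps)
  then show ?thesis unfolding \<omega>_square by (simp add: el_def algebra_simps)
qed

lemma elI [intro]: "el u v \<in> L" by (auto simp: L_def)

lemma LE: assumes "x \<in> L" obtains u v where "x = el u v"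
  using assms by (auto simp: L_def)

lemma L_add: "x \<in> L \<Longrightarrow> y \<in> L \<Longrightarrow> x + y \<in> L"
  by (elim LE) (auto simp: el_add)

lemma L_mult: "x \<in> L \<Longrightarrow> y \<in> L \<Longrightarrow> x * y \<in> L"
  by (elim LE) (auto simp: el_mult)

lemma el_of_int: "of_int u = el u 0" and el_\<omega>: "\<omega> = el 0 1"
  by (simp_all add: el_def)

lemma L_of_int [simp]: "of_int u \<in> L" by (simp add: el_of_int elI)

lemma L_0 [simp]: "0 \<in> L" and L_1 [simp]: "1 \<in> L" and L_of_nat [simp]: "of_nat m \<in> L" and L_\<omega> [simp]: "\<omega> \<in> L"
  using L_of_int[of 0] L_of_int[of 1] L_of_int[of "int m"] by (simp_all add: el_\<omega> elI)

lemma L_uminus: "x \<in> L \<Longrightarrow> - x \<in> L"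
  using L_mult[of "of_int (- 1)" x] L_of_int[of "- 1"] by simp

lemma L_power: "x \<in> L \<Longrightarrow> x ^ k \<in> L"
  by (induction k) (auto intro: L_mult)

lemma L_sum: "(\<And>i. i \<in> A \<Longrightarrow> f i \<in> L) \<Longrightarrow> sum f A \<in> L"
  by (induction A rule: infinite_finite_induct) (auto intro: L_add)

lemma cj_in_L: "x \<in> L \<Longrightarrow> cj x \<in> L"
proof (elim LE)
  fix u v assume "x = el u v"
  moreover have "of_int u + of_int v * (1 - \<omega>) = el (u + v) (- v)" by (simp add: el_def algebra_simps)
  ultimately show ?thesis by (simp add: cj_el elI)
qed

lemma cj_add: "x \<in> L \<Longrightarrow> y \<in> L \<Longrightarrow> cj (x + y) = cj x + cj y"
  by (elim LE) (simp add: el_add cj_el algebra_simps)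

lemma cj_mult: "x \<in> L \<Longrightarrow> y \<in> L \<Longrightarrow> cj (x * y) = cj x * cj y"
proof (elim LE)
  fix u v u' v' assume xy: "x = el u v" "y = el u' v'"
  have "(1 - \<omega>) * (1 - \<omega>) = 1 - \<omega> + of_int q" using \<omega>_square by (simp add: algebra_simps)
  moreover have "(of_int u + of_int v * w) * (of_int u' + of_int v' * w) =
      of_int u * of_int u' + of_int v * of_int v' * (w * w) + (of_int u * of_int v' + of_int u' * of_int v) * w" for w :: real
    by (simp add: algebra_simps)
  ultimately show ?thesis unfolding xy el_mult cj_el by (simp add: algebra_simps)
qed

lemma cj_of_int [simp]: "cj (of_int u) = of_int u"
  unfolding el_of_int cj_el by (simp add: el_def)

lemma cj_1 [simp]: "cj 1 = 1" and cj_0 [simp]: "cj 0 = 0"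
  using cj_of_int[of 1] cj_of_int[of 0] by simp_all

lemma cj_uminus: "x \<in> L \<Longrightarrow> cj (- x) = - cj x"
  using cj_mult[of "of_int (- 1)" x] cj_of_int[of "- 1"] L_of_int[of "- 1"] by simp

lemma cj_\<omega>: "cj \<omega> = 1 - \<omega>"
  unfolding el_\<omega> cj_el by (simp add: el_def)

lemma cj_power: "x \<in> L \<Longrightarrow> cj (x ^ k) = cj x ^ k"
  by (induction k) (auto simp: cj_mult L_power)

lemma cj_cj: "x \<in> L \<Longrightarrow> cj (cj x) = x"
proof (elim LE)
  fix u v assume x: "x = el u v"
  have "of_int u + of_int v * (1 - \<omega>) = el (u + v) (- v)" by (simp add: el_def algebra_simps)
  then show ?thesis unfolding x by (simp add: cj_el) (simp add: el_def algebra_simps)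
qed

lemma Nm_el: "Nm (el u v) = of_int (u * u + u * v - q * v * v)"
proof -
  have "(of_int u + of_int v * \<omega>) * (of_int u + of_int v * (1 - \<omega>)) =
     of_int u * of_int u + of_int u * of_int v + of_int v * of_int v * (\<omega> - \<omega> * \<omega>)"
    by (simp add: algebra_simps)
  then show ?thesis unfolding Nm_def cj_el unfolding el_def \<omega>_square by (simp add: algebra_simps)
qed

lemma Nm_int: "x \<in> L \<Longrightarrow> \<exists>m. Nm x = of_int m"
  by (elim LE) (metis Nm_el)

lemma Nm_mult: "x \<in> L \<Longrightarrow> y \<in> L \<Longrightarrow> Nm (x * y) = Nm x * Nm y"
  by (simp add: Nm_def cj_mult)

lemma Nm_power: "x \<in> L \<Longrightarrow> Nm (x ^ k) = Nm x ^ k"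
  by (simp add: Nm_def cj_power power_mult_distrib)

lemma cj_eq_0: "x \<in> L \<Longrightarrow> cj x = 0 \<longleftrightarrow> x = 0"
  using cj_cj cj_0 by metis

lemma Nm_eq_0: "x \<in> L \<Longrightarrow> Nm x = 0 \<longleftrightarrow> x = 0"
  by (simp add: Nm_def cj_eq_0)

lemma Nm_of_int: "Nm (of_int m) = of_int (m * m)"
  by (simp add: Nm_def)

section \<open>The algebraic integers of the field\<close>

lemma quad_field_alt: "x \<in> quad_field p \<longleftrightarrow> (\<exists>d::int. d > 0 \<and> of_int d * x \<in> L)"
proof
  assume "x \<in> quad_field p"
  then obtain a b where ab: "a \<in> \<rat>" "b \<in> \<rat>" "x = a + b * sq" by (auto simp: quad_field_def)
  obtain a1 a2 where a: "a = of_int a1 / of_int a2" "a2 > 0" using ab(1) by (auto elim: Rats_cases')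
  obtain b1 b2 where b: "b = of_int b1 / of_int b2" "b2 > 0" using ab(2) by (auto elim: Rats_cases')
  have "of_int (a2 * b2) * x = el (a1 * b2 - b1 * a2) (2 * b1 * a2)"
    unfolding ab a b el_def \<omega>_def using a b by (simp add: field_simps)
  then show "\<exists>d::int. d > 0 \<and> of_int d * x \<in> L" using a b by (intro exI[of _ "a2 * b2"]) (auto simp: elI)
next
  assume "\<exists>d::int. d > 0 \<and> of_int d * x \<in> L"
  then obtain d u v where d: "d > 0" "of_int d * x = el u v" by (auto elim: LE)
  have "x = (of_int u + of_int v / 2) / of_int d + (of_int v / 2 / of_int d) * sq"
    using d unfolding el_def \<omega>_def by (simp add: field_simps)
  moreover have "(of_int u + of_int v / 2) / of_int d \<in> \<rat>" "of_int v / 2 / of_int d \<in> (\<rat> :: real set)" by simp_all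
  ultimately show "x \<in> quad_field p" unfolding quad_field_def by blast
qed

text \<open>If d clears the denominator of \<open>x\<close> and the monic equation has degree m,
  then d^m clears that of every power of \<open>x\<close>: the equation expresses higher powers by
  lower ones with integer coefficients.\<close>

lemma algebraic_int_bounded_denominator:
  assumes x: "x \<in> quad_field p" "algebraic_int x"
  shows "\<exists>D::int. D > 0 \<and> (\<forall>k. of_int D * x ^ k \<in> L)"
proof -
  obtain d :: int where d: "d > 0" "of_int d * x \<in> L" using x(1) quad_field_alt by blast
  obtain f where f: "lead_coeff f = 1" "\<forall>i. Polynomial.coeff f i \<in> \<int>" "poly f x = 0"
    using x(2) by (auto elim: algebraic_int.cases)
  define m where "m = degree f"
  have red: "x ^ m = - (\<Sum>i<m. Polynomial.coeff f i * x ^ i)"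
  proof -
    have "(\<Sum>i\<le>m. Polynomial.coeff f i * x ^ i) = 0" using f(3) by (simp add: poly_altdef m_def)
    then show ?thesis using f(1) by (simp add: m_def lessThan_Suc_atMost[symmetric] add_eq_0_iff2)
  qed
  have "of_int (d ^ m) * x ^ k \<in> L" for k
  proof (induction k rule: less_induct)
    case (less k)
    show ?case
    proof (cases "k < m")
      case True
      then have "of_int (d ^ m) * x ^ k = of_int (d ^ (m - k)) * (of_int d * x) ^ k"
        by (simp add: power_mult_distrib power_add[symmetric] mult.assoc[symmetric])
      then show ?thesis using d(2) by (auto intro!: L_mult L_power simp del: of_int_power)
    next
      case False
      have "of_int (d ^ m) * x ^ k = of_int (d ^ m) * x ^ (k - m) * x ^ m"
        using False by (simp add: power_add[symmetric])
      also have "\<dots> = - (\<Sum>i<m. Polynomial.coeff f i * (of_int (d ^ m) * x ^ (k - m + i)))"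
        unfolding red by (simp add: sum_distrib_left power_add algebra_simps)
      also have "\<dots> \<in> L"
      proof (intro L_uminus L_sum)
        fix i assume "i \<in> {..<m}"
        have "Polynomial.coeff f i \<in> L" using f(2) L_of_int by (metis Ints_cases)
        moreover have "of_int (d ^ m) * x ^ (k - m + i) \<in> L" using \<open>i \<in> {..<m}\<close> False by (intro less) auto
        ultimately show "Polynomial.coeff f i * (of_int (d ^ m) * x ^ (k - m + i)) \<in> L" by (rule L_mult)
      qed
      finally show ?thesis .
    qed
  qed
  then show ?thesis using d(1) by (intro exI[of _ "d ^ m"]) auto
qed

text \<open>Says that the norm of \<open>x\<close> is an integer. Taking norms of D (d x)^k shows
  that all powers of d^2 divide those of the norm of d x up to the fixed factor D^2, and
  \<open>power_dvd_bounded\<close> applies.\<close>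

lemma norm_denominator:
  assumes D: "D > 0" "\<And>k. of_int D * x ^ k \<in> L" and d: "d > 0" and y: "of_int d * x = el u v"
  shows "d\<^sup>2 dvd u * u + u * v - q * v * v"
proof -
  define N0 where "N0 = u * u + u * v - q * v * v"
  have dvd: "(d\<^sup>2) ^ k dvd D\<^sup>2 * N0 ^ k" for k
  proof -
    define w where "w = of_int D * x ^ k"
    have w: "w \<in> L" using D(2) w_def by simp
    have "of_int D * el u v ^ k = of_int (d ^ k) * w"
      unfolding y[symmetric] w_def power_mult_distrib of_int_power by (simp only: mult_ac)
    then have "Nm (of_int D * el u v ^ k) = Nm (of_int (d ^ k) * w)" by simp
    then have "of_int (D * D) * of_int N0 ^ k = of_int (d ^ k * d ^ k) * Nm w"
      unfolding Nm_mult[OF L_of_int L_power[OF elI]] Nm_power[OF elI] Nm_mult[OF L_of_int w] Nm_of_int Nm_el N0_def .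
    moreover obtain m where "Nm w = of_int m" using Nm_int[OF w] by blast
    ultimately have "of_int (D * D * N0 ^ k) = (of_int (d ^ k * d ^ k * m) :: real)"
      by (simp only: of_int_mult of_int_power)
    then have "D * D * N0 ^ k = d ^ k * d ^ k * m" by (simp only: of_int_eq_iff)
    then have "D\<^sup>2 * N0 ^ k = (d\<^sup>2) ^ k * m" by (simp only: power2_eq_square power_mult_distrib)
    then show ?thesis by (rule dvdI)
  qed
  have "D\<^sup>2 \<noteq> 0" "d\<^sup>2 \<noteq> 0" using D(1) d by simp_all
  from power_dvd_bounded[OF this dvd] show ?thesis unfolding N0_def .
qed

text \<open>Integrality of the norms of \<open>x\<close> and x + 1 gives integrality of the trace.
  Then p v^2 = trace^2 - 4 norm, in cleared form, forces the denominator to divide \<open>v\<close>,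
  and a parity argument modulo 4 shows that it divides \<open>u\<close> too.\<close>

lemma carrier_eq_L: "carrier (quad_int_ring p) = L"
proof (intro equalityI subsetI)
  fix x assume "x \<in> carrier (quad_int_ring p)"
  then have x: "x \<in> quad_field p" "algebraic_int x" by (auto simp: quad_int_ring_def)
  obtain D :: int where D: "D > 0" "\<And>k. of_int D * x ^ k \<in> L"
    using algebraic_int_bounded_denominator[OF x] by blast
  \<comment> \<open>By the binomial theorem the same \<open>D\<close> bounds the denominators of the
    powers of x + 1.\<close>
  have D1: "of_int D * (x + 1) ^ k \<in> L" for k
  proof -
    have "of_int D * (x + 1) ^ k = (\<Sum>i\<le>k. of_nat (k choose i) * (of_int D * x ^ i))"
      unfolding binomial_ring by (simp add: sum_distrib_left algebra_simps)
    also have "\<dots> \<in> L" by (intro L_sum L_mult[OF L_of_nat D(2)])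
    finally show ?thesis .
  qed
  obtain d u v where d: "d > 0" "of_int d * x = el u v" using x(1) quad_field_alt by (auto elim: LE)
  have n0: "d\<^sup>2 dvd u * u + u * v - q * v * v" by (rule norm_denominator[OF D d])
  have "of_int d * (x + 1) = el (u + d) v" using d(2) by (simp add: distrib_left el_def)
  then have n1: "d\<^sup>2 dvd (u + d) * (u + d) + (u + d) * v - q * v * v"
    by (rule norm_denominator[OF D(1) D1 d(1)])
  have "(u + d) * (u + d) + (u + d) * v - q * v * v - (u * u + u * v - q * v * v) - d * d = d * (2 * u + v)"
    by (simp add: algebra_simps)
  moreover have "d\<^sup>2 dvd d * d" by (simp add: power2_eq_square)
  ultimately have "d * d dvd d * (2 * u + v)" using n0 n1 by (metis dvd_diff power2_eq_square)
  then have tr: "d dvd 2 * u + v" using d(1) by simp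
  have "int p * v\<^sup>2 = (2 * u + v)\<^sup>2 - 4 * (u * u + u * v - q * v * v)"
    unfolding p_eq_q by (simp add: power2_eq_square algebra_simps)
  moreover have "d\<^sup>2 dvd (2 * u + v)\<^sup>2" using tr by (rule dvd_power_same)
  ultimately have "d\<^sup>2 dvd int p * v\<^sup>2" using n0 by (metis dvd_diff dvd_mult)
  then have "d dvd v" using square_dvd_prime_mult[OF prime_int_p] by blast
  then obtain v1 where v1: "v = d * v1" by blast
  with tr have "d dvd 2 * u" by (metis dvd_add_left_iff dvd_triv_left)
  then obtain t where t: "2 * u = d * t" by blast
  have "d * d dvd u * (u + v)"
  proof -
    have "u * (u + v) = (u * u + u * v - q * v * v) + d * d * (q * v1 * v1)" unfolding v1 by (simp add: algebra_simps)
    then show ?thesis using n0 by (metis dvd_add dvd_triv_left power2_eq_square)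
  qed
  then have "4 * (d * d) dvd 4 * (u * (u + v))" by (rule mult_dvd_mono[OF dvd_refl])
  moreover have "4 * (u * (u + v)) = (2 * u) * (2 * u + 2 * v)" by (simp add: algebra_simps)
  ultimately have "4 * (d * d) dvd (2 * u) * (2 * u + 2 * v)" by simp
  moreover have "(2 * u) * (2 * u + 2 * v) = d * d * (t * (t + 2 * v1))" unfolding t v1 by (simp add: algebra_simps)
  ultimately have "(d * d) * 4 dvd (d * d) * (t * (t + 2 * v1))" by (simp add: mult.commute)
  then have "4 dvd t * (t + 2 * v1)" using d(1) by simp
  then have "even (t * (t + 2 * v1))" by (meson dvd_trans even_numeral)
  then have "even t" by auto
  then obtain t1 where "t = 2 * t1" by blast
  then have u: "u = d * t1" using t by simp
  have "of_int d * x = of_int d * el t1 v1" unfolding d(2) u v1 el_def by (simp add: algebra_simps)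
  then have "x = el t1 v1" using d(1) by simp
  then show "x \<in> L" by auto
next
  fix x assume "x \<in> L"
  then obtain u v where x: "x = el u v" by (rule LE)
  have "x * x = of_int (2 * u + v) * x + of_int (- (u * u + u * v - q * v * v))"
    unfolding x el_mult by (simp add: el_def algebra_simps)
  then have "algebraic_int x" by (rule algebraic_int_quadratic)
  moreover have "x \<in> quad_field p" using \<open>x \<in> L\<close> quad_field_alt by (intro iffD2[OF quad_field_alt] exI[of _ 1]) auto
  ultimately show "x \<in> carrier (quad_int_ring p)" by (simp add: quad_int_ring_def)
qed

abbreviation QR :: "real ring" where "QR \<equiv> quad_int_ring p"

lemma QR_simps: "mult QR = (*)" "one QR = 1" "zero QR = 0" "add QR = (+)" "carrier QR = L"
  by (simp_all add: carrier_eq_L) (simp_all add: quad_int_ring_def)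

lemma ring_QR: "ring QR"
proof (rule ringI)
  show "abelian_group QR"
    by (rule abelian_groupI) (auto simp: QR_simps L_add algebra_simps intro!: bexI[of _ "- x" for x] L_uminus)
  show "Group.monoid QR"
    by (rule Group.monoidI) (auto simp: QR_simps L_mult algebra_simps)
qed (auto simp: QR_simps algebra_simps)

lemma ideal_iff: "ideal I QR \<longleftrightarrow>
  I \<subseteq> L \<and> 0 \<in> I \<and> (\<forall>x\<in>I. \<forall>y\<in>I. x + y \<in> I) \<and> (\<forall>x\<in>I. \<forall>y\<in>L. y * x \<in> I)" (is "_ \<longleftrightarrow> ?R")
proof
  assume I: "ideal I QR"
  note sub = ideal.axioms(1)[OF I]
  have "I \<subseteq> L" using additive_subgroup.a_subset[OF sub] unfolding QR_simps .
  moreover have "0 \<in> I" using additive_subgroup.zero_closed[OF sub] unfolding QR_simps .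
  moreover have "x + y \<in> I" if "x \<in> I" "y \<in> I" for x y
    using additive_subgroup.a_closed[OF sub that] unfolding QR_simps .
  moreover have "y * x \<in> I" if "x \<in> I" "y \<in> L" for x y
    using ideal.I_l_closed[OF I that(1), of y] that(2) unfolding QR_simps .
  ultimately show ?R by blast
next
  assume R: ?R
  show "ideal I QR"
  proof (rule idealI[OF ring_QR])
    have neg: "- x \<in> I" if "x \<in> I" for x
    proof -
      have "of_int (- 1) * x \<in> I" using R that L_of_int[of "- 1"] by blast
      then show ?thesis by simp
    qed
    have inv: "m_inv (add_monoid QR) x = - x" if "x \<in> I" for x
    proof -
      have "x \<in> L" "- x \<in> L" using that neg[OF that] R by blast+
      then have "\<ominus>\<^bsub>QR\<^esub> x = - x"
        by (intro abelian_group.minus_equality[OF ring.axioms(1)[OF ring_QR]]) (simp_all add: QR_simps)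
      then show ?thesis by (simp add: a_inv_def)
    qed
    show "subgroup I (add_monoid QR)"
    proof (rule subgroup.intro)
      show "I \<subseteq> carrier (add_monoid QR)" using R by (simp add: QR_simps)
      show "x \<otimes>\<^bsub>add_monoid QR\<^esub> y \<in> I" if "x \<in> I" "y \<in> I" for x y
        using R that by (simp add: QR_simps)
      show "\<one>\<^bsub>add_monoid QR\<^esub> \<in> I" using R by (simp add: QR_simps)
      show "m_inv (add_monoid QR) x \<in> I" if "x \<in> I" for x
        unfolding inv[OF that] by (rule neg[OF that])
    qed
    fix a x assume ax: "a \<in> I" "x \<in> carrier QR"
    then have "x \<in> L" by (simp only: QR_simps)
    then have "x * a \<in> I" using R ax by blast
    then show "x \<otimes>\<^bsub>QR\<^esub> a \<in> I" by (simp only: QR_simps)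
    from \<open>x * a \<in> I\<close> show "a \<otimes>\<^bsub>QR\<^esub> x \<in> I" by (simp only: QR_simps mult.commute[of x a])
  qed
qed

lemma Units_iff: "u \<in> Units QR \<longleftrightarrow> u \<in> L \<and> \<bar>Nm u\<bar> = 1"
proof
  assume "u \<in> Units QR"
  then obtain v where uv: "u \<in> L" "v \<in> L" "u * v = 1" unfolding Units_def QR_simps by (auto simp: mult.commute)
  obtain m m' where m: "Nm u = of_int m" "Nm v = of_int m'" using Nm_int uv by blast
  have "Nm u * Nm v = Nm 1" using uv by (simp add: Nm_mult[symmetric])
  moreover have "Nm 1 = 1" by (simp add: Nm_def)
  ultimately have "of_int (m * m') = (of_int 1 :: real)" unfolding m by simp
  then have "m * m' = 1" by (simp only: of_int_eq_iff)
  then have "\<bar>m\<bar> = 1" by (metis abs_zmult_eq_1 abs_1)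
  then show "u \<in> L \<and> \<bar>Nm u\<bar> = 1" using uv m by (metis of_int_1 of_int_abs)
next
  assume u: "u \<in> L \<and> \<bar>Nm u\<bar> = 1"
  then have "Nm u = 1 \<or> Nm u = - 1" by linarith
  then have "u * (Nm u * cj u) = 1" by (auto simp: Nm_def)
  moreover have "Nm u * cj u \<in> L" using u cj_in_L Nm_int L_mult L_of_int by metis
  ultimately show "u \<in> Units QR" unfolding Units_def QR_simps using u by (auto simp: mult.commute)
qed

end

section \<open>The fundamental unit\<close>

context prime_1_mod_4
begin

definition U :: "real set" where "U = {u \<in> L. \<bar>Nm u\<bar> = 1}"

lemma Units_QR: "Units QR = U"
  using Units_iff by (auto simp: U_def)

lemma U_L: "u \<in> U \<Longrightarrow> u \<in> L"
  by (simp add: U_def)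

lemma U_nonzero: "u \<in> U \<Longrightarrow> u \<noteq> 0"
  using Nm_def by (auto simp: U_def)

lemma U_mult: "u \<in> U \<Longrightarrow> v \<in> U \<Longrightarrow> u * v \<in> U"
  by (simp add: U_def L_mult Nm_mult abs_mult)

lemma U_1: "1 \<in> U"
  by (simp add: U_def Nm_def)

lemma U_uminus: "u \<in> U \<Longrightarrow> - u \<in> U"
  by (simp add: U_def L_uminus Nm_def cj_uminus)

lemma Nm_1 [simp]: "Nm 1 = 1"
  by (simp add: Nm_def)

lemma U_inverse: assumes "u \<in> U" shows "inverse u \<in> U" "Nm (inverse u) = Nm u"
proof -
  have u: "u \<in> L" "Nm u = 1 \<or> Nm u = - 1" using assms by (auto simp: U_def abs_if split: if_splits)
  have "inverse u = Nm u * cj u"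
  proof (rule inverse_unique)
    have "u * (Nm u * cj u) = Nm u * Nm u" by (simp only: Nm_def mult_ac)
    then show "u * (Nm u * cj u) = 1" using u(2) by auto
  qed
  moreover have "Nm u * cj u \<in> L" using u(2) cj_in_L[OF u(1)] L_uminus[OF cj_in_L[OF u(1)]] by (elim disjE) simp_all
  ultimately have iL: "inverse u \<in> L" by simp
  have "Nm (inverse u) * Nm u = Nm (inverse u * u)" by (rule Nm_mult[OF iL u(1), symmetric])
  also have "inverse u * u = 1" using U_nonzero[OF assms] by simp
  finally have "Nm (inverse u) * Nm u = 1" by simp
  then show Nm: "Nm (inverse u) = Nm u" using u(2) by (elim disjE) simp_all
  show "inverse u \<in> U" using iL assms unfolding U_def mem_Collect_eq Nm by blast
qed

lemma U_power: "u \<in> U \<Longrightarrow> u ^ k \<in> U"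
  by (simp add: U_def L_power Nm_power power_abs)

lemma U_powi: "u \<in> U \<Longrightarrow> u powi k \<in> U"
  by (cases "k \<ge> 0") (auto simp: power_int_def U_power U_inverse)

lemma Nm_powi_1: "u \<in> U \<Longrightarrow> Nm u = 1 \<Longrightarrow> Nm (u powi k) = 1"
  by (cases "k \<ge> 0") (auto simp: power_int_def Nm_power U_L U_inverse)

lemma el_minus_cj: "el x y - cj (el x y) = of_int y * sq"
  unfolding cj_el unfolding el_def \<omega>_def by (simp add: field_simps)

text \<open>A unit u > 1 has a conjugate of absolute value 1/u < 1, so both conjugates, and with
  them both integer coordinates, are bounded.\<close>

lemma finite_U_interval: "finite {u \<in> U. 1 < u \<and> u \<le> B}"
proof -
  define M where "M = \<lceil>\<bar>B\<bar> + (\<bar>B\<bar> + 1) * (\<omega> + 1)\<rceil>"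
  have sq1: "sq \<ge> 1" using p_gt_3 by simp
  have \<omega>1: "\<omega> \<ge> 1" using sq1 by (simp add: \<omega>_def)
  have "{u \<in> U. 1 < u \<and> u \<le> B} \<subseteq> (\<lambda>(x, y). el x y) ` ({- M..M} \<times> {- M..M})"
  proof
    fix u assume "u \<in> {u \<in> U. 1 < u \<and> u \<le> B}"
    then have u: "u \<in> U" "1 < u" "u \<le> B" by auto
    obtain x y where xy: "u = el x y" using U_L[OF u(1)] by (rule LE)
    have "\<bar>u\<bar> * \<bar>cj u\<bar> = 1" using u(1) by (simp add: U_def Nm_def abs_mult)
    then have "\<bar>cj u\<bar> = 1 / u" using u by (simp add: field_simps)
    then have cj: "\<bar>cj u\<bar> \<le> 1" using u by simp
    have "of_int y * sq = u - cj u" unfolding xy by (rule el_minus_cj[symmetric])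
    then have "\<bar>of_int y * sq\<bar> \<le> \<bar>B\<bar> + 1"
      using cj u by linarith
    moreover have "\<bar>of_int y\<bar> * 1 \<le> \<bar>of_int y\<bar> * sq" using sq1 by (intro mult_left_mono) auto
    ultimately have y: "\<bar>of_int y\<bar> \<le> \<bar>B\<bar> + 1" by (simp add: abs_mult)
    have "of_int x = u - of_int y * \<omega>" unfolding xy el_def by simp
    then have "\<bar>of_int x\<bar> \<le> \<bar>u\<bar> + \<bar>of_int y\<bar> * \<bar>\<omega>\<bar>" unfolding abs_mult[symmetric] by linarith
    also have "\<dots> \<le> \<bar>B\<bar> + (\<bar>B\<bar> + 1) * \<omega>"
      using y u \<omega>1 by (intro add_mono mult_mono) auto
    finally have x: "\<bar>of_int x\<bar> \<le> \<bar>B\<bar> + (\<bar>B\<bar> + 1) * \<omega>" .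
    have xM: "\<bar>of_int x\<bar> \<le> \<bar>B\<bar> + (\<bar>B\<bar> + 1) * (\<omega> + 1)"
      using x by (simp add: algebra_simps)
    have "(\<bar>B\<bar> + 1) * \<omega> \<ge> 0" using \<omega>1 by simp
    then have yM: "\<bar>of_int y\<bar> \<le> \<bar>B\<bar> + (\<bar>B\<bar> + 1) * (\<omega> + 1)"
      using y by (simp add: algebra_simps)
    have "\<bar>x\<bar> \<le> M" "\<bar>y\<bar> \<le> M" using xM yM unfolding M_def by linarith+
    then show "u \<in> (\<lambda>(x, y). el x y) ` ({- M..M} \<times> {- M..M})"
      unfolding xy by (intro image_eqI[of _ _ "(x, y)"]) auto
  qed
  then show ?thesis by (rule finite_subset) auto
qed

text \<open>A unit of norm -1 is neither 1 nor -1, so its absolute value or the inverse of that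
  exceeds 1, and finiteness yields a least unit above 1. Dividing by a suitable power shows that it
  generates, which also gives uniqueness for the definite description. If it had norm 1, so would
  every unit.\<close>

lemma fundamental_unit_properties:
  assumes \<eta>: "\<eta> \<in> L" "Nm \<eta> = - 1"
  defines "\<epsilon> \<equiv> fundamental_unit p"
  shows "\<epsilon> \<in> U" "\<epsilon> > 1" "Nm \<epsilon> = - 1" "\<And>u. u \<in> U \<Longrightarrow> u > 1 \<Longrightarrow> \<epsilon> \<le> u"
proof -
  have \<eta>U: "\<eta> \<in> U" using \<eta> by (simp add: U_def)
  have "Nm (- 1) = 1" using Nm_of_int[of "- 1"] by simp
  then have "\<eta> \<noteq> 1" "\<eta> \<noteq> - 1" "\<eta> \<noteq> 0" using \<eta> Nm_1 U_nonzero[OF \<eta>U] by fastforce+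
  then have w: "\<bar>\<eta>\<bar> \<noteq> 1" "\<bar>\<eta>\<bar> > 0" by linarith+
  have wU: "\<bar>\<eta>\<bar> \<in> U" using \<eta>U U_uminus[OF \<eta>U] by (cases "\<eta> \<ge> 0") simp_all
  obtain u0 where u0: "u0 \<in> U" "u0 > 1"
  proof (cases "\<bar>\<eta>\<bar> > 1")
    case True then show ?thesis using that wU by blast
  next
    case False
    then have "inverse \<bar>\<eta>\<bar> > 1" using w by (intro one_less_inverse) linarith+
    then show ?thesis using that U_inverse(1)[OF wU] by blast
  qed
  define T where "T = {u \<in> U. 1 < u \<and> u \<le> u0}"
  have T: "finite T" "T \<noteq> {}" using finite_U_interval u0 by (auto simp: T_def)
  define e0 where "e0 = Min T"
  have e0: "e0 \<in> U" "e0 > 1" using Min_in[OF T] by (auto simp: T_def e0_def)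
  have least: "e0 \<le> u" if "u \<in> U" "u > 1" for u
  proof (cases "u \<le> u0")
    case True then show ?thesis unfolding e0_def using that T by (intro Min_le) (auto simp: T_def)
  next
    case False
    have "e0 \<le> u0" unfolding e0_def using u0 T by (intro Min_le) (auto simp: T_def)
    then show ?thesis using False by simp
  qed
  have pos_units: "\<exists>k::int. u = e0 powi k" if u: "u \<in> U" "u > 0" for u
  proof -
    \<comment> \<open>Dividing by this power brings the unit into the interval from 1 to
      \<open>e0\<close>, where minimality leaves only 1.\<close>
    define k where "k = \<lfloor>log e0 u\<rfloor>"
    define w where "w = u * e0 powi (- k)"
    have wU: "w \<in> U" unfolding w_def using u e0 by (intro U_mult U_powi) auto
    have pk: "e0 powi k = e0 powr of_int k" using e0 by (simp add: powr_real_of_int')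
    have "e0 powr of_int k \<le> e0 powr log e0 u" "e0 powr log e0 u < e0 powr (of_int k + 1)"
      using e0 unfolding k_def by (auto intro!: powr_mono)
    then have "e0 powi k \<le> u" "u < e0 powi k * e0" using e0 u by (simp_all add: pk powr_add)
    moreover have "e0 powi k > 0" using e0 by simp
    ultimately have "1 \<le> w" "w < e0" unfolding w_def power_int_minus by (simp_all add: field_simps)
    then have "w = 1" using least[OF wU] by force
    then have "u = e0 powi k" unfolding w_def power_int_minus using \<open>e0 powi k > 0\<close> by (simp add: field_simps)
    then show ?thesis ..
  qed
  have all_units: "\<exists>k::int. u = e0 powi k \<or> u = - (e0 powi k)" if "u \<in> U" for u
  proof (cases "u > 0")
    case True then show ?thesis using pos_units that by blast
  next
    case False
    then have mu: "- u > 0" using U_nonzero[OF that] by simp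
    obtain k :: int where "- u = e0 powi k" using pos_units[OF _ mu] U_uminus \<open>u \<in> U\<close> by blast
    then have "u = - (e0 powi k)" by simp
    then show ?thesis by blast
  qed
  have "fundamental_unit p = e0"
    unfolding fundamental_unit_def Units_QR
  proof (rule the_equality)
    show "e0 \<in> U \<and> 1 < e0 \<and> (\<forall>u\<in>U. \<exists>k. u = e0 powi k \<or> u = - (e0 powi k))"
      using e0 all_units by blast
    fix e assume e: "e \<in> U \<and> 1 < e \<and> (\<forall>u\<in>U. \<exists>k. u = e powi k \<or> u = - (e powi k))"
    have ge: "e0 \<le> e" using least e by blast
    obtain k :: int where k: "e0 = e powi k \<or> e0 = - (e powi k)" using e e0 by blast
    have pk: "e powi k > 0" using e by simp
    then have k': "e0 = e powi k" using k e0 by linarith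
    have "k > 0"
    proof (rule ccontr)
      assume "\<not> k > 0"
      then have "e powi k \<le> e powi 0" using e by (intro power_int_increasing) auto
      then show False using k' e0 by simp
    qed
    then have "e powi 1 \<le> e powi k" using e by (intro power_int_increasing) auto
    then show "e = e0" using k' ge by simp
  qed
  then have \<epsilon>: "\<epsilon> = e0" by (simp add: \<epsilon>_def)
  show "\<epsilon> \<in> U" "\<epsilon> > 1" "\<And>u. u \<in> U \<Longrightarrow> u > 1 \<Longrightarrow> \<epsilon> \<le> u" using e0 least by (simp_all add: \<epsilon>)
  show "Nm \<epsilon> = - 1"
  proof (rule ccontr)
    assume "Nm \<epsilon> \<noteq> - 1"
    then have 1: "Nm e0 = 1" using e0 by (auto simp: U_def \<epsilon> abs_if split: if_splits)
    obtain k :: int where "\<eta> = e0 powi k \<or> \<eta> = - (e0 powi k)" using all_units[OF \<eta>U] by blast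
    then have "Nm \<eta> = Nm (e0 powi k)"
      using U_L[OF U_powi[OF e0(1)]] by (auto simp: Nm_def cj_uminus)
    then show False using Nm_powi_1[OF e0(1) 1] \<eta> by simp
  qed
qed

end

section \<open>Ideals\<close>

context prime_1_mod_4
begin

text \<open>The ideal \<open>k (\<int> a + \<int> (b + \<omega>))\<close>, of norm \<open>k\<^sup>2 a\<close>.\<close>

definition std_ideal :: "nat \<Rightarrow> nat \<Rightarrow> int \<Rightarrow> real set" where
  "std_ideal k a b = {el (int k * (x * int a + y * b)) (int k * y) | x y. True}"

text \<open>The divisibility makes the lattice closed under multiplication by \<omega>; reducing b
  modulo a makes the description of an ideal unique.\<close>

definition valid :: "nat \<Rightarrow> nat \<Rightarrow> int \<Rightarrow> bool" where
  "valid k a b \<longleftrightarrow> k > 0 \<and> a > 0 \<and> b \<in> {0..<int a} \<and> int a dvd root_poly q b"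

lemma el_in_std_ideal: "el u v \<in> std_ideal k a b \<longleftrightarrow> (\<exists>x y. u = int k * (x * int a + y * b) \<and> v = int k * y)"
  unfolding std_ideal_def by (auto simp: el_unique)

lemma std_ideal_ideal:
  assumes "int a dvd root_poly q b"
  shows "ideal (std_ideal k a b) QR"
  unfolding ideal_iff
proof (intro conjI ballI)
  show "std_ideal k a b \<subseteq> L" by (auto simp: std_ideal_def)
  show "0 \<in> std_ideal k a b" using el_in_std_ideal[of 0 0 k a b] by (auto simp: el_def intro!: exI[of _ 0])
next
  fix s t assume "s \<in> std_ideal k a b" "t \<in> std_ideal k a b"
  then obtain x y x' y' where "s = el (int k * (x * int a + y * b)) (int k * y)" "t = el (int k * (x' * int a + y' * b)) (int k * y')"
    by (auto simp: std_ideal_def)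
  then have "s + t = el (int k * ((x + x') * int a + (y + y') * b)) (int k * (y + y'))"
    by (simp add: el_add algebra_simps)
  then show "s + t \<in> std_ideal k a b" by (auto simp: std_ideal_def)
next
  fix s t assume "s \<in> std_ideal k a b" "t \<in> L"
  then obtain x y u v where st: "s = el (int k * (x * int a + y * b)) (int k * y)" "t = el u v"
    by (auto simp: std_ideal_def elim: LE)
  obtain c where c: "b\<^sup>2 + b - q = int a * c" using assms by (auto simp: root_poly_def)
  have q: "q = b * b + b - int a * c" using c by (simp add: power2_eq_square)
  \<comment> \<open>Coordinates of the product in the basis a, b + \<omega>, obtained by eliminating
    \<open>q\<close> through b^2 + b - q = a c.\<close>
  define x' y' where "x' = u * x - v * x * b - v * y * c" and "y' = u * y + v * x * int a + v * y * (b + 1)"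
  have "u * (int k * (x * int a + y * b)) + q * v * (int k * y) = int k * (x' * int a + y' * b)"
    unfolding x'_def y'_def q by (simp add: algebra_simps)
  moreover have "u * (int k * y) + (int k * (x * int a + y * b)) * v + v * (int k * y) = int k * y'"
    unfolding y'_def by (simp add: algebra_simps)
  ultimately have "t * s = el (int k * (x' * int a + y' * b)) (int k * y')"
    unfolding st el_mult by (simp only:)
  then show "t * s \<in> std_ideal k a b" by (auto simp: std_ideal_def)
qed

lemma std_ideal_shift: "std_ideal k a (b + t * int a) = std_ideal k a b"
proof -
  have "el u v \<in> std_ideal k a (b + t * int a) \<longleftrightarrow> el u v \<in> std_ideal k a b" for u v
  proof -
    have "(\<exists>x y. u = int k * (x * int a + y * (b + t * int a)) \<and> v = int k * y) \<longleftrightarrow>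
        (\<exists>x y. u = int k * (x * int a + y * b) \<and> v = int k * y)"
    proof
      assume "\<exists>x y. u = int k * (x * int a + y * (b + t * int a)) \<and> v = int k * y"
      then obtain x y where "u = int k * (x * int a + y * (b + t * int a))" "v = int k * y" by blast
      then show "\<exists>x y. u = int k * (x * int a + y * b) \<and> v = int k * y"
        by (intro exI[of _ "x + y * t"] exI[of _ y]) (simp add: algebra_simps)
    next
      assume "\<exists>x y. u = int k * (x * int a + y * b) \<and> v = int k * y"
      then obtain x y where "u = int k * (x * int a + y * b)" "v = int k * y" by blast
      then show "\<exists>x y. u = int k * (x * int a + y * (b + t * int a)) \<and> v = int k * y"
        by (intro exI[of _ "x - y * t"] exI[of _ y]) (simp add: algebra_simps)
    qed
    then show ?thesis unfolding el_in_std_ideal .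
  qed
  moreover have "\<exists>u v. s = el u v" if "s \<in> std_ideal k a b" for s b using that by (auto simp: std_ideal_def)
  ultimately show ?thesis by blast
qed

text \<open>A Hermite normal form: m is the least positive integer in the ideal and k the least
  positive coefficient of \<omega>, attained at c + k \<omega>. Multiplying elements by \<omega>
  shows that k divides both m and c. A nonzero integer exists in the ideal because norms lie in
  it.\<close>

lemma ideal_is_std_ideal:
  assumes I: "ideal I QR" "I \<noteq> {0}"
  shows "\<exists>k a b. valid k a b \<and> I = std_ideal k a b"
proof -
  have IL: "I \<subseteq> L" and I0: "0 \<in> I" and Iadd: "\<And>x y. x \<in> I \<Longrightarrow> y \<in> I \<Longrightarrow> x + y \<in> I"
    and Imult: "\<And>x y. x \<in> I \<Longrightarrow> y \<in> L \<Longrightarrow> y * x \<in> I"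
    using I(1) unfolding ideal_iff by blast+
  have scale: "el (t * u) (t * v) \<in> I" if "el u v \<in> I" for t u v
    using Imult[OF that L_of_int[of t]] by (simp add: el_def algebra_simps)
  have comb: "el (u + t * u') (v + t * v') \<in> I" if "el u v \<in> I" "el u' v' \<in> I" for t u v u' v'
    using Iadd[OF that(1) scale[OF that(2), of t]] by (simp add: el_add)
  have mulw: "el (q * v) (u + v) \<in> I" if "el u v \<in> I" for u v
    using Imult[OF that L_\<omega>] unfolding el_\<omega> el_mult by simp
  obtain x0 where x0: "x0 \<in> I" "x0 \<noteq> 0" using I I0 by blast
  then have x0L: "x0 \<in> L" using IL by blast
  obtain N0 where N0: "Nm x0 = of_int N0" using Nm_int[OF x0L] by blast
  have "N0 \<noteq> 0" using N0 Nm_eq_0[OF x0L] x0 by auto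
  have "cj x0 * x0 = of_int N0" using N0 by (simp only: Nm_def mult.commute[of "cj x0"])
  then have N0I: "el N0 0 \<in> I" using Imult[OF x0(1) cj_in_L[OF x0L]] by (simp only: el_of_int)
  have absI: "el \<bar>N0\<bar> 0 \<in> I"
  proof -
    have "sgn N0 * N0 = \<bar>N0\<bar>" by (simp add: sgn_if)
    then show ?thesis using scale[OF N0I, of "sgn N0"] by simp
  qed
  define P where "P m \<longleftrightarrow> m > 0 \<and> el (int m) 0 \<in> I" for m
  have "P (nat \<bar>N0\<bar>)" unfolding P_def using absI \<open>N0 \<noteq> 0\<close> by simp
  define m where "m = (LEAST m. P m)"
  have m: "m > 0" "el (int m) 0 \<in> I" using LeastI[of P, OF \<open>P (nat \<bar>N0\<bar>)\<close>] unfolding m_def P_def by auto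
  have m_least: "m \<le> m'" if "m' > 0" "el (int m') 0 \<in> I" for m'
    unfolding m_def using that by (intro Least_le) (simp add: P_def)
  have m_dvd: "int m dvd u" if "el u 0 \<in> I" for u
  proof (rule ccontr)
    assume "\<not> int m dvd u"
    then have "u mod int m \<noteq> 0" using mod_0_imp_dvd by blast
    moreover have "u mod int m \<ge> 0" using m(1) by simp
    ultimately have pos: "u mod int m > 0" by linarith
    have "el (u + (- (u div int m)) * int m) (0 + (- (u div int m)) * 0) \<in> I" by (rule comb[OF that m(2)])
    then have "el (u mod int m) 0 \<in> I" by (simp add: minus_div_mult_eq_mod)
    then have "m \<le> nat (u mod int m)" using pos by (intro m_least) auto
    then have "int m \<le> u mod int m" using pos by (simp add: le_nat_iff)
    moreover have "u mod int m < int m" using m(1) by simp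
    ultimately show False by linarith
  qed
  define Q where "Q k \<longleftrightarrow> k > 0 \<and> (\<exists>c. el c (int k) \<in> I)" for k
  have "el 0 (int m) \<in> I" using mulw[OF m(2)] by simp
  then have "Q m" unfolding Q_def using m(1) by blast
  define k where "k = (LEAST k. Q k)"
  have "Q k" unfolding k_def by (rule LeastI[of Q, OF \<open>Q m\<close>])
  then obtain c where k: "k > 0" "el c (int k) \<in> I" unfolding Q_def by blast
  have k_least: "k \<le> k'" if "k' > 0" "el c' (int k') \<in> I" for k' c'
    unfolding k_def using that by (intro Least_le) (auto simp: Q_def)
  have k_dvd: "int k dvd v" if "el u v \<in> I" for u v
  proof (rule ccontr)
    assume "\<not> int k dvd v"
    then have "v mod int k \<noteq> 0" using mod_0_imp_dvd by blast
    moreover have "v mod int k \<ge> 0" using k(1) by simp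
    ultimately have pos: "v mod int k > 0" by linarith
    have "el (u + (- (v div int k)) * c) (v + (- (v div int k)) * int k) \<in> I" by (rule comb[OF that k(2)])
    then have "el (u + (- (v div int k)) * c) (int (nat (v mod int k))) \<in> I" using pos by (simp add: minus_div_mult_eq_mod)
    then have "k \<le> nat (v mod int k)" using pos by (intro k_least) auto
    then have "int k \<le> v mod int k" using pos by (simp add: le_nat_iff)
    moreover have "v mod int k < int k" using k(1) by simp
    ultimately show False by linarith
  qed
  have "int k dvd int m" using k_dvd \<open>el 0 (int m) \<in> I\<close> by blast
  then obtain a where a: "m = k * a" by auto
  have a0: "a > 0" using a m by (cases a) auto
  have wI: "el (q * int k) (c + int k) \<in> I" by (rule mulw[OF k(2)])
  have "int k dvd c + int k" by (rule k_dvd[OF wI])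
  then have "int k dvd c" by simp
  then obtain b0 where b0: "c = int k * b0" by blast
  \<comment> \<open>\<omega> times the generator c + k \<omega>, reduced by that generator to a
    rational integer; divisibility of this integer by m = k a is the root condition modulo
    a.\<close>
  have "el (q * int k + (- (b0 + 1)) * c) (c + int k + (- (b0 + 1)) * int k) \<in> I" by (rule comb[OF wI k(2)])
  moreover have "c + int k + (- (b0 + 1)) * int k = 0" by (simp add: b0 algebra_simps)
  moreover have "q * int k + (- (b0 + 1)) * c = int k * (- root_poly q b0)" by (simp add: b0 root_poly_def power2_eq_square algebra_simps)
  ultimately have "el (int k * (- root_poly q b0)) 0 \<in> I" by (simp only:)
  then have "int m dvd int k * (- root_poly q b0)" by (rule m_dvd)
  then have ad: "int a dvd root_poly q b0" using k(1) unfolding a by simp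
  define b where "b = b0 mod int a"
  have b: "b0 = b + (b0 div int a) * int a" by (simp add: b_def)
  have "[b0 = b] (mod int a)" by (simp add: b_def unique_euclidean_semiring_class.cong_def)
  then have "int a dvd root_poly q b" using ad root_poly_cong by blast
  then have valid: "valid k a b" unfolding valid_def using k a0 by (simp add: b_def)
  have "I = std_ideal k a b0"
  proof (intro equalityI subsetI)
    fix s assume s: "s \<in> I"
    then have "s \<in> L" using IL by blast
    then obtain u v where uv: "s = el u v" by (rule LE)
    obtain y where y: "v = int k * y" using k_dvd s uv by blast
    have "el (u + (- y) * c) (v + (- y) * int k) \<in> I" using s uv by (intro comb[OF _ k(2)]) simp
    then have "el (u - y * c) 0 \<in> I" by (simp add: y algebra_simps)
    then obtain x where "u - y * c = int m * x" using m_dvd by blast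
    then have "u = int k * (x * int a + y * b0)" by (simp add: a b0 algebra_simps)
    then show "s \<in> std_ideal k a b0" unfolding uv el_in_std_ideal using y by blast
  next
    fix s assume "s \<in> std_ideal k a b0"
    then obtain x y where s: "s = el (int k * (x * int a + y * b0)) (int k * y)" by (auto simp: std_ideal_def)
    have "el (x * int m + y * c) (x * 0 + y * int k) \<in> I" by (rule comb[OF scale[OF m(2)] k(2)])
    then show "s \<in> I" unfolding s by (simp add: a b0 algebra_simps)
  qed
  also have "\<dots> = std_ideal k a b" using std_ideal_shift[of k a b "b0 div int a"] unfolding b[symmetric] .
  finally show ?thesis using valid by blast
qed

lemma std_ideal_nonzero: "valid k a b \<Longrightarrow> std_ideal k a b \<noteq> {0}"
proof -
  assume v: "valid k a b"
  have "el (int k * b) (int k) \<in> std_ideal k a b" unfolding el_in_std_ideal by (intro exI[of _ 0] exI[of _ 1]) simp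
  moreover have "el (int k * b) (int k) \<noteq> el 0 0" using v by (auto simp: el_unique valid_def)
  moreover have "el 0 0 = 0" by (simp add: el_def)
  ultimately show ?thesis by auto
qed

lemma nonzero_ideals_eq: "nonzero_ideals p = {std_ideal k a b | k a b. valid k a b}"
  unfolding nonzero_ideals_def using ideal_is_std_ideal std_ideal_ideal std_ideal_nonzero by (auto simp: valid_def)

lemma std_ideal_unique:
  assumes v: "valid k a b" "valid k' a' b'" and eq: "std_ideal k a b = std_ideal k' a' b'"
  shows "k = k' \<and> a = a' \<and> b = b'"
proof -
  have kdvd: "int k dvd int k'" if v: "valid k a b" "valid k' a' b'" and eq: "std_ideal k a b = std_ideal k' a' b'" for k a b k' a' b'
  proof -
    have "el (int k' * b') (int k') \<in> std_ideal k a b" unfolding eq el_in_std_ideal by (intro exI[of _ 0] exI[of _ 1]) simp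
    then obtain y where "int k' = int k * y" unfolding el_in_std_ideal by blast
    then show ?thesis by (rule dvdI)
  qed
  have k: "k = k'" using kdvd[OF v eq] kdvd[OF v(2,1) eq[symmetric]] by (simp add: dvd_antisym)
  have k0: "k > 0" using v by (simp add: valid_def)
  have adv: "int a dvd int a'" if v: "valid k a b" "valid k a' b'" and eq: "std_ideal k a b = std_ideal k a' b'" for a b a' b'
  proof -
    have "el (int k * int a') 0 \<in> std_ideal k a b" unfolding eq el_in_std_ideal by (intro exI[of _ 1] exI[of _ 0]) simp
    then obtain x y where xy: "int k * int a' = int k * (x * int a + y * b)" "0 = int k * y" unfolding el_in_std_ideal by blast
    then have "y = 0" using k0 by simp
    then have "int a' = x * int a" using xy k0 by simp
    then show ?thesis by simp
  qed
  have a: "a = a'" using adv[of a b a' b'] adv[of a' b' a b] v eq k by (simp add: dvd_antisym)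
  have "el (int k * b) (int k) \<in> std_ideal k a b'"
    unfolding eq[unfolded k[symmetric] a[symmetric], symmetric] el_in_std_ideal by (intro exI[of _ 0] exI[of _ 1]) simp
  then obtain x y where xy: "int k * b = int k * (x * int a + y * b')" "int k = int k * y" unfolding el_in_std_ideal by blast
  then have "y = 1" using k0 by simp
  then have "b = x * int a + b'" using xy k0 by simp
  then have "b mod int a = b' mod int a" by simp
  then have "b = b'" using v a by (simp add: valid_def)
  then show ?thesis using k a by simp
qed

text \<open>The usual norm, the index of k (Z a + Z (b + \<omega>)) in the ring, read off from the
  unique normal form.\<close>

definition ideal_norm :: "real set \<Rightarrow> nat" where
  "ideal_norm I = (THE m. \<exists>k a b. valid k a b \<and> I = std_ideal k a b \<and> m = k\<^sup>2 * a)"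

lemma ideal_norm_std_ideal: "valid k a b \<Longrightarrow> ideal_norm (std_ideal k a b) = k\<^sup>2 * a"
  unfolding ideal_norm_def by (rule the_equality) (use std_ideal_unique in blast)+

definition triples :: "nat \<Rightarrow> (nat \<times> nat \<times> int) set" where
  "triples X = {(k, a, b). valid k a b \<and> k\<^sup>2 * a \<le> X}"

lemma bij_triples: "bij_betw (\<lambda>(k, a, b). std_ideal k a b) (triples X) {I \<in> nonzero_ideals p. ideal_norm I \<le> X}"
proof (rule bij_betw_imageI)
  show "inj_on (\<lambda>(k, a, b). std_ideal k a b) (triples X)"
    by (rule inj_onI) (use std_ideal_unique in \<open>auto simp: triples_def\<close>)
  show "(\<lambda>(k, a, b). std_ideal k a b) ` triples X = {I \<in> nonzero_ideals p. ideal_norm I \<le> X}"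
  proof (intro equalityI subsetI)
    fix I assume "I \<in> {I \<in> nonzero_ideals p. ideal_norm I \<le> X}"
    then obtain k a b where "valid k a b" "I = std_ideal k a b" "ideal_norm I \<le> X" unfolding nonzero_ideals_eq by auto
    then show "I \<in> (\<lambda>(k, a, b). std_ideal k a b) ` triples X"
      by (intro image_eqI[of _ _ "(k, a, b)"]) (auto simp: triples_def ideal_norm_std_ideal)
  qed (auto simp: triples_def ideal_norm_std_ideal nonzero_ideals_eq)
qed

text \<open>The triples are sorted by the norm m = k^2 a; given m and k, the remaining choice is a
  root b modulo m/k^2.\<close>

lemma card_triples: "finite (triples X)" "int (card (triples X)) = (\<Sum>m=1..X. r m)"
proof -
  define B where "B a = {b \<in> {0..<int a}. int a dvd root_poly q b}" for a :: nat
  have B: "finite (B a)" "card (B a) = root_count q a" for a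
    unfolding B_def root_count_def by (rule finite_subset[of _ "{0..<int a}"]) auto
  have fs: "finite (sqdiv m)" if "m > 0" for m
  proof (rule finite_subset)
    show "sqdiv m \<subseteq> {..m}"
    proof
      fix k assume "k \<in> sqdiv m"
      then have "k\<^sup>2 \<le> m" using that by (auto simp: sqdiv_def dest: dvd_imp_le)
      moreover have "k \<le> k\<^sup>2" by (simp add: power2_eq_square)
      ultimately show "k \<in> {..m}" by simp
    qed
  qed simp
  let ?T = "SIGMA m:{1..X}. SIGMA k:sqdiv m. B (m div k\<^sup>2)"
  have finT: "finite ?T" by (intro finite_SigmaI) (auto simp: fs B)
  have bij: "bij_betw (\<lambda>(m, k, b). (k, m div k\<^sup>2, b)) ?T (triples X)"
  proof (rule bij_betwI[of _ _ _ "\<lambda>(k, a, b). (k\<^sup>2 * a, k, b)"])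
    show "(\<lambda>(m, k, b). (k, m div k\<^sup>2, b)) \<in> ?T \<rightarrow> triples X"
    proof (intro funcsetI, clarify)
      fix m k b assume *: "m \<in> {1..X}" "k \<in> sqdiv m" "b \<in> B (m div k\<^sup>2)"
      then obtain a where a: "m = k\<^sup>2 * a" by (auto simp: sqdiv_def)
      have k0: "k > 0" "a > 0" using a * by (auto intro!: Nat.gr0I)
      then show "(k, m div k\<^sup>2, b) \<in> triples X" using * a by (auto simp: triples_def valid_def B_def)
    qed
    show "(\<lambda>(k, a, b). (k\<^sup>2 * a, k, b)) \<in> triples X \<rightarrow> ?T"
      by (auto simp: triples_def valid_def B_def sqdiv_def)
    show "(\<lambda>(k, a, b). (k\<^sup>2 * a, k, b)) ((\<lambda>(m, k, b). (k, m div k\<^sup>2, b)) w) = w" if "w \<in> ?T" for w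
      using that by (auto simp: sqdiv_def)
    show "(\<lambda>(m, k, b). (k, m div k\<^sup>2, b)) ((\<lambda>(k, a, b). (k\<^sup>2 * a, k, b)) w) = w" if "w \<in> triples X" for w
      using that by (auto simp: triples_def valid_def)
  qed
  show "finite (triples X)" using bij_betw_finite[OF bij] finT by simp
  have "card (triples X) = card ?T" using bij_betw_same_card[OF bij] by simp
  also have "\<dots> = (\<Sum>m=1..X. card (SIGMA k:sqdiv m. B (m div k\<^sup>2)))"
    by (rule card_SigmaI) (auto simp: fs B)
  also have "\<dots> = (\<Sum>m=1..X. ideal_count m)"
    unfolding ideal_count_def by (rule sum.cong[OF refl], subst card_SigmaI) (auto simp: fs B)
  finally have "int (card (triples X)) = (\<Sum>m=1..X. int (ideal_count m))" by simp
  also have "\<dots> = (\<Sum>m=1..X. r m)" by (rule sum.cong[OF refl], rule ideal_count_eq) auto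
  finally show "int (card (triples X)) = (\<Sum>m=1..X. r m)" .
qed

text \<open>The determinant of the pair and its conjugates. Up to sign it depends only on the
  lattice, so it measures norms without reference to a normal form.\<close>

definition disc :: "real \<Rightarrow> real \<Rightarrow> real" where "disc x y = x * cj y - y * cj x"

lemma disc_comb:
  assumes "x \<in> L" "y \<in> L"
  shows "disc (of_int s * x + of_int t * y) (of_int u * x + of_int v * y) = of_int (s * v - t * u) * disc x y"
proof -
  have "cj (of_int s * x + of_int t * y) = of_int s * cj x + of_int t * cj y" for s t
    using assms by (simp add: cj_add cj_mult L_mult)
  then show ?thesis unfolding disc_def by (simp add: algebra_simps)
qed

text \<open>Each base change multiplies \<open>disc\<close> by an integer, and the two integers are
  inverse to each other.\<close>

lemma disc_basis:
  assumes L: "e1 \<in> L" "e2 \<in> L" "f1 \<in> L" "f2 \<in> L"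
    and eq: "{of_int x * e1 + of_int y * e2 | x y. True} = {of_int x * f1 + of_int y * f2 | x y. True}"
    and nz: "disc e1 e2 \<noteq> 0"
  shows "\<bar>disc e1 e2\<bar> = \<bar>disc f1 f2\<bar>"
proof -
  have multiple: "\<exists>d::int. disc f1 f2 = of_int d * disc e1 e2"
    if L: "e1 \<in> L" "e2 \<in> L" and eq: "{of_int x * e1 + of_int y * e2 | x y. True} = {of_int x * f1 + of_int y * f2 | x y. True}"
    for e1 e2 f1 f2
  proof -
    have "f1 \<in> {of_int x * f1 + of_int y * f2 | x y. True}" "f2 \<in> {of_int x * f1 + of_int y * f2 | x y. True}"
      by (auto intro: exI[of _ 1] exI[of _ 0])
    then obtain s t u v where "f1 = of_int s * e1 + of_int t * e2" "f2 = of_int u * e1 + of_int v * e2"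
      unfolding eq[symmetric] by blast
    then show ?thesis using disc_comb[OF L] by blast
  qed
  obtain d where d: "disc f1 f2 = of_int d * disc e1 e2" using multiple[OF L(1,2) eq] by blast
  obtain d' where d': "disc e1 e2 = of_int d' * disc f1 f2" using multiple[OF L(3,4) eq[symmetric]] by blast
  have "disc e1 e2 = of_int (d' * d) * disc e1 e2" using d d' by (simp add: mult.assoc)
  then have "of_int (d' * d) = (of_int 1 :: real)" using nz by simp
  then have "d' * d = 1" by (simp only: of_int_eq_iff)
  then have "\<bar>d\<bar> = 1" by (metis abs_zmult_eq_1 mult.commute abs_1)
  then have "\<bar>of_int d :: real\<bar> = 1" by (metis of_int_1 of_int_abs)
  then show ?thesis using d by (simp add: abs_mult)
qed

end

section \<open>Lattice points in a hyperbolic sector\<close>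

text \<open>The mean value theorem on each step of length \<open>h\<close> traps the increment of
  the antiderivative between two consecutive terms of the Riemann sum.\<close>

lemma sum_antimono_integral_bounds:
  fixes g F :: "real \<Rightarrow> real"
  assumes F: "\<And>t. t \<ge> 0 \<Longrightarrow> (F has_real_derivative g t) (at t)"
    and g: "\<And>t u. 0 \<le> t \<Longrightarrow> t \<le> u \<Longrightarrow> g u \<le> g t" and h: "h > 0"
  shows "F (real (Suc K) * h) - F 0 \<le> h * (\<Sum>k\<le>K. g (real k * h))"
    and "h * (\<Sum>k\<le>K. g (real k * h)) \<le> h * g 0 + F (real K * h) - F 0"
proof -
  have step: "h * g (real (Suc k) * h) \<le> F (real (Suc k) * h) - F (real k * h)"
    "F (real (Suc k) * h) - F (real k * h) \<le> h * g (real k * h)" for k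
  proof -
    have k0: "real k * h \<ge> 0" using h by simp
    have lt: "real k * h < real (Suc k) * h" using h by (simp add: algebra_simps)
    obtain \<xi> where \<xi>: "real k * h < \<xi>" "\<xi> < real (Suc k) * h"
      "F (real (Suc k) * h) - F (real k * h) = (real (Suc k) * h - real k * h) * g \<xi>"
      using MVT2[OF lt, of F g] F k0 by (metis order_trans)
    moreover have "real (Suc k) * h - real k * h = h" by (simp add: algebra_simps)
    moreover have "g (real (Suc k) * h) \<le> g \<xi>" "g \<xi> \<le> g (real k * h)"
      by (rule g; use \<xi> k0 in linarith)+
    ultimately show "h * g (real (Suc k) * h) \<le> F (real (Suc k) * h) - F (real k * h)"
      "F (real (Suc k) * h) - F (real k * h) \<le> h * g (real k * h)"
      using h by auto
  qed
  show "F (real (Suc K) * h) - F 0 \<le> h * (\<Sum>k\<le>K. g (real k * h))"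
  proof (induction K)
    case 0 then show ?case using step(2)[of 0] by simp
  next
    case (Suc K) then show ?case using step(2)[of "Suc K"] by (simp add: distrib_left)
  qed
  show "h * (\<Sum>k\<le>K. g (real k * h)) \<le> h * g 0 + F (real K * h) - F 0"
  proof (induction K)
    case (Suc K) then show ?case using step(1)[of K] by (simp add: distrib_left)
  qed simp
qed

lemma card_int_interval:
  fixes u v :: real
  shows "{m :: int. u < of_int m \<and> of_int m \<le> v} = {\<lfloor>u\<rfloor><..\<lfloor>v\<rfloor>}"
    and "u \<le> v \<Longrightarrow> \<bar>real (card {m :: int. u < of_int m \<and> of_int m \<le> v}) - (v - u)\<bar> \<le> 1"
proof -
  show eq: "{m :: int. u < of_int m \<and> of_int m \<le> v} = {\<lfloor>u\<rfloor><..\<lfloor>v\<rfloor>}"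
    by (auto simp: floor_less_iff le_floor_iff)
  assume "u \<le> v"
  then have "\<lfloor>u\<rfloor> \<le> \<lfloor>v\<rfloor>" by (rule floor_mono)
  then show "\<bar>real (card {m :: int. u < of_int m \<and> of_int m \<le> v}) - (v - u)\<bar> \<le> 1"
    unfolding eq by (simp add: of_nat_diff) linarith
qed

text \<open>For fixed difference \<open>d = x - x'\<close>, the conditions \<open>0 < x'\<close>, \<open>x < E\<^sup>2 x'\<close> and \<open>x x' \<le> Y\<close> confine
  \<open>x\<close> to an interval of length \<open>\<surd>Y g(d/\<surd>Y)\<close>; the function \<open>F\<close> is an antiderivative of \<open>g\<close>, and \<open>g\<close>
  vanishes at \<open>E - 1/E\<close>.\<close>

locale hyperbolic_sector =
  fixes E :: real
  assumes E: "E > 1"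
begin

text \<open>With d = x - x', the condition x < E^2 x' reads d c < x.\<close>

definition c :: real where "c = E\<^sup>2 / (E\<^sup>2 - 1)"

definition g :: "real \<Rightarrow> real" where
  "g t = (t + sqrt (t\<^sup>2 + 4)) / 2 - t * c"

definition F :: "real \<Rightarrow> real" where
  "F t = t\<^sup>2 / 4 + t * sqrt (t\<^sup>2 + 4) / 4 + ln (t / 2 + sqrt (t\<^sup>2 + 4) / 2) - t\<^sup>2 / 2 * c"

text \<open>The value of x - x' where the ray x = E^2 x' meets the hyperbola x x' = 1, namely at x =
  E and x' = 1/E.\<close>

definition D :: real where "D = E - 1 / E"

lemma E2: "E\<^sup>2 - 1 > 0"
  using E by (simp add: one_less_power)

lemma D_pos: "D > 0"
  using E E2 by (simp add: D_def field_simps power2_eq_square)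

lemma sqrt_D: "sqrt (D\<^sup>2 + 4) = E + 1 / E"
proof -
  have "D\<^sup>2 + 4 = (E + 1 / E)\<^sup>2" using E by (simp add: D_def field_simps power2_eq_square)
  then show ?thesis using E by (simp add: real_sqrt_abs)
qed

lemma c_eq: "c = E / D"
  using E E2 by (simp add: c_def D_def field_simps power2_eq_square)

lemma c_ge_1: "1 \<le> c"
  using E2 by (simp add: c_def)

text \<open>The area of the normalised sector in the coordinates x and x - x'; this is the source of
  the regulator in the class number formula.\<close>

lemma F_D: "F D - F 0 = ln E"
proof -
  have "D / 2 + sqrt (D\<^sup>2 + 4) / 2 = E" unfolding sqrt_D by (simp add: D_def add_divide_distrib diff_divide_distrib)
  moreover have "D\<^sup>2 / 4 + D * sqrt (D\<^sup>2 + 4) / 4 - D\<^sup>2 / 2 * c = 0"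
    unfolding sqrt_D c_eq using D_pos by (simp add: field_simps power2_eq_square) (simp add: D_def field_simps)
  ultimately show ?thesis unfolding F_def by simp
qed

lemma F_deriv: "(F has_real_derivative g t) (at t)" if t: "t \<ge> 0"
proof -
  define Q where "Q u = sqrt (u\<^sup>2 + 4)" for u :: real
  define q where "q = Q t"
  have "t\<^sup>2 + 4 > 0" by (intro add_nonneg_pos) auto
  then have q: "q > 0" "q * q = t\<^sup>2 + 4" unfolding q_def Q_def by auto
  have pos: "t / 2 + Q t / 2 > 0" using q t unfolding q_def by (intro add_nonneg_pos) auto
  have Q: "(Q has_real_derivative t / q) (at t)"
  proof -
    have "((\<lambda>u. u\<^sup>2 + 4) has_real_derivative 2 * t) (at t)" by (auto intro!: derivative_eq_intros)
    from DERIV_chain2[OF DERIV_real_sqrt[OF \<open>t\<^sup>2 + 4 > 0\<close>] this]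
    show ?thesis unfolding Q_def q_def by (simp add: field_simps)
  qed
  have A1: "((\<lambda>u. u\<^sup>2 / 4) has_real_derivative t / 2) (at t)"
    by (auto intro!: derivative_eq_intros)
  have A2: "((\<lambda>u. u * Q u / 4) has_real_derivative (1 * Q t + (t / q) * t) / 4) (at t)"
    by (rule DERIV_cdivide[OF DERIV_mult[OF DERIV_ident Q]])
  have A3: "((\<lambda>u. ln (u / 2 + Q u / 2)) has_real_derivative 1 / (t / 2 + Q t / 2) * (1 / 2 + t / q / 2)) (at t)"
    by (rule DERIV_chain2[OF DERIV_ln_divide[OF pos] DERIV_add[OF DERIV_cdivide[OF DERIV_ident] DERIV_cdivide[OF Q]]])
  have A4: "((\<lambda>u. u\<^sup>2 / 2 * c) has_real_derivative t * c) (at t)"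
    by (auto intro!: derivative_eq_intros)
  have "F = (\<lambda>u. u\<^sup>2 / 4 + u * Q u / 4 + ln (u / 2 + Q u / 2) - u\<^sup>2 / 2 * c)"
    unfolding F_def Q_def ..
  then have "(F has_real_derivative t / 2 + (1 * Q t + (t / q) * t) / 4 +
      1 / (t / 2 + Q t / 2) * (1 / 2 + t / q / 2) - t * c) (at t)"
    using DERIV_diff[OF DERIV_add[OF DERIV_add[OF A1 A2] A3] A4] by simp
  also have "1 / 2 + t / q / 2 = (t / 2 + Q t / 2) / q" using q by (simp add: field_simps q_def[symmetric])
  also have "1 / (t / 2 + Q t / 2) * ((t / 2 + Q t / 2) / q) = 1 / q" using pos by simp
  also have "(t / q) * t = q - 4 / q" using q by (simp add: field_simps power2_eq_square)
  also have "t / 2 + (1 * Q t + (q - 4 / q)) / 4 + 1 / q - t * c = g t"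
    unfolding g_def Q_def[symmetric] q_def[symmetric] by (simp add: field_simps)
  finally show ?thesis .
qed

text \<open>The square root grows with slope at most 1, so the first summand of \<open>g\<close>
  does too, while the subtracted term has slope c, at least 1.\<close>

lemma g_antimono: "g u \<le> g t" if "0 \<le> t" "t \<le> u"
proof -
  have "sqrt (u\<^sup>2 + 4) \<le> sqrt (t\<^sup>2 + 4) + (u - t)"
  proof (rule real_le_lsqrt)
    have "t \<le> sqrt (t\<^sup>2 + 4)" by (rule real_le_rsqrt) simp
    then have "2 * t * (u - t) \<le> 2 * sqrt (t\<^sup>2 + 4) * (u - t)" using that by (intro mult_right_mono) auto
    then show "u\<^sup>2 + 4 \<le> (sqrt (t\<^sup>2 + 4) + (u - t))\<^sup>2"
      by (simp add: power2_sum algebra_simps power2_eq_square)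
  qed (use that in auto)
  moreover have "(u - t) * 1 \<le> (u - t) * c"
    using that c_ge_1 by (intro mult_left_mono) auto
  then have "u - t \<le> u * c - t * c" by (simp only: left_diff_distrib mult_1_right)
  ultimately show ?thesis unfolding g_def add_divide_distrib by argo
qed

lemma g_D: "g D = 0"
  unfolding g_def sqrt_D c_eq using D_pos by (simp add: D_def)

text \<open>The row k holds the lattice points with difference k s, spaced by \<open>a\<close>. The
  offset \<open>f\<close> of each row is arbitrary, since it does not influence the asymptotic
  count.\<close>

definition sector :: "real \<Rightarrow> real \<Rightarrow> (nat \<Rightarrow> real) \<Rightarrow> real \<Rightarrow> (nat \<times> int) set" where
  "sector a s f Y = {(k, m). let x = of_int m * a + f k; x' = x - real k * s in
      0 < x' \<and> x < E\<^sup>2 * x' \<and> x * x' \<le> Y}"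

lemma slice:
  assumes Y: "Y > 0" and d: "d \<ge> 0"
  shows "0 < x - d \<and> x < E\<^sup>2 * (x - d) \<and> x * (x - d) \<le> Y \<longleftrightarrow>
    d * c < x \<and> x \<le> (d + sqrt (d\<^sup>2 + 4 * Y)) / 2"
proof -
  have 1: "x < E\<^sup>2 * (x - d) \<longleftrightarrow> d * c < x"
    using E2 by (simp add: c_def field_simps)
  have "d * 1 \<le> d * c" using d c_ge_1 by (intro mult_left_mono) auto
  then have 2: "0 < x - d" if "d * c < x" using that by simp
  have 3: "x * (x - d) \<le> Y \<longleftrightarrow> x \<le> (d + sqrt (d\<^sup>2 + 4 * Y)) / 2" if "0 < x - d"
  proof -
    have "x * (x - d) \<le> Y \<longleftrightarrow> (2 * x - d)\<^sup>2 \<le> d\<^sup>2 + 4 * Y"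
    proof -
      have "(2 * x - d)\<^sup>2 = 4 * (x * (x - d)) + d\<^sup>2" by (simp add: power2_eq_square algebra_simps)
      then show ?thesis by linarith
    qed
    also have "\<dots> \<longleftrightarrow> sqrt ((2 * x - d)\<^sup>2) \<le> sqrt (d\<^sup>2 + 4 * Y)"
      by (rule real_sqrt_le_iff[symmetric])
    also have "sqrt ((2 * x - d)\<^sup>2) = 2 * x - d" using that d by simp
    finally show ?thesis by (simp add: algebra_simps)
  qed
  show ?thesis using 1 2 3 by blast
qed

text \<open>Each row is an interval containing its length divided by \<open>a\<close> many points,
  up to an error of 1. Rows beyond \<open>K\<close> are empty because \<open>g\<close> is
  nonpositive from \<open>D\<close> on.\<close>

lemma card_sector:
  assumes a: "a > 0" and s: "s > 0" and Y: "Y > 0"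
    and h_def: "h = s / sqrt Y" and K_def: "K = nat \<lfloor>D / h\<rfloor>"
  shows "finite (sector a s f Y)"
    and "\<bar>real (card (sector a s f Y)) - sqrt Y / a * (\<Sum>k\<le>K. g (real k * h))\<bar> \<le> real (Suc K)"
proof -
  have h: "h > 0" using s Y by (simp add: h_def)
  define lo where "lo k = (real k * s * c - f k) / a" for k
  define hi where "hi k = ((real k * s + sqrt ((real k * s)\<^sup>2 + 4 * Y)) / 2 - f k) / a" for k
  define M where "M k = {m :: int. lo k < of_int m \<and> of_int m \<le> hi k}" for k
  have sec: "sector a s f Y = (SIGMA k:UNIV. M k)"
  proof -
    have "(let x = of_int m * a + f k; x' = x - real k * s in 0 < x' \<and> x < E\<^sup>2 * x' \<and> x * x' \<le> Y) \<longleftrightarrow> m \<in> M k" for k m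
    proof -
      have "real k * s \<ge> 0" using s by simp
      moreover have "(u - f k) / a < of_int m \<longleftrightarrow> u < of_int m * a + f k"
        "of_int m \<le> (u - f k) / a \<longleftrightarrow> of_int m * a + f k \<le> u" for u
        using a by (simp_all add: pos_divide_less_eq pos_le_divide_eq diff_less_eq le_diff_eq)
      ultimately show ?thesis
        unfolding Let_def M_def lo_def hi_def mem_Collect_eq by (simp only: slice[OF Y])
    qed
    then show ?thesis unfolding sector_def by auto
  qed
  have len: "hi k - lo k = sqrt Y / a * g (real k * h)" for k
  proof -
    define t where "t = real k * h"
    have ks: "real k * s = sqrt Y * t" using Y by (simp add: h_def t_def)
    have "sqrt ((sqrt Y * t)\<^sup>2 + 4 * Y) = sqrt Y * sqrt (t\<^sup>2 + 4)" for t
    proof -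
      have "(sqrt Y * t)\<^sup>2 + 4 * Y = Y * (t\<^sup>2 + 4)" using Y by (simp add: power_mult_distrib algebra_simps)
      then show ?thesis by (simp add: real_sqrt_mult)
    qed
    then show ?thesis
    proof -
      have "(sqrt Y * t + sqrt Y * sqrt (t\<^sup>2 + 4)) / 2 - sqrt Y * t * c = sqrt Y * g t"
        unfolding g_def by (simp add: algebra_simps add_divide_distrib)
      moreover have "(u - f k) / a - (v - f k) / a = (u - v) / a" for u v
        by (simp add: diff_divide_distrib)
      ultimately show ?thesis
        unfolding lo_def hi_def t_def[symmetric] ks \<open>\<And>t. sqrt ((sqrt Y * t)\<^sup>2 + 4 * Y) = _\<close> by simp
    qed
  qed
  have le_K: "k \<le> K \<longleftrightarrow> real k * h \<le> D" for k
  proof -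
    have "0 \<le> \<lfloor>D / h\<rfloor>" using h D_pos by simp
    then have "k \<le> K \<longleftrightarrow> int k \<le> \<lfloor>D / h\<rfloor>" unfolding K_def by linarith
    also have "\<dots> \<longleftrightarrow> real k \<le> D / h" by (simp add: le_floor_iff)
    also have "\<dots> \<longleftrightarrow> real k * h \<le> D" using h by (rule pos_le_divide_eq)
    finally show ?thesis .
  qed
  have empty: "M k = {}" if "k > K" for k
  proof -
    have "D \<le> real k * h" using that le_K[of k] by simp
    then have "g (real k * h) \<le> 0" using g_antimono[of D] D_pos g_D by simp
    then have "sqrt Y / a * g (real k * h) \<le> 0" using a Y by (intro mult_nonneg_nonpos) auto
    then have "hi k \<le> lo k" using len[of k] by linarith
    then show ?thesis unfolding M_def by auto
  qed
  have sec': "sector a s f Y = (SIGMA k:{..K}. M k)"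
  proof -
    have "k \<le> K" if "m \<in> M k" for k m using that empty[of k] by (cases "k \<le> K") auto
    then show ?thesis unfolding sec by blast
  qed
  have fin: "finite (M k)" for k unfolding M_def card_int_interval(1) by simp
  show "finite (sector a s f Y)" unfolding sec' using fin by auto
  have "real (card (sector a s f Y)) = (\<Sum>k\<le>K. real (card (M k)))"
    unfolding sec' using fin by (simp add: card_SigmaI)
  then have "real (card (sector a s f Y)) - sqrt Y / a * (\<Sum>k\<le>K. g (real k * h)) =
      (\<Sum>k\<le>K. real (card (M k)) - (hi k - lo k))"
    unfolding len by (simp add: sum_subtractf sum_distrib_left)
  also have "\<bar>\<dots>\<bar> \<le> (\<Sum>k\<le>K. \<bar>real (card (M k)) - (hi k - lo k)\<bar>)" by (rule sum_abs)
  also have "\<dots> \<le> (\<Sum>k\<le>K. 1)"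
  proof (rule sum_mono)
    fix k assume "k \<in> {..K}"
    then have "real k * h \<le> D" using le_K by simp
    then have "g (real k * h) \<ge> 0" using g_antimono[of "real k * h" D] g_D h by simp
    then have "sqrt Y / a * g (real k * h) \<ge> 0" using a Y by simp
    then have "lo k \<le> hi k" using len[of k] by linarith
    then show "\<bar>real (card (M k)) - (hi k - lo k)\<bar> \<le> 1"
      unfolding M_def by (rule card_int_interval(2))
  qed
  finally show "\<bar>real (card (sector a s f Y)) - sqrt Y / a * (\<Sum>k\<le>K. g (real k * h))\<bar> \<le> real (Suc K)" by simp
qed

text \<open>The main term is a Riemann sum for \<open>g\<close> with step s/sqrt Y, hence tends to
  ln E after scaling; the error counts the rows, whose number is only of order sqrt Y.\<close>

lemma sector_asymp:
  assumes a: "a > 0" and s: "s > 0"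
  shows "((\<lambda>Y. real (card (sector a s f Y)) / Y) \<longlongrightarrow> ln E / (a * s)) at_top"
proof -
  define h where "h Y = s / sqrt Y" for Y
  define K where "K Y = nat \<lfloor>D / h Y\<rfloor>" for Y
  define \<Sigma> where "\<Sigma> Y = h Y * (\<Sum>k\<le>K Y. g (real k * h Y))" for Y
  have h0: "(h \<longlongrightarrow> 0) at_top"
    unfolding h_def by (intro tendsto_divide_0[OF tendsto_const] filterlim_at_top_imp_at_infinity sqrt_at_top)
  have hpos: "h Y > 0" if "Y > 0" for Y using that s by (simp add: h_def)
  have Kh: "real (K Y) * h Y \<le> D" "D \<le> real (Suc (K Y)) * h Y" if "Y > 0" for Y
  proof -
    have "real (K Y) \<le> D / h Y" "D / h Y \<le> real (Suc (K Y))"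
      unfolding K_def using hpos[OF that] D_pos by (auto simp: less_imp_le) linarith+
    then show "real (K Y) * h Y \<le> D" "D \<le> real (Suc (K Y)) * h Y"
      using hpos[OF that] by (simp_all add: field_simps)
  qed
  have K1: "((\<lambda>Y. real (K Y) * h Y) \<longlongrightarrow> D) at_top"
  proof (rule tendsto_sandwich[of "\<lambda>Y. D - h Y" _ _ "\<lambda>_. D"])
    show "\<forall>\<^sub>F Y in at_top. D - h Y \<le> real (K Y) * h Y"
      using eventually_gt_at_top[of 0] by eventually_elim (use Kh in \<open>auto simp: algebra_simps\<close>)
    show "\<forall>\<^sub>F Y in at_top. real (K Y) * h Y \<le> D"
      using eventually_gt_at_top[of 0] by eventually_elim (use Kh in auto)
    show "((\<lambda>Y. D - h Y) \<longlongrightarrow> D) at_top" using tendsto_diff[OF tendsto_const h0, of D] by simp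
  qed simp
  have K2: "((\<lambda>Y. real (Suc (K Y)) * h Y) \<longlongrightarrow> D) at_top"
    using tendsto_add[OF K1 h0] by (simp add: algebra_simps)
  have contF: "isCont F D" by (rule DERIV_isCont[OF F_deriv]) (use D_pos in simp)
  have \<Sigma>: "(\<Sigma> \<longlongrightarrow> ln E) at_top"
  proof (rule tendsto_sandwich)
    show "\<forall>\<^sub>F Y in at_top. F (real (Suc (K Y)) * h Y) - F 0 \<le> \<Sigma> Y"
      using eventually_gt_at_top[of 0]
      by eventually_elim (unfold \<Sigma>_def, rule sum_antimono_integral_bounds[OF F_deriv g_antimono hpos])
    show "\<forall>\<^sub>F Y in at_top. \<Sigma> Y \<le> h Y * g 0 + F (real (K Y) * h Y) - F 0"
      using eventually_gt_at_top[of 0]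
      by eventually_elim (unfold \<Sigma>_def, rule sum_antimono_integral_bounds[OF F_deriv g_antimono hpos])
    show "((\<lambda>Y. F (real (Suc (K Y)) * h Y) - F 0) \<longlongrightarrow> ln E) at_top"
      unfolding F_D[symmetric] by (intro tendsto_intros isCont_tendsto_compose[OF contF] K2)
    have "((\<lambda>Y. h Y * g 0 + F (real (K Y) * h Y) - F 0) \<longlongrightarrow> 0 * g 0 + F D - F 0) at_top"
      by (intro tendsto_intros isCont_tendsto_compose[OF contF] K1 h0)
    then show "((\<lambda>Y. h Y * g 0 + F (real (K Y) * h Y) - F 0) \<longlongrightarrow> ln E) at_top" by (simp add: F_D)
  qed
  have err: "((\<lambda>Y. real (Suc (K Y)) / Y) \<longlongrightarrow> 0) at_top"
  proof -
    have "((\<lambda>Y. (real (Suc (K Y)) * h Y) * h Y / s\<^sup>2) \<longlongrightarrow> D * 0 / s\<^sup>2) at_top"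
      using s by (intro tendsto_intros K2 h0) auto
    moreover have "\<forall>\<^sub>F Y in at_top. (real (Suc (K Y)) * h Y) * h Y / s\<^sup>2 = real (Suc (K Y)) / Y"
      using eventually_gt_at_top[of 0]
      by eventually_elim (use s in \<open>auto simp: h_def power2_eq_square real_sqrt_mult[symmetric] field_simps\<close>)
    ultimately show ?thesis using tendsto_cong by fastforce
  qed
  have "((\<lambda>Y. real (card (sector a s f Y)) / Y - \<Sigma> Y / (a * s)) \<longlongrightarrow> 0) at_top"
  proof (rule Lim_null_comparison[OF _ err])
    show "\<forall>\<^sub>F Y in at_top. norm (real (card (sector a s f Y)) / Y - \<Sigma> Y / (a * s)) \<le> real (Suc (K Y)) / Y"
      using eventually_gt_at_top[of 0]
    proof eventually_elim
      fix Y :: real assume Y: "Y > 0"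
      let ?S = "\<Sum>k\<le>K Y. g (real k * h Y)"
      have "\<Sigma> Y / (a * s) = (sqrt Y / a * ?S) / Y"
        unfolding \<Sigma>_def using a s Y by (simp add: h_def field_simps)
      then have "real (card (sector a s f Y)) / Y - \<Sigma> Y / (a * s) =
          (real (card (sector a s f Y)) - sqrt Y / a * ?S) / Y"
        by (simp add: diff_divide_distrib)
      then show "norm (real (card (sector a s f Y)) / Y - \<Sigma> Y / (a * s)) \<le> real (Suc (K Y)) / Y"
        using card_sector(2)[OF a s Y h_def K_def, of f] Y
        by (simp only: real_norm_def abs_divide) (simp add: divide_right_mono)
    qed
  qed
  moreover have "((\<lambda>Y. \<Sigma> Y / (a * s)) \<longlongrightarrow> ln E / (a * s)) at_top"
    using a s by (intro tendsto_intros \<Sigma>) auto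
  ultimately show ?thesis using tendsto_add by fastforce
qed

end

section \<open>The class number formula\<close>

text \<open>The class number formula is developed under this assumption alone; the determinants
  discharge it later, when \<open>real_gauss_sum\<close> becomes a sublocale.\<close>

locale negative_norm_unit = prime_1_mod_4 +
  assumes neg_unit: "\<exists>\<eta>. \<eta> \<in> L \<and> Nm \<eta> = - 1"
begin

definition \<epsilon> :: real where "\<epsilon> = fundamental_unit p"

lemma \<epsilon>_U: "\<epsilon> \<in> U" and \<epsilon>_gt_1: "\<epsilon> > 1" and Nm_\<epsilon>: "Nm \<epsilon> = - 1"
  and \<epsilon>_least: "u \<in> U \<Longrightarrow> u > 1 \<Longrightarrow> \<epsilon> \<le> u"
  using neg_unit fundamental_unit_properties unfolding \<epsilon>_def by blast+

lemma \<epsilon>_L: "\<epsilon> \<in> L"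
  by (rule U_L[OF \<epsilon>_U])

text \<open>If \<theta> > 1, then \<theta>/\<epsilon> is a unit in [1, \<epsilon>), hence 1; but
  \<epsilon> has norm -1 and \<theta> norm 1. The same applies to the inverse.\<close>

lemma unit_eq_1:
  assumes \<theta>: "\<theta> \<in> U" "Nm \<theta> = 1" "\<theta> > 0" "\<theta> < \<epsilon>\<^sup>2" "1 < \<epsilon>\<^sup>2 * \<theta>"
  shows "\<theta> = 1"
proof -
  have *: "\<not> \<theta> > 1" if \<theta>: "\<theta> \<in> U" "Nm \<theta> = 1" "\<theta> < \<epsilon>\<^sup>2" for \<theta>
  proof
    assume "\<theta> > 1"
    then have ge: "\<epsilon> \<le> \<theta>" using \<epsilon>_least \<theta> by blast
    have wU: "\<theta> * inverse \<epsilon> \<in> U" using \<theta> \<epsilon>_U by (intro U_mult U_inverse)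
    have "\<theta> * inverse \<epsilon> < \<epsilon>" using \<theta>(3) \<epsilon>_gt_1 by (simp add: field_simps power2_eq_square)
    then have "\<not> \<theta> * inverse \<epsilon> > 1" using \<epsilon>_least[OF wU] by linarith
    then have "\<theta> = \<epsilon>" using ge \<epsilon>_gt_1 by (simp add: field_simps)
    then show False using Nm_\<epsilon> \<theta> by simp
  qed
  have "\<not> \<theta> > 1" using * \<theta> by blast
  moreover have "\<not> inverse \<theta> > 1"
  proof (rule *)
    show "inverse \<theta> \<in> U" "Nm (inverse \<theta>) = 1" using U_inverse[OF \<theta>(1)] \<theta>(2) by simp_all
    show "inverse \<theta> < \<epsilon>\<^sup>2" using \<theta>(3,5) by (simp add: field_simps)
  qed
  ultimately show ?thesis using \<theta>(3) by (simp add: one_less_inverse_iff not_less)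
qed

text \<open>With \<open>I = \<int> a + \<int> (b + \<omega>)\<close>, the set \<open>\<Lambda> a b\<close> is \<open>a I\<^sup>-\<^sup>1\<close>: it consists of the \<open>\<mu>\<close> such that \<open>(\<mu>/a) I\<close>
  is an integral ideal. The ideals in the class of \<open>I\<close> thus correspond to the nonzero elements of this
  lattice up to units, and \<open>unit_domain a b\<close> contains one element of each such orbit.\<close>

definition \<Lambda> :: "nat \<Rightarrow> int \<Rightarrow> real set" where
  "\<Lambda> a b = {\<mu> \<in> L. \<exists>w\<in>L. \<mu> * (of_int b + \<omega>) = of_nat a * w}"

lemma \<Lambda>_L: "\<mu> \<in> \<Lambda> a b \<Longrightarrow> \<mu> \<in> L"
  by (simp add: \<Lambda>_def)

lemma \<Lambda>_mult: "\<mu> \<in> \<Lambda> a b \<Longrightarrow> t \<in> L \<Longrightarrow> t * \<mu> \<in> \<Lambda> a b"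
proof -
  assume \<mu>: "\<mu> \<in> \<Lambda> a b" and t: "t \<in> L"
  then obtain w where w: "w \<in> L" "\<mu> * (of_int b + \<omega>) = of_nat a * w" by (auto simp: \<Lambda>_def)
  have "t * \<mu> * (of_int b + \<omega>) = of_nat a * (t * w)" using w(2) by (simp add: mult.assoc mult.left_commute)
  then show ?thesis using \<mu> t w(1) L_mult unfolding \<Lambda>_def by blast
qed

lemma \<Lambda>_eq:
  assumes "int a dvd root_poly q b"
  shows "\<Lambda> a b = {el (x * int a - y * (b + 1)) y | x y. True}"
proof -
  obtain c where c: "b\<^sup>2 + b - q = int a * c" using assms by (auto simp: root_poly_def)
  have q: "q = b * b + b - int a * c" using c by (simp add: power2_eq_square)
  have bw: "of_int b + \<omega> = el b 1" by (simp add: el_def)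
  have aw: "of_nat a * el s t = el (int a * s) (int a * t)" for s t by (simp add: el_def algebra_simps)
  show ?thesis
  proof (intro equalityI subsetI)
    fix \<mu> assume \<mu>: "\<mu> \<in> \<Lambda> a b"
    obtain u v where uv: "\<mu> = el u v" using \<Lambda>_L[OF \<mu>] by (rule LE)
    obtain w where w: "w \<in> L" "el u v * el b 1 = of_nat a * w" using \<mu> unfolding \<Lambda>_def uv bw by blast
    obtain s t where "w = el s t" using w(1) by (rule LE)
    with w(2) have "el u v * el b 1 = of_nat a * el s t" by simp
    then have "u + b * v + v = int a * t" unfolding el_mult aw el_unique by simp
    then have "u = t * int a - v * (b + 1)" by (simp add: algebra_simps)
    then show "\<mu> \<in> {el (x * int a - y * (b + 1)) y | x y. True}" using uv by blast
  next
    fix \<mu> assume "\<mu> \<in> {el (x * int a - y * (b + 1)) y | x y. True}"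
    then obtain x y where \<mu>: "\<mu> = el (x * int a - y * (b + 1)) y" by blast
    have "\<mu> * el b 1 = el (int a * (x * b - y * c)) (int a * x)"
      unfolding \<mu> el_mult q by (simp add: algebra_simps)
    then show "\<mu> \<in> \<Lambda> a b" unfolding \<Lambda>_def bw using \<mu> aw by (auto intro!: bexI[of _ "el (x * b - y * c) x"])
  qed
qed

text \<open>Dividing by k as well cancels the content of the standard ideal, so this is (\<mu>/a) I
  for the primitive I = Z a + Z (b + \<omega>).\<close>

definition scaled_ideal :: "nat \<Rightarrow> nat \<Rightarrow> int \<Rightarrow> real \<Rightarrow> real set" where
  "scaled_ideal k a b \<mu> = (\<lambda>s. \<mu> * s / (of_nat k * of_nat a)) ` std_ideal k a b"

lemma scaled_ideal_lattice:
  assumes v: "valid k a b" and w: "\<mu> * (of_int b + \<omega>) = of_nat a * w"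
  shows "scaled_ideal k a b \<mu> = {of_int x * \<mu> + of_int y * w | x y. True}"
proof -
  have ka: "real k > 0" "real a > 0" using v by (auto simp: valid_def)
  have "\<mu> * el (int k * (x * int a + y * b)) (int k * y) / (of_nat k * of_nat a) = of_int x * \<mu> + of_int y * w" for x y
  proof -
    have "\<mu> * el (int k * (x * int a + y * b)) (int k * y) =
        of_nat k * (of_int x * of_nat a * \<mu> + of_int y * (\<mu> * (of_int b + \<omega>)))"
      by (simp add: el_def algebra_simps)
    also have "\<dots> = of_nat k * of_nat a * (of_int x * \<mu> + of_int y * w)"
      unfolding w by (simp add: algebra_simps)
    finally show ?thesis using ka by simp
  qed
  then show ?thesis unfolding scaled_ideal_def std_ideal_def by (auto simp: image_iff) metis+
qed

lemma scaled_ideal_scale: "scaled_ideal k a b (t * \<mu>) = (*) t ` scaled_ideal k a b \<mu>"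
  unfolding scaled_ideal_def image_image by (simp add: mult.assoc)

lemma ideal_mult:
  assumes I: "ideal I QR" "s \<in> I" "t \<in> L"
  shows "t * s \<in> I"
  using assms unfolding ideal_iff by blast

lemma scaled_ideal_ideal:
  assumes v: "valid k a b" and \<mu>: "\<mu> \<in> \<Lambda> a b"
  shows "ideal (scaled_ideal k a b \<mu>) QR"
proof -
  obtain w where w: "w \<in> L" "\<mu> * (of_int b + \<omega>) = of_nat a * w" using \<mu> by (auto simp: \<Lambda>_def)
  note lat = scaled_ideal_lattice[OF v w(2)]
  have I: "ideal (std_ideal k a b) QR" using v std_ideal_ideal by (simp add: valid_def)
  show ?thesis unfolding ideal_iff
  proof (intro conjI ballI)
    show "scaled_ideal k a b \<mu> \<subseteq> L"
      unfolding lat using w(1) \<Lambda>_L[OF \<mu>] by (auto intro!: L_add L_mult)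
    show "0 \<in> scaled_ideal k a b \<mu>" unfolding lat by (auto intro!: exI[of _ 0])
    fix s t assume "s \<in> scaled_ideal k a b \<mu>" "t \<in> scaled_ideal k a b \<mu>"
    then obtain x y x' y' where "s = of_int x * \<mu> + of_int y * w" "t = of_int x' * \<mu> + of_int y' * w"
      unfolding lat by blast
    then have "s + t = of_int (x + x') * \<mu> + of_int (y + y') * w" by (simp add: algebra_simps)
    then show "s + t \<in> scaled_ideal k a b \<mu>" unfolding lat by blast
  next
    fix s t assume s: "s \<in> scaled_ideal k a b \<mu>" and t: "t \<in> L"
    then obtain i where i: "i \<in> std_ideal k a b" "s = \<mu> * i / (of_nat k * of_nat a)" unfolding scaled_ideal_def by blast
    have "t * i \<in> std_ideal k a b" by (rule ideal_mult[OF I i(1) t])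
    moreover have "t * s = \<mu> * (t * i) / (of_nat k * of_nat a)" unfolding i(2) by simp
    ultimately show "t * s \<in> scaled_ideal k a b \<mu>" unfolding scaled_ideal_def by blast
  qed
qed

lemma scaled_ideal_mem: assumes "valid k a b" shows "\<mu> \<in> scaled_ideal k a b \<mu>"
proof -
  have "el (int k * int a) 0 \<in> std_ideal k a b" unfolding el_in_std_ideal by (intro exI[of _ 1] exI[of _ 0]) simp
  moreover have "\<mu> * el (int k * int a) 0 / (of_nat k * of_nat a) = \<mu>" using assms by (simp add: el_def valid_def)
  ultimately show ?thesis unfolding scaled_ideal_def by (metis image_eqI)
qed

lemma scaled_ideal_nonzero:
  assumes v: "valid k a b" and \<mu>: "\<mu> \<in> \<Lambda> a b" "\<mu> \<noteq> 0"
  shows "scaled_ideal k a b \<mu> \<in> nonzero_ideals p"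
  unfolding nonzero_ideals_def using scaled_ideal_ideal[OF v \<mu>(1)] scaled_ideal_mem[OF v, of \<mu>] \<mu>(2) by auto

text \<open>An equality \<alpha> J = \<beta> A means that A is the multiple of J by
  \<alpha>/\<beta>, and \<mu> is this quotient times k a. Membership of \<mu> in the lattice holds
  because \<mu> and w, the images of the basis, lie in the integral ideal A.\<close>

lemma class_rel_iff:
  assumes v: "valid k a b"
  shows "(std_ideal k a b, A) \<in> ideal_class_rel p \<longleftrightarrow> (\<exists>\<mu>\<in>\<Lambda> a b. \<mu> \<noteq> 0 \<and> A = scaled_ideal k a b \<mu>)"
proof
  have ka: "real k * real a \<noteq> 0" using v by (auto simp: valid_def)
  assume "(std_ideal k a b, A) \<in> ideal_class_rel p"
  then obtain \<alpha> \<beta> where ab: "\<alpha> \<in> L" "\<alpha> \<noteq> 0" "\<beta> \<in> L" "\<beta> \<noteq> 0" "(*) \<alpha> ` std_ideal k a b = (*) \<beta> ` A"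
    and A: "ideal A QR"
    unfolding ideal_class_rel_def nonzero_ideals_def carrier_eq_L by blast
  define \<mu> where "\<mu> = \<alpha> * (of_nat k * of_nat a) / \<beta>"
  have "scaled_ideal k a b \<mu> = (\<lambda>s. s / \<beta>) ` ((*) \<alpha> ` std_ideal k a b)"
    unfolding scaled_ideal_def \<mu>_def image_image using ka by simp
  also have "\<dots> = A" unfolding ab(5) image_image using ab(4) by simp
  finally have JA: "scaled_ideal k a b \<mu> = A" .
  have AL: "A \<subseteq> L" using A unfolding ideal_iff by blast
  have "\<mu> \<in> L" using scaled_ideal_mem[OF v, of \<mu>] JA AL by blast
  define w where "w = \<mu> * (of_int b + \<omega>) / of_nat a"
  have w: "\<mu> * (of_int b + \<omega>) = of_nat a * w" using v by (simp add: w_def valid_def)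
  have "of_int 0 * \<mu> + of_int 1 * w \<in> scaled_ideal k a b \<mu>" unfolding scaled_ideal_lattice[OF v w] by blast
  then have "w \<in> L" using JA AL by auto
  then have "\<mu> \<in> \<Lambda> a b" using \<open>\<mu> \<in> L\<close> w by (auto simp: \<Lambda>_def)
  moreover have "\<mu> \<noteq> 0" using ab ka by (auto simp: \<mu>_def)
  ultimately show "\<exists>\<mu>\<in>\<Lambda> a b. \<mu> \<noteq> 0 \<and> A = scaled_ideal k a b \<mu>" using JA by blast
next
  have ka: "real k * real a \<noteq> 0" using v by (auto simp: valid_def)
  assume "\<exists>\<mu>\<in>\<Lambda> a b. \<mu> \<noteq> 0 \<and> A = scaled_ideal k a b \<mu>"
  then obtain \<mu> where \<mu>: "\<mu> \<in> \<Lambda> a b" "\<mu> \<noteq> 0" "A = scaled_ideal k a b \<mu>" by blast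
  have "(*) \<mu> ` std_ideal k a b = (*) (real k * real a) ` A"
    unfolding \<mu>(3) scaled_ideal_def image_image using ka by simp
  moreover have "real k * real a \<in> L" by (intro L_mult L_of_nat)
  moreover have "std_ideal k a b \<in> nonzero_ideals p" using v nonzero_ideals_eq by blast
  ultimately show "(std_ideal k a b, A) \<in> ideal_class_rel p"
    unfolding ideal_class_rel_def carrier_eq_L
    using scaled_ideal_nonzero[OF v \<mu>(1,2)] \<Lambda>_L[OF \<mu>(1)] \<mu>(2,3) ka by blast
qed

text \<open>The ideal has the basis \<mu>, w and also the basis of its normal form.
  \<open>disc\<close> of the former is the norm of \<mu> over a, of the latter the ideal norm, each
  times sqrt p up to sign.\<close>

lemma ideal_norm_scaled_ideal:
  assumes v: "valid k a b" and \<mu>: "\<mu> \<in> \<Lambda> a b" "\<mu> \<noteq> 0"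
  shows "real (ideal_norm (scaled_ideal k a b \<mu>)) = \<bar>Nm \<mu>\<bar> / real a"
proof -
  obtain w where w: "w \<in> L" "\<mu> * (of_int b + \<omega>) = of_nat a * w" using \<mu> by (auto simp: \<Lambda>_def)
  have a: "real a > 0" using v by (simp add: valid_def)
  obtain k' a' b' where I: "valid k' a' b'" "scaled_ideal k a b \<mu> = std_ideal k' a' b'"
    using scaled_ideal_nonzero[OF v \<mu>] unfolding nonzero_ideals_eq by blast
  have \<mu>L: "\<mu> \<in> L" by (rule \<Lambda>_L[OF \<mu>(1)])
  have dsq: "1 - 2 * \<omega> = - sq" by (simp add: \<omega>_def field_simps)
  have acj: "of_nat a * cj w = cj \<mu> * (of_int b + (1 - \<omega>))"
  proof -
    have "cj (of_nat a * w) = of_nat a * cj w" using cj_mult[of "of_int (int a)" w] w(1) cj_of_int[of "int a"] by simp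
    moreover have "cj (\<mu> * (of_int b + \<omega>)) = cj \<mu> * (of_int b + (1 - \<omega>))"
      using \<mu>L by (simp add: cj_mult cj_add L_add cj_\<omega>)
    ultimately show ?thesis using w(2) by simp
  qed
  have "of_nat a * disc \<mu> w = \<mu> * (of_nat a * cj w) - (of_nat a * w) * cj \<mu>"
    by (simp add: disc_def algebra_simps)
  also have "\<dots> = \<mu> * (cj \<mu> * (of_int b + (1 - \<omega>))) - (\<mu> * (of_int b + \<omega>)) * cj \<mu>"
    unfolding acj w(2) ..
  also have "\<dots> = Nm \<mu> * (1 - 2 * \<omega>)" by (simp add: Nm_def algebra_simps)
  finally have d1: "disc \<mu> w = - (Nm \<mu> * sq / of_nat a)" unfolding dsq using a by (simp add: field_simps)
  let ?f1 = "el (int k' * int a') 0" and ?f2 = "el (int k' * b') (int k')"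
  have "?f1 = of_nat k' * of_nat a'" "cj ?f1 = of_nat k' * of_nat a'"
    "cj ?f2 = of_nat k' * (of_int b' + (1 - \<omega>))" "?f2 = of_nat k' * (of_int b' + \<omega>)"
    unfolding cj_el by (simp_all add: el_def algebra_simps)
  then have "disc ?f1 ?f2 = of_nat k' * of_nat a' * (of_nat k' * (of_int b' + (1 - \<omega>))) -
      of_nat k' * (of_int b' + \<omega>) * (of_nat k' * of_nat a')"
    unfolding disc_def by (simp only:)
  also have "\<dots> = of_nat (k'\<^sup>2 * a') * (1 - 2 * \<omega>)"
    by (simp add: algebra_simps power2_eq_square)
  finally have "disc ?f1 ?f2 = of_nat (k'\<^sup>2 * a') * (1 - 2 * \<omega>)" .
  then have d2: "disc ?f1 ?f2 = - (of_nat (k'\<^sup>2 * a') * sq)" unfolding dsq by simp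
  have "std_ideal k' a' b' = {of_int x * ?f1 + of_int y * ?f2 | x y. True}"
  proof -
    have "el (int k' * (x * int a' + y * b')) (int k' * y) = of_int x * ?f1 + of_int y * ?f2" for x y
      by (simp add: el_def algebra_simps)
    then show ?thesis unfolding std_ideal_def by simp
  qed
  then have eq: "{of_int x * \<mu> + of_int y * w | x y. True} = {of_int x * ?f1 + of_int y * ?f2 | x y. True}"
    using I(2) scaled_ideal_lattice[OF v w(2)] by simp
  have "disc \<mu> w \<noteq> 0" unfolding d1 using a Nm_eq_0[OF \<mu>L] \<mu>(2) sq(2) by simp
  then have "\<bar>disc \<mu> w\<bar> = \<bar>disc ?f1 ?f2\<bar>"
    by (intro disc_basis[OF \<mu>L w(1) elI elI eq])
  then have "\<bar>Nm \<mu>\<bar> * sq / of_nat a = of_nat (k'\<^sup>2 * a') * sq"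
    unfolding d1 d2 using sq(2) by (simp only: abs_minus_cancel abs_mult abs_divide abs_of_nat abs_of_pos)
  then have "\<bar>Nm \<mu>\<bar> / of_nat a * sq = of_nat (k'\<^sup>2 * a') * sq" by simp
  then show ?thesis unfolding I(2) ideal_norm_std_ideal[OF I(1)] using sq(2) by (metis mult_right_cancel less_irrefl)
qed

text \<open>Multiplication by the quotient maps a lattice of rank two into itself, so the quotient
  is a root of the characteristic polynomial of an integer matrix. Being an algebraic integer of the
  field, it lies in \<open>L\<close>.\<close>

lemma scaled_ideal_stabiliser:
  assumes v: "valid k a b" and \<mu>: "\<mu> \<in> \<Lambda> a b" "\<mu> \<noteq> 0" and \<nu>: "\<nu> \<in> L"
    and eq: "scaled_ideal k a b \<nu> = scaled_ideal k a b \<mu>"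
  shows "\<nu> / \<mu> \<in> L"
proof -
  define \<theta> where "\<theta> = \<nu> / \<mu>"
  have \<nu>\<theta>: "\<nu> = \<theta> * \<mu>" using \<mu> by (simp add: \<theta>_def)
  obtain w where w: "w \<in> L" "\<mu> * (of_int b + \<omega>) = of_nat a * w" using \<mu> by (auto simp: \<Lambda>_def)
  note lat = scaled_ideal_lattice[OF v w(2)]
  have st: "\<theta> * s \<in> scaled_ideal k a b \<mu>" if "s \<in> scaled_ideal k a b \<mu>" for s
    using that eq unfolding \<nu>\<theta> scaled_ideal_scale by blast
  have "\<mu> \<in> scaled_ideal k a b \<mu>" by (rule scaled_ideal_mem[OF v])
  from st[OF this] obtain x y where 1: "\<theta> * \<mu> = of_int x * \<mu> + of_int y * w" unfolding lat by blast
  have "of_int 0 * \<mu> + of_int 1 * w \<in> scaled_ideal k a b \<mu>" unfolding lat by blast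
  then have "w \<in> scaled_ideal k a b \<mu>" by simp
  from st[OF this] obtain x' y' where 2: "\<theta> * w = of_int x' * \<mu> + of_int y' * w" unfolding lat by blast
  have "((\<theta> - of_int x) * (\<theta> - of_int y') - of_int (y * x')) * \<mu> = 0"
  proof -
    have "(\<theta> - of_int x) * \<mu> = of_int y * w" using 1 by (simp add: algebra_simps)
    moreover have "(\<theta> - of_int y') * w = of_int x' * \<mu>" using 2 by (simp add: algebra_simps)
    ultimately have "(\<theta> - of_int y') * ((\<theta> - of_int x) * \<mu>) = of_int y * (of_int x' * \<mu>)" by (metis mult.left_commute)
    then show ?thesis by (simp add: algebra_simps)
  qed
  then have "(\<theta> - of_int x) * (\<theta> - of_int y') - of_int (y * x') = 0" using \<mu>(2) by (simp only: mult_eq_0_iff) blast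
  then have "\<theta> * \<theta> = of_int (x + y') * \<theta> + of_int (y * x' - x * y')" by (simp add: algebra_simps)
  then have alg: "algebraic_int \<theta>" by (rule algebraic_int_quadratic)
  have \<mu>L: "\<mu> \<in> L" by (rule \<Lambda>_L[OF \<mu>(1)])
  obtain m where m: "Nm \<mu> = of_int m" using Nm_int[OF \<mu>L] by blast
  have m0: "m \<noteq> 0" using m Nm_eq_0[OF \<mu>L] \<mu>(2) by auto
  have "of_int m * \<theta> = \<nu> * cj \<mu>" unfolding m[symmetric] Nm_def \<theta>_def using \<mu>(2) by simp
  then have "of_int m * \<theta> \<in> L" using \<nu> cj_in_L[OF \<mu>L] L_mult by simp
  then have "of_int (sgn m) * (of_int m * \<theta>) \<in> L" by (rule L_mult[OF L_of_int])
  moreover have "of_int (sgn m) * (of_int m * \<theta>) = of_int \<bar>m\<bar> * \<theta>" by (simp add: sgn_if abs_if)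
  ultimately have "of_int \<bar>m\<bar> * \<theta> \<in> L" by (simp only:)
  moreover have "\<bar>m\<bar> > 0" using m0 by simp
  ultimately have "\<theta> \<in> quad_field p" unfolding quad_field_alt by blast
  then have "\<theta> \<in> carrier QR" using alg by (simp add: quad_int_ring_def)
  then show ?thesis unfolding carrier_eq_L \<theta>_def .
qed

lemma scaled_ideal_eq_imp_unit:
  assumes v: "valid k a b" and \<mu>: "\<mu> \<in> \<Lambda> a b" "\<mu> \<noteq> 0" and \<nu>: "\<nu> \<in> \<Lambda> a b" "\<nu> \<noteq> 0"
    and eq: "scaled_ideal k a b \<nu> = scaled_ideal k a b \<mu>"
  shows "\<exists>\<theta>\<in>U. \<nu> = \<theta> * \<mu>"
proof -
  have "\<nu> / \<mu> \<in> L" by (rule scaled_ideal_stabiliser[OF v \<mu> \<Lambda>_L[OF \<nu>(1)] eq])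
  moreover have "\<mu> / \<nu> \<in> L" by (rule scaled_ideal_stabiliser[OF v \<nu> \<Lambda>_L[OF \<mu>(1)] eq[symmetric]])
  moreover have "\<nu> / \<mu> * (\<mu> / \<nu>) = 1" using \<mu>(2) \<nu>(2) by simp
  moreover have "\<mu> / \<nu> * (\<nu> / \<mu>) = 1" using \<mu>(2) \<nu>(2) by simp
  ultimately have "\<nu> / \<mu> \<in> Units QR" unfolding Units_def QR_simps by blast
  then have "\<nu> / \<mu> \<in> U" by (simp add: Units_QR)
  then show ?thesis using \<mu>(2) by (intro bexI[of _ "\<nu> / \<mu>"]) auto
qed

lemma scaled_ideal_unit:
  assumes v: "valid k a b" and \<mu>: "\<mu> \<in> \<Lambda> a b" and \<theta>: "\<theta> \<in> U"
  shows "scaled_ideal k a b (\<theta> * \<mu>) = scaled_ideal k a b \<mu>"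
  unfolding scaled_ideal_scale
proof (intro equalityI subsetI)
  note I = scaled_ideal_ideal[OF v \<mu>]
  fix s
  show "s \<in> scaled_ideal k a b \<mu>" if "s \<in> (*) \<theta> ` scaled_ideal k a b \<mu>"
    using that ideal_mult[OF I _ U_L[OF \<theta>]] by auto
  assume "s \<in> scaled_ideal k a b \<mu>"
  then have "inverse \<theta> * s \<in> scaled_ideal k a b \<mu>" using ideal_mult[OF I _ U_L[OF U_inverse(1)[OF \<theta>]]] by blast
  moreover have "s = \<theta> * (inverse \<theta> * s)" using U_nonzero[OF \<theta>] by simp
  ultimately show "s \<in> (*) \<theta> ` scaled_ideal k a b \<mu>" by blast
qed

section \<open>A fundamental domain for the units, and the count of one ideal class\<close>

definition unit_domain :: "nat \<Rightarrow> int \<Rightarrow> real set" where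
  "unit_domain a b = {\<mu> \<in> \<Lambda> a b. 0 < cj \<mu> \<and> cj \<mu> \<le> \<mu> \<and> \<mu> < (\<epsilon>\<^sup>2)\<^sup>2 * cj \<mu>}"

text \<open>Both conjugates of \<theta> are positive, so its norm is 1 and it changes the ratio of
  an element to its conjugate by its square. Both ratios lie in [1, \<epsilon>^4), which confines
  \<theta> strictly between \<epsilon>^(-2) and \<epsilon>^2.\<close>

lemma unit_domain_unique:
  assumes \<mu>: "\<mu> \<in> unit_domain a b" and \<nu>: "\<nu> \<in> unit_domain a b" and \<theta>: "\<theta> \<in> U" "\<nu> = \<theta> * \<mu>"
  shows "\<nu> = \<mu>"
proof -
  have m: "0 < cj \<mu>" "cj \<mu> \<le> \<mu>" "\<mu> < (\<epsilon>\<^sup>2)\<^sup>2 * cj \<mu>" "\<mu> \<in> L"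
    and n: "0 < cj \<nu>" "cj \<nu> \<le> \<nu>" "\<nu> < (\<epsilon>\<^sup>2)\<^sup>2 * cj \<nu>"
    using \<mu> \<nu> \<Lambda>_L by (auto simp: unit_domain_def)
  have cj\<nu>: "cj \<nu> = cj \<theta> * cj \<mu>" unfolding \<theta>(2) by (rule cj_mult[OF U_L[OF \<theta>(1)] m(4)])
  have "0 < \<mu>" "0 < \<theta> * \<mu>" "0 < cj \<theta> * cj \<mu>" using m(1,2) n(1,2) unfolding \<theta>(2)[symmetric] cj\<nu>[symmetric] by linarith+
  then have pos: "\<theta> > 0" "cj \<theta> > 0" using m(1) by (simp_all add: zero_less_mult_iff)
  have N1: "Nm \<theta> = 1" using \<theta>(1) pos by (simp add: U_def Nm_def)
  then have cj\<theta>: "cj \<theta> = 1 / \<theta>" using pos by (simp add: Nm_def field_simps)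
  have E: "\<epsilon>\<^sup>2 > 0" using \<epsilon>_gt_1 by simp
  have "\<theta> * \<mu> < (\<epsilon>\<^sup>2)\<^sup>2 * (cj \<mu> / \<theta>)" using n(3) \<theta>(2) cj\<nu> cj\<theta> by simp
  then have "\<theta>\<^sup>2 * \<mu> < (\<epsilon>\<^sup>2)\<^sup>2 * cj \<mu>" using pos by (simp add: field_simps power2_eq_square)
  also have "\<dots> \<le> (\<epsilon>\<^sup>2)\<^sup>2 * \<mu>" using m(2) by (intro mult_left_mono) auto
  finally have "\<theta>\<^sup>2 < (\<epsilon>\<^sup>2)\<^sup>2" using m by simp
  then have 1: "\<theta> < \<epsilon>\<^sup>2" using E by (rule power_less_imp_less_base[OF _ less_imp_le])
  have "cj \<mu> / \<theta> \<le> \<theta> * \<mu>" using n(2) \<theta>(2) cj\<nu> cj\<theta> by simp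
  then have "cj \<mu> \<le> \<theta>\<^sup>2 * \<mu>" using pos by (simp add: field_simps power2_eq_square)
  also have "\<dots> < \<theta>\<^sup>2 * ((\<epsilon>\<^sup>2)\<^sup>2 * cj \<mu>)" using m(3) pos by (intro mult_strict_left_mono) auto
  finally have "1 * cj \<mu> < (\<epsilon>\<^sup>2 * \<theta>)\<^sup>2 * cj \<mu>" by (simp add: power_mult_distrib mult.assoc mult.left_commute)
  then have "1\<^sup>2 < (\<epsilon>\<^sup>2 * \<theta>)\<^sup>2" using m(1) by simp
  then have 2: "1 < \<epsilon>\<^sup>2 * \<theta>" by (rule power_less_imp_less_base) (use pos E in simp)
  have "\<theta> = 1" by (rule unit_eq_1[OF \<theta>(1) N1 pos(1) 1 2])
  then show ?thesis using \<theta>(2) by simp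
qed

text \<open>A factor \<epsilon>, of norm -1, makes the norm positive; a factor -1 then makes both
  conjugates positive; a power of \<epsilon>^2 finally moves the ratio of the conjugates into the
  required interval.\<close>

lemma unit_domain_exists:
  assumes \<mu>: "\<mu> \<in> \<Lambda> a b" "\<mu> \<noteq> 0"
  shows "\<exists>\<theta>\<in>U. \<theta> * \<mu> \<in> unit_domain a b"
proof -
  have \<mu>L: "\<mu> \<in> L" by (rule \<Lambda>_L[OF \<mu>(1)])
  obtain \<theta>1 where \<theta>1: "\<theta>1 \<in> U" "Nm (\<theta>1 * \<mu>) > 0"
  proof (cases "Nm \<mu> > 0")
    case True then show ?thesis using that[of 1] U_1 by simp
  next
    case False
    then have "Nm (\<epsilon> * \<mu>) > 0" using Nm_eq_0[OF \<mu>L] \<mu>(2) by (simp add: Nm_mult[OF \<epsilon>_L \<mu>L] Nm_\<epsilon>)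
    then show ?thesis using that \<epsilon>_U by blast
  qed
  define \<mu>1 where "\<mu>1 = \<theta>1 * \<mu>"
  have \<mu>1: "\<mu>1 \<in> L" "Nm \<mu>1 > 0" using \<theta>1 \<mu>L L_mult U_L by (auto simp: \<mu>1_def)
  obtain \<theta>2 where \<theta>2: "\<theta>2 \<in> U" "\<theta>2 * \<mu>1 > 0" "cj (\<theta>2 * \<mu>1) > 0"
  proof (cases "\<mu>1 > 0")
    case True then show ?thesis using that[of 1] U_1 \<mu>1 by (simp add: Nm_def zero_less_mult_iff)
  next
    case False
    then have "- 1 * \<mu>1 > 0" "cj (- 1 * \<mu>1) > 0"
      using \<mu>1 by (auto simp: Nm_def zero_less_mult_iff cj_uminus)
    then show ?thesis using that U_uminus[OF U_1] by blast
  qed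
  define \<mu>2 where "\<mu>2 = \<theta>2 * \<mu>1"
  have \<mu>2: "\<mu>2 \<in> L" "\<mu>2 > 0" "cj \<mu>2 > 0" using \<theta>2 \<mu>1 L_mult U_L by (auto simp: \<mu>2_def)
  \<comment> \<open>Multiplication by \<epsilon>^2, of norm 1, multiplies the ratio of an element to
    its conjugate by this number; the floor of a logarithm to base \<open>E\<close> gives the power
    needed.\<close>
  define E where "E = (\<epsilon>\<^sup>2)\<^sup>2"
  have E: "E > 1" unfolding E_def using \<epsilon>_gt_1 by (simp add: one_less_power)
  define j where "j = - \<lfloor>log E (\<mu>2 / cj \<mu>2)\<rfloor>"
  define \<theta>3 where "\<theta>3 = \<epsilon>\<^sup>2 powi j"
  have e2: "\<epsilon>\<^sup>2 \<in> U" "Nm (\<epsilon>\<^sup>2) = 1" using \<epsilon>_U U_power by (auto simp: Nm_power \<epsilon>_L Nm_\<epsilon>)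
  have \<theta>3: "\<theta>3 \<in> U" "Nm \<theta>3 = 1" "\<theta>3 > 0"
    unfolding \<theta>3_def using e2 \<epsilon>_gt_1 by (auto simp: U_powi Nm_powi_1)
  have cj3: "cj \<theta>3 = 1 / \<theta>3" using \<theta>3 by (simp add: Nm_def field_simps)
  have sq3: "\<theta>3\<^sup>2 = E powi j" unfolding \<theta>3_def E_def by (simp add: power2_eq_square power_int_mult_distrib)
  have pj: "E powi j = E powr (- of_int \<lfloor>log E (\<mu>2 / cj \<mu>2)\<rfloor>)" using E by (simp add: powr_real_of_int'[symmetric] j_def)
  define x where "x = log E (\<mu>2 / cj \<mu>2)"
  have ratio: "\<mu>2 / cj \<mu>2 = E powr x" using E \<mu>2 by (simp add: x_def)
  have prod: "\<theta>3\<^sup>2 * (\<mu>2 / cj \<mu>2) = E powr (x - of_int \<lfloor>x\<rfloor>)"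
    unfolding sq3 pj x_def[symmetric] unfolding ratio by (simp add: powr_add[symmetric])
  have "E powr 0 \<le> E powr (x - of_int \<lfloor>x\<rfloor>)" using E by (intro powr_mono) auto
  then have ge: "1 \<le> \<theta>3\<^sup>2 * (\<mu>2 / cj \<mu>2)" unfolding prod using E by simp
  have "E powr (x - of_int \<lfloor>x\<rfloor>) < E powr 1" using E by (intro powr_less_mono) linarith+
  then have lt: "\<theta>3\<^sup>2 * (\<mu>2 / cj \<mu>2) < E" unfolding prod using E by simp
  have cj\<mu>3: "cj (\<theta>3 * \<mu>2) = cj \<mu>2 / \<theta>3" using cj_mult[OF U_L[OF \<theta>3(1)] \<mu>2(1)] cj3 by simp
  have eq: "\<theta>3 * \<mu>2 = \<theta>3 * \<theta>2 * \<theta>1 * \<mu>" by (simp add: \<mu>2_def \<mu>1_def mult.assoc)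
  have U: "\<theta>3 * \<theta>2 * \<theta>1 \<in> U" using \<theta>1 \<theta>2 \<theta>3 by (intro U_mult)
  have "\<theta>3 * \<mu>2 \<in> unit_domain a b"
    unfolding unit_domain_def mem_Collect_eq
  proof (intro conjI)
    show "\<theta>3 * \<mu>2 \<in> \<Lambda> a b" unfolding eq by (rule \<Lambda>_mult[OF \<mu>(1) U_L[OF U]])
    show "0 < cj (\<theta>3 * \<mu>2)" unfolding cj\<mu>3 using \<mu>2 \<theta>3 by simp
    show "cj (\<theta>3 * \<mu>2) \<le> \<theta>3 * \<mu>2"
      unfolding cj\<mu>3 using ge \<mu>2 \<theta>3 by (simp add: field_simps power2_eq_square)
    show "\<theta>3 * \<mu>2 < (\<epsilon>\<^sup>2)\<^sup>2 * cj (\<theta>3 * \<mu>2)"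
      unfolding cj\<mu>3 E_def[symmetric] using lt \<mu>2 \<theta>3 by (simp add: field_simps power2_eq_square)
  qed
  then show ?thesis unfolding eq using U by blast
qed

text \<open>Elements of the lattice are x a + y (\<omega> - b - 1), and they differ from their
  conjugates by y sqrt p. So the condition that the conjugate is at most the element makes y a
  natural number, the row index, with row offset y (\<omega> - b - 1).\<close>

lemma class_count:
  assumes v: "valid k a b"
  shows "card {A. (std_ideal k a b, A) \<in> ideal_class_rel p \<and> ideal_norm A \<le> X} =
    card (hyperbolic_sector.sector (\<epsilon>\<^sup>2) (real a) sq (\<lambda>y. of_nat y * (\<omega> - of_int b - 1)) (real a * real X))"
proof -
  have E: "hyperbolic_sector (\<epsilon>\<^sup>2)" by standard (use \<epsilon>_gt_1 in \<open>simp add: one_less_power\<close>)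
  have a: "real a > 0" and ad: "int a dvd root_poly q b" using v by (auto simp: valid_def)
  define g where "g = (\<lambda>(y :: nat, x). el (x * int a - int y * (b + 1)) (int y))"
  let ?S = "hyperbolic_sector.sector (\<epsilon>\<^sup>2) (real a) sq (\<lambda>y. of_nat y * (\<omega> - of_int b - 1)) (real a * real X)"
  let ?DX = "{\<mu> \<in> unit_domain a b. Nm \<mu> \<le> real a * real X}"
  have g1: "g (y, x) = of_int x * real a + of_nat y * (\<omega> - of_int b - 1)" for x y
    by (simp add: g_def el_def algebra_simps)
  have g2: "cj (g (y, x)) = g (y, x) - of_nat y * sq" for x y
    using el_minus_cj[of "x * int a - int y * (b + 1)" "int y"] by (simp add: g_def)
  have mem: "(y, x) \<in> ?S \<longleftrightarrow> g (y, x) \<in> ?DX" for x y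
  proof -
    have "g (y, x) \<in> \<Lambda> a b" unfolding \<Lambda>_eq[OF ad] g_def by auto
    moreover have "cj (g (y, x)) \<le> g (y, x)" unfolding g2 by simp
    ultimately have "g (y, x) \<in> ?DX \<longleftrightarrow> 0 < cj (g (y, x)) \<and> g (y, x) < (\<epsilon>\<^sup>2)\<^sup>2 * cj (g (y, x)) \<and> g (y, x) * cj (g (y, x)) \<le> real a * real X"
      unfolding unit_domain_def Nm_def by blast
    then show ?thesis
      unfolding hyperbolic_sector.sector_def[OF E] g2 by (simp add: g1 Let_def)
  qed
  have "bij_betw g ?S ?DX"
  proof (rule bij_betw_imageI)
    show "inj_on g ?S"
    proof (rule inj_onI)
      fix s t assume "g s = g t"
      then show "s = t" using a by (cases s; cases t) (auto simp: g_def el_unique)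
    qed
    show "g ` ?S = ?DX"
    proof (intro equalityI subsetI)
      fix \<mu> assume \<mu>: "\<mu> \<in> ?DX"
      then have "\<mu> \<in> \<Lambda> a b" by (auto simp: unit_domain_def)
      then obtain x y where xy: "\<mu> = el (x * int a - y * (b + 1)) y" unfolding \<Lambda>_eq[OF ad] by blast
      have "cj \<mu> \<le> \<mu>" using \<mu> by (auto simp: unit_domain_def)
      then have "0 \<le> of_int y * sq" unfolding xy using el_minus_cj[of "x * int a - y * (b + 1)" y] by linarith
      then have "0 \<le> y" using sq(2) by (simp add: zero_le_mult_iff)
      then have "\<mu> = g (nat y, x)" unfolding xy g_def by simp
      then show "\<mu> \<in> g ` ?S" using mem \<mu> by blast
    next
      fix \<mu> assume "\<mu> \<in> g ` ?S"
      then obtain y x where "\<mu> = g (y, x)" "(y, x) \<in> ?S" by (auto simp: image_iff)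
      then show "\<mu> \<in> ?DX" using mem by blast
    qed
  qed
  then have c1: "card ?S = card ?DX" by (rule bij_betw_same_card)
  have nz: "\<mu> \<noteq> 0" and pos: "Nm \<mu> > 0" if "\<mu> \<in> unit_domain a b" for \<mu>
    using that by (auto simp: unit_domain_def Nm_def)
  have le_iff: "ideal_norm (scaled_ideal k a b \<mu>) \<le> X \<longleftrightarrow> Nm \<mu> \<le> real a * real X" if "\<mu> \<in> unit_domain a b" for \<mu>
  proof -
    have "real (ideal_norm (scaled_ideal k a b \<mu>)) = Nm \<mu> / real a"
      using ideal_norm_scaled_ideal[OF v _ nz[OF that]] pos[OF that] that by (auto simp: unit_domain_def)
    then have "real (ideal_norm (scaled_ideal k a b \<mu>)) \<le> real X \<longleftrightarrow> Nm \<mu> / real a \<le> real X" by simp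
    also have "\<dots> \<longleftrightarrow> Nm \<mu> \<le> real X * real a" using a by (rule pos_divide_le_eq)
    finally show ?thesis by (simp add: mult.commute)
  qed
  have "bij_betw (scaled_ideal k a b) ?DX {A. (std_ideal k a b, A) \<in> ideal_class_rel p \<and> ideal_norm A \<le> X}"
  proof (rule bij_betw_imageI)
    show "inj_on (scaled_ideal k a b) ?DX"
    proof (rule inj_onI)
      fix \<mu> \<nu> assume *: "\<mu> \<in> ?DX" "\<nu> \<in> ?DX" "scaled_ideal k a b \<mu> = scaled_ideal k a b \<nu>"
      then have D: "\<mu> \<in> unit_domain a b" "\<nu> \<in> unit_domain a b" by auto
      then have \<Lambda>: "\<mu> \<in> \<Lambda> a b" "\<nu> \<in> \<Lambda> a b" by (auto simp: unit_domain_def)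
      obtain \<theta> where "\<theta> \<in> U" "\<nu> = \<theta> * \<mu>"
        using scaled_ideal_eq_imp_unit[OF v \<Lambda>(1) nz[OF D(1)] \<Lambda>(2) nz[OF D(2)] *(3)[symmetric]] by blast
      then show "\<mu> = \<nu>" using unit_domain_unique[OF D] by simp
    qed
    show "scaled_ideal k a b ` ?DX = {A. (std_ideal k a b, A) \<in> ideal_class_rel p \<and> ideal_norm A \<le> X}"
    proof (intro equalityI subsetI)
      fix A assume "A \<in> scaled_ideal k a b ` ?DX"
      then obtain \<mu> where \<mu>: "\<mu> \<in> unit_domain a b" "Nm \<mu> \<le> real a * real X" "A = scaled_ideal k a b \<mu>" by blast
      have "\<mu> \<in> \<Lambda> a b" using \<mu> by (auto simp: unit_domain_def)
      then have "(std_ideal k a b, A) \<in> ideal_class_rel p" unfolding class_rel_iff[OF v] using \<mu> nz by blast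
      then show "A \<in> {A. (std_ideal k a b, A) \<in> ideal_class_rel p \<and> ideal_norm A \<le> X}" using \<mu> le_iff by blast
    next
      fix A assume "A \<in> {A. (std_ideal k a b, A) \<in> ideal_class_rel p \<and> ideal_norm A \<le> X}"
      then have A: "(std_ideal k a b, A) \<in> ideal_class_rel p" "ideal_norm A \<le> X" by auto
      then obtain \<mu> where \<mu>: "\<mu> \<in> \<Lambda> a b" "\<mu> \<noteq> 0" "A = scaled_ideal k a b \<mu>" unfolding class_rel_iff[OF v] by blast
      obtain \<theta> where \<theta>: "\<theta> \<in> U" "\<theta> * \<mu> \<in> unit_domain a b" using unit_domain_exists[OF \<mu>(1,2)] by blast
      have "A = scaled_ideal k a b (\<theta> * \<mu>)" using scaled_ideal_unit[OF v \<mu>(1) \<theta>(1)] \<mu>(3) by simp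
      then show "A \<in> scaled_ideal k a b ` ?DX" using \<theta>(2) le_iff A(2) by blast
    qed
  qed
  from bij_betw_same_card[OF this] show ?thesis using c1 by simp
qed

text \<open>The factor a from the norm bound cancels the a in the spacing of the lattice, so the
  limit is the same for every class.\<close>

lemma class_count_asymp:
  assumes "I \<in> nonzero_ideals p"
  shows "(\<lambda>X. real (card {A. (I, A) \<in> ideal_class_rel p \<and> ideal_norm A \<le> X}) / real X) \<longlonglongrightarrow> 2 * ln \<epsilon> / sq"
proof -
  obtain k a b where v: "valid k a b" and I: "I = std_ideal k a b" using assms unfolding nonzero_ideals_eq by blast
  have E: "hyperbolic_sector (\<epsilon>\<^sup>2)" by standard (use \<epsilon>_gt_1 in \<open>simp add: one_less_power\<close>)
  have a: "real a > 0" using v by (simp add: valid_def)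
  let ?c = "\<lambda>Y. real (card (hyperbolic_sector.sector (\<epsilon>\<^sup>2) (real a) sq (\<lambda>y. of_nat y * (\<omega> - of_int b - 1)) Y))"
  have "((\<lambda>Y. ?c Y / Y) \<longlongrightarrow> ln (\<epsilon>\<^sup>2) / (real a * sq)) at_top"
    by (rule hyperbolic_sector.sector_asymp[OF E a sq(2)])
  moreover have "filterlim (\<lambda>X. real a * real X) at_top sequentially"
    using a by (intro filterlim_tendsto_pos_mult_at_top[OF tendsto_const] filterlim_real_sequentially)
  ultimately have "(\<lambda>X. ?c (real a * real X) / (real a * real X)) \<longlonglongrightarrow> ln (\<epsilon>\<^sup>2) / (real a * sq)"
    by (rule filterlim_compose)
  then have "(\<lambda>X. real a * (?c (real a * real X) / (real a * real X))) \<longlonglongrightarrow> real a * (ln (\<epsilon>\<^sup>2) / (real a * sq))"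
    by (intro tendsto_mult tendsto_const)
  moreover have "ln (\<epsilon>\<^sup>2) = 2 * ln \<epsilon>" using \<epsilon>_gt_1 by (simp add: ln_realpow)
  ultimately show ?thesis unfolding I class_count[OF v] using a by simp
qed

lemma equiv_class_rel: "equiv (nonzero_ideals p) (ideal_class_rel p)"
proof (rule equivI)
  show sub: "ideal_class_rel p \<subseteq> nonzero_ideals p \<times> nonzero_ideals p" by (auto simp: ideal_class_rel_def)
  show "refl_on (nonzero_ideals p) (ideal_class_rel p)"
    by (rule refl_onI) (auto simp: ideal_class_rel_def carrier_eq_L intro!: bexI[of _ 1])
  show "sym (ideal_class_rel p)"
    by (rule symI) (fastforce simp: ideal_class_rel_def)
  show "trans (ideal_class_rel p)"
  proof (rule transI)
    fix I J K assume IJ: "(I, J) \<in> ideal_class_rel p" and JK: "(J, K) \<in> ideal_class_rel p"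
    obtain \<alpha> \<beta> where 1: "\<alpha> \<in> L" "\<alpha> \<noteq> 0" "\<beta> \<in> L" "\<beta> \<noteq> 0" "(*) \<alpha> ` I = (*) \<beta> ` J"
      using IJ unfolding ideal_class_rel_def carrier_eq_L by blast
    obtain \<gamma> \<delta> where 2: "\<gamma> \<in> L" "\<gamma> \<noteq> 0" "\<delta> \<in> L" "\<delta> \<noteq> 0" "(*) \<gamma> ` J = (*) \<delta> ` K"
      using JK unfolding ideal_class_rel_def carrier_eq_L by blast
    have "(*) (\<gamma> * \<alpha>) ` I = (*) \<gamma> ` ((*) \<alpha> ` I)" by (simp add: image_image mult.assoc)
    also have "\<dots> = (*) \<beta> ` ((*) \<gamma> ` J)" unfolding 1(5) by (simp add: image_image mult.left_commute)
    also have "\<dots> = (*) (\<beta> * \<delta>) ` K" unfolding 2(5) by (simp add: image_image mult.assoc)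
    finally have "(*) (\<gamma> * \<alpha>) ` I = (*) (\<beta> * \<delta>) ` K" .
    moreover have "\<gamma> * \<alpha> \<in> L - {0}" "\<beta> * \<delta> \<in> L - {0}" using 1 2 by (auto intro: L_mult)
    ultimately show "(I, K) \<in> ideal_class_rel p"
      using IJ JK unfolding ideal_class_rel_def carrier_eq_L by blast
  qed
qed

text \<open>Any finite set of classes accounts for at most all ideals, which bounds its size by l/c;
  hence there are finitely many classes, and summing over all of them gives equality. Finiteness
  must be proved since \<open>card\<close> is 0 on infinite sets.\<close>

theorem class_number_formula:
  assumes l: "S \<longlonglongrightarrow> l"
  shows "real (class_number p) * (2 * ln \<epsilon> / sq) = l"
proof -
  define cl where "cl = nonzero_ideals p // ideal_class_rel p"
  define c where "c = 2 * ln \<epsilon> / sq"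
  have c: "c > 0" using \<epsilon>_gt_1 sq(2) by (simp add: c_def)
  define cnt where "cnt C X = card {A \<in> C. ideal_norm A \<le> X}" for C X
  define T where "T X = {I \<in> nonzero_ideals p. ideal_norm I \<le> X}" for X
  have finT: "finite (T X)" and cardT: "int (card (T X)) = (\<Sum>m=1..X. r m)" for X
    using bij_betw_finite[OF bij_triples[of X]] bij_betw_same_card[OF bij_triples[of X]] card_triples[of X]
    by (auto simp: T_def)
  have T_lim: "(\<lambda>X. real (card (T X)) / real X) \<longlonglongrightarrow> l"
  proof -
    have "real (card (T X)) = of_int (\<Sum>m=1..X. r m)" for X unfolding cardT[symmetric] by simp
    then show ?thesis using sum_r_asymp[OF l] by simp
  qed
  have cnt_lim: "(\<lambda>X. real (cnt C X) / real X) \<longlonglongrightarrow> c" if C: "C \<in> cl" for C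
  proof -
    obtain I where "I \<in> nonzero_ideals p" "C = ideal_class_rel p `` {I}" using C unfolding cl_def by (elim quotientE)
    then show ?thesis using class_count_asymp[of I] by (simp add: cnt_def c_def Image_singleton)
  qed
  have sum_cnt: "(\<Sum>C\<in>D. cnt C X) = card (\<Union>C\<in>D. {A \<in> C. ideal_norm A \<le> X})" if D: "finite D" "D \<subseteq> cl" for D X
    unfolding cnt_def
  proof (rule card_UN_disjoint[symmetric])
    show "\<forall>C\<in>D. finite {A \<in> C. ideal_norm A \<le> X}"
    proof
      fix C assume "C \<in> D"
      then have "C \<subseteq> nonzero_ideals p"
        using D(2) Union_quotient[OF equiv_class_rel] unfolding cl_def by blast
      then show "finite {A \<in> C. ideal_norm A \<le> X}" by (intro finite_subset[OF _ finT[of X]]) (auto simp: T_def)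
    qed
    show "\<forall>i\<in>D. \<forall>j\<in>D. i \<noteq> j \<longrightarrow> {A \<in> i. ideal_norm A \<le> X} \<inter> {A \<in> j. ideal_norm A \<le> X} = {}"
    proof (intro ballI impI)
      fix i j assume "i \<in> D" "j \<in> D" "i \<noteq> j"
      then have "i \<inter> j = {}" using quotient_disj[OF equiv_class_rel, of i j] D(2) unfolding cl_def by blast
      then show "{A \<in> i. ideal_norm A \<le> X} \<inter> {A \<in> j. ideal_norm A \<le> X} = {}" by blast
    qed
  qed (use D in auto)
  have sum_lim: "(\<lambda>X. real (\<Sum>C\<in>D. cnt C X) / real X) \<longlonglongrightarrow> real (card D) * c" if D: "finite D" "D \<subseteq> cl" for D
  proof -
    have "(\<lambda>X. \<Sum>C\<in>D. real (cnt C X) / real X) \<longlonglongrightarrow> (\<Sum>C\<in>D. c)"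
      using D by (intro tendsto_sum cnt_lim) auto
    then show ?thesis by (simp add: sum_divide_distrib)
  qed
  have bound: "real (card D) * c \<le> l" if D: "finite D" "D \<subseteq> cl" for D
  proof (rule LIMSEQ_le[OF sum_lim[OF D] T_lim], intro exI allI impI)
    fix X :: nat
    have "(\<Union>C\<in>D. {A \<in> C. ideal_norm A \<le> X}) \<subseteq> T X"
      using D(2) Union_quotient[OF equiv_class_rel] unfolding cl_def T_def by blast
    then have "(\<Sum>C\<in>D. cnt C X) \<le> card (T X)" unfolding sum_cnt[OF D] by (rule card_mono[OF finT])
    then show "real (\<Sum>C\<in>D. cnt C X) / real X \<le> real (card (T X)) / real X"
      by (intro divide_right_mono) (auto simp only: of_nat_le_iff of_nat_0_le_iff)
  qed
  have fin: "finite cl"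
  proof (rule ccontr)
    assume "infinite cl"
    obtain m :: nat where m: "l / c < real m" using reals_Archimedean2 by blast
    obtain D where D: "finite D" "card D = m" "D \<subseteq> cl" using infinite_arbitrarily_large[OF \<open>infinite cl\<close>] by blast
    have "real m * c \<le> l" using bound[OF D(1,3)] D(2) by simp
    then show False using m c by (simp add: field_simps)
  qed
  have "(\<Sum>C\<in>cl. cnt C X) = card (T X)" for X
  proof -
    have "(\<Union>C\<in>cl. {A \<in> C. ideal_norm A \<le> X}) = T X"
      using Union_quotient[OF equiv_class_rel] unfolding cl_def T_def by blast
    then show ?thesis using sum_cnt[OF fin order_refl] by simp
  qed
  then have "(\<lambda>X. real (card (T X)) / real X) \<longlonglongrightarrow> real (card cl) * c"
    using sum_lim[OF fin order_refl] by simp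
  then have "real (card cl) * c = l" using T_lim LIMSEQ_unique by blast
  then show ?thesis by (simp add: class_number_def cl_def c_def)
qed

end

section \<open>The determinant formulas\<close>

lemma (in odd_prime) root_of_unity_cis: "root_of_unity p (cis (2 * pi / real p))"
proof (rule root_of_unity.intro[OF odd_prime_axioms root_of_unity_axioms.intro])
  have "real p * (2 * pi / real p) = 2 * pi" using p_gt_3 by simp
  then have "cis (real p * (2 * pi / real p)) = 1" by (metis cis_2pi)
  then show "cis (2 * pi / real p) ^ p = 1" using Complex.DeMoivre[of "2 * pi / real p" p] by metis
  have "sin (2 * pi / real p) > 0"
    using p_gt_3 by (intro sin_gt_zero) (auto simp: field_simps)
  then show "cis (2 * pi / real p) \<noteq> 1" by (auto simp: complex_eq_iff)
qed

text \<open>The square of the Gauss sum leaves a sign open. Replacing \<open>z\<close> by its power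
  with nonresidue exponent changes that sign, so no determination of the sign is required.\<close>

lemma (in odd_prime) root_of_unity_exists:
  assumes "chi (- 1) = 1"
  shows "\<exists>z. root_of_unity p z \<and> root_of_unity.G p z = of_real (sqrt (real p))"
proof -
  obtain z where z: "root_of_unity p z" using root_of_unity_cis by blast
  have "(root_of_unity.G p z)\<^sup>2 = of_nat p"
    using root_of_unity.gauss_sum_square[OF z] assms by simp
  also have "\<dots> = (of_real (sqrt (real p)))\<^sup>2"
    by (simp add: of_real_power[symmetric] del: of_real_power)
  finally consider "root_of_unity.G p z = of_real (sqrt (real p))" | "root_of_unity.G p z = - of_real (sqrt (real p))"
    by (auto simp: power2_eq_iff)
  then show ?thesis
  proof cases
    case 1 then show ?thesis using z by blast
  next
    case 2
    obtain g where g: "\<not> p dvd g" "chi (int g) = -1" using nonresidue_exists by blast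
    have zg: "root_of_unity p (z ^ g)"
    proof (rule root_of_unity.intro[OF odd_prime_axioms root_of_unity_axioms.intro])
      have "(z ^ g) ^ p = (z ^ p) ^ g" by (simp only: power_mult[symmetric] mult.commute)
      then show "(z ^ g) ^ p = 1" by (simp only: root_of_unity.z_p[OF z] power_one)
      show "z ^ g \<noteq> 1" using root_of_unity.zpow_eq_1_iff[OF z] g by simp
    qed
    have "root_of_unity.G p (z ^ g) = (\<Sum>m<p. of_int (chi (int m)) * z ^ (m * g))"
      unfolding root_of_unity.G_def[OF zg] by (simp add: power_mult[symmetric] mult.commute)
    also have "\<dots> = of_int (chi (int g)) * root_of_unity.G p z"
      by (rule root_of_unity.gauss_sum_twist[OF z])
    finally show ?thesis using zg g 2 by auto
  qed
qed

section \<open>Identification of the determinant values with the coefficients of the unit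
  power\<close>

locale real_gauss_sum = prime_1_mod_4 + root_of_unity +
  assumes G_eq: "G = of_real sq"
begin

lemma chi_m1: "chi (- 1) = 1"
proof -
  have "even n" using p_mod_4 p_eq by presburger
  then show ?thesis by (simp add: chi_minus_1)
qed

definition A :: real where "A = (norm \<nu> - norm \<rho>) / (2 * sq)"
definition B :: real where "B = (norm \<rho> + norm \<nu>) / (2 * real p)"

lemma norm_prod: "norm \<rho> * norm \<nu> = real p"
  using \<rho>_\<nu> by (metis norm_mult norm_of_nat)

lemma norms_pos: "norm \<rho> > 0" "norm \<nu> > 0"
  using \<rho>_real[OF chi_m1] \<nu>_real[OF chi_m1] by auto

lemma \<rho>_eq: "\<rho> = of_real (norm \<rho>)" and \<nu>_eq: "\<nu> = of_real (norm \<nu>)"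
  using \<rho>_real[OF chi_m1] \<nu>_real[OF chi_m1] by auto

lemma A_B: "A + B * sq = norm \<nu> / sq"
proof -
  have "t / (2 * (s * s)) * s = t / (2 * s)" if "s > 0" for s t :: real
    using that by (simp add: field_simps)
  from this[OF sq(2), of "norm \<rho> + norm \<nu>"] have "B * sq = (norm \<rho> + norm \<nu>) / (2 * sq)"
    unfolding B_def sq(1) .
  then show ?thesis unfolding A_def using sq(2) by (simp add: field_simps)
qed

text \<open>The two squares of nu - rho and nu + rho differ by four times rho nu = p.\<close>

lemma A_B_norm: "A\<^sup>2 - real p * B\<^sup>2 = - 1"
proof -
  have p0: "real p > 0" using p_gt_3 by simp
  have A2: "A\<^sup>2 = (norm \<nu> - norm \<rho>)\<^sup>2 / (4 * real p)"
    unfolding A_def using sq(1) by (simp add: power_divide power_mult_distrib)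
  have B2: "real p * B\<^sup>2 = (norm \<rho> + norm \<nu>)\<^sup>2 / (4 * real p)"
    unfolding B_def using p0 by (simp add: power_divide power_mult_distrib power2_eq_square)
  have "(norm \<nu> - norm \<rho>)\<^sup>2 - (norm \<rho> + norm \<nu>)\<^sup>2 = - (4 * (norm \<rho> * norm \<nu>))"
    by (simp add: power2_eq_square algebra_simps)
  then have "A\<^sup>2 - real p * B\<^sup>2 = - (4 * real p) / (4 * real p)"
    unfolding A2 B2 diff_divide_distrib[symmetric] norm_prod by simp
  then show ?thesis using p0 by simp
qed

lemma G2: "G\<^sup>2 = of_nat p"
  using gauss_sum_square chi_m1 by simp

lemma complex_A_B: "(\<nu> - \<rho>) / (2 * G) = of_real A" "(\<rho> + \<nu>) / (2 * of_nat p) = of_real B"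
  unfolding A_def B_def G_eq by (subst (1) \<rho>_eq, subst (1) \<nu>_eq, simp)+

lemmas hankel_dets = hankel_dets_1_mod_4[OF p_mod_4 G2, unfolded complex_A_B]

text \<open>The n by n determinants are, up to sign, 2^n B and 2^n A, while
  \<open>det_legendre_parity\<close> shows them to be integer multiples of 2^(n-1).\<close>

lemma A_B_half_integers: "\<exists>a b :: int. 2 * A = of_int a \<and> 2 * B = of_int b"
proof -
  obtain a b where ab: "det (mat n n (\<lambda>(j, k). chi (int (j + k + 1)))) = 2 ^ (n - 1) * a"
    "det (mat n n (\<lambda>(j, k). chi (int (j + k + 1)) + 1)) - det (mat n n (\<lambda>(j, k). chi (int (j + k + 1)))) = 2 ^ (n - 1) * b"
    using det_legendre_parity by blast
  have H0: "H n 0 = of_int (2 ^ (n - 1) * a)" using H_of_int[of n 0] ab(1) by simp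
  have H1: "H n 1 - H n 0 = of_int (2 ^ (n - 1) * b)"
    using H_of_int[of n 0] H_of_int[of n 1] ab(2) by (simp only: of_int_diff[symmetric] of_int_0 of_int_1 add_0_right)
  have pw: "(2 :: complex) ^ n = 2 ^ (n - 1) * 2" using n_ge_2 by (cases n) auto
  have "\<not> int p dvd 2" using p_gt_3 by (auto dest!: zdvd_imp_le)
  then have ss: "chi 2 * chi 2 = 1" by (rule chi_square)
  have "of_int (2 ^ (n - 1) * a) = of_int (chi 2) * (2 ^ (n - 1) * 2) * complex_of_real B"
    using hankel_dets(1) unfolding H0 pw .
  then have "(2 ^ (n - 1)) * complex_of_real (of_int a) = (2 ^ (n - 1)) * complex_of_real (of_int (chi 2) * (2 * B))"
    by (simp add: algebra_simps)
  then have "of_int a = of_int (chi 2) * (2 * B)" by (simp only: mult_cancel_left of_real_eq_iff) simp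
  then have "of_int (chi 2 * a) = of_int (chi 2 * chi 2) * (2 * B)" by (simp add: mult.assoc)
  then have 1: "2 * B = of_int (chi 2 * a)" unfolding ss by simp
  have "of_int (2 ^ (n - 1) * b) = - (of_int (chi 2) * (2 ^ (n - 1) * 2) * complex_of_real A)"
    using hankel_dets(2) unfolding H1 pw .
  then have "(2 ^ (n - 1)) * complex_of_real (of_int b) = (2 ^ (n - 1)) * complex_of_real (of_int (chi 2) * (- (2 * A)))"
    by (simp add: algebra_simps)
  then have "of_int b = of_int (chi 2) * (- (2 * A))" by (simp only: mult_cancel_left of_real_eq_iff) simp
  then have "of_int (chi 2 * b) = of_int (chi 2 * chi 2) * (- (2 * A))" by (simp add: mult.assoc)
  then have 2: "2 * A = of_int (- (chi 2 * b))" unfolding ss by simp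
  show ?thesis using 1 2 by blast
qed

text \<open>The unit is A + B sqrt p itself: a = 2A and b = 2B satisfy a^2 - p b^2 = -4, hence have
  equal parity, and with a = b + 2c the number becomes c + b \<omega>.\<close>

lemma norm_minus_one_unit: "\<exists>\<eta>. \<eta> \<in> L \<and> Nm \<eta> = - 1"
proof -
  obtain a b :: int where ab: "2 * A = of_int a" "2 * B = of_int b" using A_B_half_integers by blast
  have "of_int (a * a - int p * (b * b)) = (2 * A) * (2 * A) - real p * ((2 * B) * (2 * B))"
    unfolding ab by simp
  also have "\<dots> = 4 * (A\<^sup>2 - real p * B\<^sup>2)" by (simp add: power2_eq_square algebra_simps)
  also have "\<dots> = of_int (- 4)" unfolding A_B_norm by simp
  finally have eq: "a * a - int p * (b * b) = - 4" by (simp only: of_int_eq_iff)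
  have eq': "a * a = (4 * q + 1) * (b * b) - 4" using eq unfolding p_eq_q by linarith
  then have "even (a * a) \<longleftrightarrow> even (b * b)" by simp
  then have "even (a - b)" by simp
  then obtain c where c: "a = b + 2 * c" by (metis add.commute diff_add_cancel dvdE)
  define X where "X = c * c + c * b - q * b * b"
  have "4 * X = a * a - (4 * q + 1) * (b * b)" unfolding c X_def by (simp add: algebra_simps)
  also have "\<dots> = - 4" unfolding eq' by simp
  finally have "4 * X = - 4" .
  then have "X = - 1" by linarith
  then have "Nm (el c b) = - 1" unfolding Nm_el X_def by (metis of_int_1 of_int_minus)
  then show ?thesis by blast
qed

sublocale negative_norm_unit
  by unfold_locales (rule norm_minus_one_unit)

text \<open>The class number formula gives 2 h ln \<epsilon> = ln nu - ln rho. With ln rho + ln nu =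
  ln p, this becomes h ln \<epsilon> = ln (nu / sqrt p).\<close>

lemma \<epsilon>_power: "\<epsilon> ^ class_number p = A + B * sq"
proof -
  have "real (class_number p) * (2 * ln \<epsilon> / sq) = (ln (norm \<nu>) - ln (norm \<rho>)) / sq"
    by (rule class_number_formula[OF S_limit[OF chi_m1 G_eq]])
  then have "2 * (real (class_number p) * ln \<epsilon>) = ln (norm \<nu>) - ln (norm \<rho>)"
    using sq(2) by (simp add: field_simps)
  moreover have "ln (norm \<rho>) + ln (norm \<nu>) = ln (real p)"
    using norms_pos unfolding norm_prod[symmetric] by (simp add: ln_mult)
  moreover have "ln (real p) = 2 * ln sq"
    using p_gt_3 by (simp add: ln_sqrt)
  ultimately have "real (class_number p) * ln \<epsilon> = ln (norm \<nu>) - ln sq" by linarith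
  then have "ln (\<epsilon> ^ class_number p) = ln (norm \<nu> / sq)"
    using \<epsilon>_gt_1 norms_pos sq(2) by (simp add: ln_realpow ln_div)
  moreover have "\<epsilon> ^ class_number p > 0" "norm \<nu> / sq > 0" using \<epsilon>_gt_1 norms_pos sq(2) by simp_all
  ultimately have "\<epsilon> ^ class_number p = norm \<nu> / sq" by simp
  then show ?thesis by (simp add: A_B)
qed

lemma half_int_rat: "2 * x \<in> \<int> \<Longrightarrow> (x :: real) \<in> \<rat>"
proof -
  assume "2 * x \<in> \<int>"
  then obtain m where "2 * x = of_int m" by (elim Ints_cases)
  then have "x = of_int m / of_int 2" by simp
  then show ?thesis by (metis Rats_divide Rats_of_int)
qed

lemma coeffs: "coeff_a p = A" "coeff_b p = B"
proof -
  have AB: "2 * A \<in> \<int>" "2 * B \<in> \<int>" using A_B_half_integers by auto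
  have eq: "fundamental_unit p ^ class_number p = A + B * sq" using \<epsilon>_power unfolding \<epsilon>_def .
  have uniq: "a = A \<and> b = B" if "2 * a \<in> \<int>" "2 * b \<in> \<int>" "fundamental_unit p ^ class_number p = a + b * sq" for a b
    by (rule rat_sq_unique) (use that AB eq half_int_rat in auto)
  show "coeff_a p = A" unfolding coeff_a_def by (rule the_equality) (use AB eq uniq in blast)+
  show "coeff_b p = B" unfolding coeff_b_def by (rule the_equality) (use AB eq uniq in blast)+
qed

end

theorem theorem1p4:
  fixes p :: nat and x y z :: complex
  assumes "prime p" and "p > 3"
  shows "det (legendre_mat p x y z ((p - 1) div 2)) =
           (if [p = 1] (mod 4)
            then of_int (Legendre 2 (int p)) * 2 ^ ((p - 1) div 2) *
                   ((y * z - x) * of_real (coeff_a p) + (y + 1) * (z + 1) * of_real (coeff_b p))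
            else 2 ^ ((p - 1) div 2) * (y * z - x))
       \<and> det (legendre_mat p x y z ((p + 1) div 2)) =
           (if [p = 1] (mod 4)
            then of_int (Legendre 2 (int p)) * 2 ^ ((p - 1) div 2) *
                   (of_nat p * of_real (coeff_b p) * (x - y * z)
                      - of_real (coeff_a p) * (y + 1) * (z + 1))
            else 2 ^ ((p - 1) div 2) * (y + 1) * (z + 1))"
proof -
  have op: "odd_prime p" by (unfold_locales) (use assms in auto)
  define m where "m = (p - 1) div 2"
  have mn: "odd_prime.n p = m" by (simp add: odd_prime.n_def[OF op] m_def)
  have m0: "m > 0" using assms by (simp add: m_def)
  have m1: "(p + 1) div 2 = m + 1" unfolding m_def using assms by (cases p) auto
  have odd: "odd p" using assms by (simp add: prime_odd_nat)
  have cong: "[p = 1] (mod 4) \<longleftrightarrow> p mod 4 = 1" by (simp add: unique_euclidean_semiring_class.cong_def)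
  show ?thesis
  proof (cases "p mod 4 = 1")
    case True
    have p1: "prime_1_mod_4 p" by (rule prime_1_mod_4.intro[OF op]) (unfold_locales, rule True)
    have "odd_prime.n p = 2 * ((p - 1) div 4)" unfolding mn m_def using True by presburger
    then have "Legendre (- 1) (int p) = 1" using odd_prime.chi_minus_1[OF op] by simp
    then obtain w where w: "root_of_unity p w" "root_of_unity.G p w = of_real (sqrt (real p))"
      using odd_prime.root_of_unity_exists[OF op] by blast
    have gs: "real_gauss_sum p w"
      by (intro real_gauss_sum.intro p1 w(1) real_gauss_sum_axioms.intro w(2))
    note d = real_gauss_sum.hankel_dets[OF gs, unfolded mn real_gauss_sum.coeffs[OF gs, symmetric]]
    note e = root_of_unity.det_legendre_mat[OF w(1)]
    have "m + 1 > 0" by simp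
    note e' = e[OF this]
    show ?thesis
      unfolding m1 m_def[symmetric] cong if_P[OF True] e[OF m0] e' d(2,4) unfolding d(1,3)
      by (simp add: algebra_simps)
  next
    case False
    then have p3: "p mod 4 = 3" using odd by presburger
    obtain w where w: "root_of_unity p w" using odd_prime.root_of_unity_cis[OF op] by blast
    note d = root_of_unity.hankel_dets_3_mod_4[OF w p3, unfolded mn]
    note e = root_of_unity.det_legendre_mat[OF w]
    have "m + 1 > 0" by simp
    note e' = e[OF this]
    show ?thesis
      unfolding m1 m_def[symmetric] cong if_not_P[OF False] e[OF m0] e' d
      by (simp add: algebra_simps)
  qed
qed

end
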